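(* Let $(A_k)$ be the iterates of the topological gradient descent algorithm described in the context, with parameters $\tau\in(0,1)$, $\sigma\in(0,1)$, $\delta_{\mathrm{tol}}\ge0$ and initial set $A_0\subset\Omega$. Then exactly one of the following statements is true: (i) The algorithm returns after $m\in\mathbb N$ iterations with a $\delta_{\mathrm{tol}}$-solution $A_m$ of $\min_{A\subset\Omega}J(A)$, i.e. $J(A_m)\le\inf_{B\subset\Omega}J(B)+\delta_{\mathrm{tol}}$. (ii) The algorithm produces an infinite sequence $(A_k)$ with $\lim_{k\to\infty}\|\rho_k\|_{L^1(\Omega)}=0$, and $(A_k)$ is a minimizing sequence, i.e. $\lim_{k\to\infty}J(A_k)=\inf_{B\subset\Omega}J(B)$. In particular, if $\delta_{\mathrm{tol}}>0$ then the algorithm terminates after finitely many iterations.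
   Context: Setting: $\Omega\subset\mathbb R^d$ is Lebesgue measurable with $|\Omega|<\infty$ ($|\cdot|$ is Lebesgue measure); all subsets of $\Omega$ considered are Lebesgue measurable. $Y$ is a real Hilbert space, $S:L^2(\Omega)\to Y$ is bounded linear with Hilbert space adjoint $S^*:Y\to L^2(\Omega)$, and $y_d\in Y$. $g:\mathbb R\to\mathbb R\cup\{+\infty\}$ is proper, convex, lower semicontinuous, $g\ge0$, and $g(u)=0$ if and only if $u=0$; $\operatorname{dom}g=\{u:g(u)<+\infty\}$. $\beta\in L^1(\Omega)$. In addition, one of the following two sets of assumptions holds: (a) there is $\mu>0$ such that $\frac\mu2\lambda(1-\lambda)|u-v|^2+g(\lambda u+(1-\lambda)v)\le\lambda g(u)+(1-\lambda)g(v)$ for all $u,v\in\operatorname{dom}g$, $\lambda\in(0,1)$, and there is $q>6$ such that $S^*S$ is a bounded linear map from $L^2(\Omega)$ to $L^q(\Omega)$ and $S^*y_d\in L^q(\Omega)$; or (b) $\operatorname{dom}g$ is bounded and there is $q>3$ such that $S^*$ is a bounded linear map from $Y$ to $L^q(\Omega)$. Notation: for $u\in L^2(\Omega)$ and $A\subset\Omega$, $J(u,A):=\frac12\|S(\chi_Au)-y_d\|_Y^2+\int_\Omega g(u(x))+\chi_A(x)\beta(x)\,dx$. $(\mathbf P_A)$ is the problem $\min_{u\in L^2(\Omega)}J(u,A)$, and $J(A):=\min_{u\in L^2(\Omega)}J(u,A)$. A solution of $(\mathbf P_A)$ is a triple $(u_A,y_A,p_A)$ where $u_A$ is a minimizer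 of $J(\cdot,A)$ with $\chi_Au_A=u_A$, $y_A:=S(\chi_Au_A)$ and $p_A:=S^*(y_A-y_d)$. $\bar H(p):=\min_{u\in\mathbb R}(pu+g(u))$. The topological derivative of $J$ at $A$ is, for almost all $x\in\Omega$, $DJ(A)(x)=\beta(x)+\bar H(p_A(x))$ if $x\notin A$ and $DJ(A)(x)=-(\beta(x)+\bar H(p_A(x)))$ if $x\in A$. We write $a^-:=\min(a,0)$, and $\triangle$ for the symmetric difference of sets. Algorithm: choose $\tau,\sigma\in(0,1)$, $A_0\subset\Omega$, $\delta_{\mathrm{tol}}\ge0$, and set $k:=0$. Repeat: 1. Compute a solution $(u_k,y_k,p_k)$ of $(\mathbf P_{A_k})$ and $\rho_k:=(DJ(A_k))^-$. Let $R_k:=\{x:\rho_k(x)\ne0\}$. 2. If $\|\rho_k\|_{L^1(\Omega)}\le\delta_{\mathrm{tol}}$, return $A_k$. 3. (Line-search) For $t=1,\tau,\tau^2,\dots$ successively: compute $D_{k,t}$ as a solution of $\max\{\|\rho_k\|_{L^1(D)}: D\subset R_k,\ |D|\le t|R_k|\}$, and set $A_{k,t}:=A_k\triangle D_{k,t}$; stop at the first $t$ for which $$J(A_{k,t})\le J(A_k)+\sigma\int_\Omega|\chi_{A_{k,t}}-\chi_{A_k}|\,\rho_k\,dx.$$ 4. Set $t_k:=t$, $A_{k+1}:=A_{k,t_k}$, $k:=k+1$. *)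

theory Defs
  imports "HOL-Analysis.Analysis"
begin

text \<open>
  Lebesgue spaces over a measurable set \<open>\<Omega>\<close>. Elements are represented by functions
  on the whole space of which only the values on \<open>\<Omega>\<close> matter, and equality of elements is
  equality almost everywhere with respect to \<open>lebesgue_on \<Omega>\<close>. The exponent \<open>q\<close> is finite.
\<close>

definition Lp :: "'a::euclidean_space set \<Rightarrow> real \<Rightarrow> ('a \<Rightarrow> real) set" where
  "Lp \<Omega> q = {f. f \<in> borel_measurable (lebesgue_on \<Omega>) \<and>
                 integrable (lebesgue_on \<Omega>) (\<lambda>x. \<bar>f x\<bar> powr q)}"

definition Lp_norm :: "'a::euclidean_space set \<Rightarrow> real \<Rightarrow> ('a \<Rightarrow> real) \<Rightarrow> real" where
  "Lp_norm \<Omega> q f = (\<integral>x. \<bar>f x\<bar> powr q \<partial>lebesgue_on \<Omega>) powr (1 / q)"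

text \<open>
  The following three predicates say that an operator is bounded and linear. An operator that is
  linear and bounded in this sense automatically respects equality almost everywhere of its
  arguments.
\<close>

definition bounded_linear_from_Lp ::
  "'a::euclidean_space set \<Rightarrow> real \<Rightarrow> (('a \<Rightarrow> real) \<Rightarrow> 'y::real_normed_vector) \<Rightarrow> bool" where
  "bounded_linear_from_Lp \<Omega> q T \<longleftrightarrow>
     (\<forall>u\<in>Lp \<Omega> q. \<forall>v\<in>Lp \<Omega> q. T (\<lambda>x. u x + v x) = T u + T v) \<and>
     (\<forall>c. \<forall>u\<in>Lp \<Omega> q. T (\<lambda>x. c * u x) = c *\<^sub>R T u) \<and>
     (\<exists>C. \<forall>u\<in>Lp \<Omega> q. norm (T u) \<le> C * Lp_norm \<Omega> q u)"

definition bounded_linear_into_Lp ::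
  "'a::euclidean_space set \<Rightarrow> real \<Rightarrow> ('y::real_normed_vector \<Rightarrow> 'a \<Rightarrow> real) \<Rightarrow> bool" where
  "bounded_linear_into_Lp \<Omega> q T \<longleftrightarrow>
     (\<forall>y. T y \<in> Lp \<Omega> q) \<and>
     (\<forall>y z. AE x in lebesgue_on \<Omega>. T (y + z) x = T y x + T z x) \<and>
     (\<forall>c y. AE x in lebesgue_on \<Omega>. T (c *\<^sub>R y) x = c * T y x) \<and>
     (\<exists>C. \<forall>y. Lp_norm \<Omega> q (T y) \<le> C * norm y)"

definition bounded_linear_Lp_Lp ::
  "'a::euclidean_space set \<Rightarrow> real \<Rightarrow> real \<Rightarrow> (('a \<Rightarrow> real) \<Rightarrow> 'a \<Rightarrow> real) \<Rightarrow> bool" where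
  "bounded_linear_Lp_Lp \<Omega> r q T \<longleftrightarrow>
     (\<forall>u\<in>Lp \<Omega> r. T u \<in> Lp \<Omega> q) \<and>
     (\<forall>u\<in>Lp \<Omega> r. \<forall>v\<in>Lp \<Omega> r.
        AE x in lebesgue_on \<Omega>. T (\<lambda>x. u x + v x) x = T u x + T v x) \<and>
     (\<forall>c. \<forall>u\<in>Lp \<Omega> r. AE x in lebesgue_on \<Omega>. T (\<lambda>x. c * u x) x = c * T u x) \<and>
     (\<exists>C. \<forall>u\<in>Lp \<Omega> r. Lp_norm \<Omega> q (T u) \<le> C * Lp_norm \<Omega> r u)"

text \<open>The defining property determines \<open>T y\<close> up to equality almost everywhere.\<close>

definition is_L2_adjoint ::
  "'a::euclidean_space set \<Rightarrow> (('a \<Rightarrow> real) \<Rightarrow> 'y::real_inner) \<Rightarrow> ('y \<Rightarrow> 'a \<Rightarrow> real) \<Rightarrow> bool" where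
  "is_L2_adjoint \<Omega> S T \<longleftrightarrow>
     (\<forall>y. T y \<in> Lp \<Omega> 2) \<and>
     (\<forall>u\<in>Lp \<Omega> 2. \<forall>y. S u \<bullet> y = (\<integral>x. u x * T y x \<partial>lebesgue_on \<Omega>))"

definition edom :: "(real \<Rightarrow> ereal) \<Rightarrow> real set" where
  "edom g = {u. g u < \<infinity>}"

definition proper_fun :: "(real \<Rightarrow> ereal) \<Rightarrow> bool" where
  "proper_fun g \<longleftrightarrow> edom g \<noteq> {} \<and> (\<forall>u. g u \<noteq> -\<infinity>)"

definition convex_fun :: "(real \<Rightarrow> ereal) \<Rightarrow> bool" where
  "convex_fun g \<longleftrightarrow> (\<forall>u v. \<forall>l\<in>{0<..<1}.
     g (l * u + (1 - l) * v) \<le> ereal l * g u + ereal (1 - l) * g v)"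

definition lsc_fun :: "(real \<Rightarrow> ereal) \<Rightarrow> bool" where
  "lsc_fun g \<longleftrightarrow> (\<forall>u. g u \<le> Liminf (at u) g)"

definition strongly_convex_fun :: "real \<Rightarrow> (real \<Rightarrow> ereal) \<Rightarrow> bool" where
  "strongly_convex_fun \<mu> g \<longleftrightarrow> (\<forall>u\<in>edom g. \<forall>v\<in>edom g. \<forall>l\<in>{0<..<1}.
     ereal (\<mu> / 2 * l * (1 - l) * \<bar>u - v\<bar>\<^sup>2) + g (l * u + (1 - l) * v)
       \<le> ereal l * g u + ereal (1 - l) * g v)"

text \<open>
  Integral of an extended real function as the integral of its positive part minus the integral
  of its negative part; it is only used for functions with an integrable negative part.
\<close>

definition ereal_integral :: "'b measure \<Rightarrow> ('b \<Rightarrow> ereal) \<Rightarrow> ereal" where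
  "ereal_integral M f =
     enn2ereal (\<integral>\<^sup>+x. e2ennreal (f x) \<partial>M) - enn2ereal (\<integral>\<^sup>+x. e2ennreal (- f x) \<partial>M)"

definition cost ::
  "'a::euclidean_space set \<Rightarrow> (('a \<Rightarrow> real) \<Rightarrow> 'y::real_inner) \<Rightarrow> 'y \<Rightarrow> (real \<Rightarrow> ereal) \<Rightarrow>
   ('a \<Rightarrow> real) \<Rightarrow> ('a \<Rightarrow> real) \<Rightarrow> 'a set \<Rightarrow> ereal" where
  "cost \<Omega> S yd g \<beta> u A =
     ereal (1 / 2 * (norm (S (\<lambda>x. indicator A x * u x) - yd))\<^sup>2) +
     ereal_integral (lebesgue_on \<Omega>) (\<lambda>x. g (u x) + ereal (indicator A x * \<beta> x))"

text \<open>
  The minimal value is written as an infimum; that it is attained is not built into the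
  definition.
\<close>

definition opt_value ::
  "'a::euclidean_space set \<Rightarrow> (('a \<Rightarrow> real) \<Rightarrow> 'y::real_inner) \<Rightarrow> 'y \<Rightarrow> (real \<Rightarrow> ereal) \<Rightarrow>
   ('a \<Rightarrow> real) \<Rightarrow> 'a set \<Rightarrow> ereal" where
  "opt_value \<Omega> S yd g \<beta> A = (INF u\<in>Lp \<Omega> 2. cost \<Omega> S yd g \<beta> u A)"

definition inf_value ::
  "'a::euclidean_space set \<Rightarrow> (('a \<Rightarrow> real) \<Rightarrow> 'y::real_inner) \<Rightarrow> 'y \<Rightarrow> (real \<Rightarrow> ereal) \<Rightarrow>
   ('a \<Rightarrow> real) \<Rightarrow> ereal" where
  "inf_value \<Omega> S yd g \<beta> = (INF B\<in>{B \<in> sets lebesgue. B \<subseteq> \<Omega>}. opt_value \<Omega> S yd g \<beta> B)"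

definition is_solution ::
  "'a::euclidean_space set \<Rightarrow> (('a \<Rightarrow> real) \<Rightarrow> 'y::real_inner) \<Rightarrow> ('y \<Rightarrow> 'a \<Rightarrow> real) \<Rightarrow> 'y \<Rightarrow>
   (real \<Rightarrow> ereal) \<Rightarrow> ('a \<Rightarrow> real) \<Rightarrow> 'a set \<Rightarrow> ('a \<Rightarrow> real) \<Rightarrow> 'y \<Rightarrow> ('a \<Rightarrow> real) \<Rightarrow> bool" where
  "is_solution \<Omega> S Sadj yd g \<beta> A u y p \<longleftrightarrow>
     u \<in> Lp \<Omega> 2 \<and>
     (\<forall>v\<in>Lp \<Omega> 2. cost \<Omega> S yd g \<beta> u A \<le> cost \<Omega> S yd g \<beta> v A) \<and>
     (AE x in lebesgue_on \<Omega>. indicator A x * u x = u x) \<and>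
     y = S (\<lambda>x. indicator A x * u x) \<and>
     p \<in> Lp \<Omega> 2 \<and> (AE x in lebesgue_on \<Omega>. p x = Sadj (y - yd) x)"

definition Hbar :: "(real \<Rightarrow> ereal) \<Rightarrow> real \<Rightarrow> ereal" where
  "Hbar g p = (INF u. ereal (p * u) + g u)"

text \<open>The topological derivative at \<open>A\<close>, in terms of the adjoint state \<open>p\<close>.\<close>

definition topo_deriv ::
  "(real \<Rightarrow> ereal) \<Rightarrow> ('a \<Rightarrow> real) \<Rightarrow> 'a set \<Rightarrow> ('a \<Rightarrow> real) \<Rightarrow> 'a \<Rightarrow> real" where
  "topo_deriv g \<beta> A p x =
     (if x \<notin> A then \<beta> x + real_of_ereal (Hbar g (p x))
      else - (\<beta> x + real_of_ereal (Hbar g (p x))))"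

definition is_max_set ::
  "'a::euclidean_space set \<Rightarrow> ('a \<Rightarrow> real) \<Rightarrow> real \<Rightarrow> 'a set \<Rightarrow> bool" where
  "is_max_set \<Omega> \<rho> t D \<longleftrightarrow>
     (let R = {x \<in> \<Omega>. \<rho> x \<noteq> 0};
          admissible = {D \<in> sets lebesgue. D \<subseteq> R \<and> measure lebesgue D \<le> t * measure lebesgue R}
      in D \<in> admissible \<and> (\<forall>D'\<in>admissible. Lp_norm D' 1 \<rho> \<le> Lp_norm D 1 \<rho>))"

definition accepted ::
  "'a::euclidean_space set \<Rightarrow> (('a \<Rightarrow> real) \<Rightarrow> 'y::real_inner) \<Rightarrow> 'y \<Rightarrow> (real \<Rightarrow> ereal) \<Rightarrow>
   ('a \<Rightarrow> real) \<Rightarrow> real \<Rightarrow> 'a set \<Rightarrow> ('a \<Rightarrow> real) \<Rightarrow> 'a set \<Rightarrow> bool" where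
  "accepted \<Omega> S yd g \<beta> \<sigma> A \<rho> A' \<longleftrightarrow>
     opt_value \<Omega> S yd g \<beta> A' \<le> opt_value \<Omega> S yd g \<beta> A +
       ereal (\<sigma> * (\<integral>x. \<bar>indicator A' x - indicator A x\<bar> * \<rho> x \<partial>lebesgue_on \<Omega>))"

text \<open>
  The algorithm as a nondeterministic transition system. The number \<open>k\<close> counts completed
  iterations; \<open>Line_Search k A \<rho> n\<close> is the state in which the step size \<open>\<tau> ^ n\<close> is about to be
  tried. The solutions of the state problem and the sets \<open>D\<close> are chosen arbitrarily among the
  solutions of the respective problem. A state without successor which is not of the form
  \<open>Returned m A\<close>, or an unending line search, would be a failure of the algorithm.
\<close>

datatype 'a alg_state =
    Iterate nat "'a set"
  | Line_Search nat "'a set" "'a \<Rightarrow> real" nat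
  | Returned nat "'a set"

inductive alg_step ::
  "'a::euclidean_space set \<Rightarrow> (('a \<Rightarrow> real) \<Rightarrow> 'y::real_inner) \<Rightarrow> ('y \<Rightarrow> 'a \<Rightarrow> real) \<Rightarrow> 'y \<Rightarrow>
   (real \<Rightarrow> ereal) \<Rightarrow> ('a \<Rightarrow> real) \<Rightarrow> real \<Rightarrow> real \<Rightarrow> real \<Rightarrow> 'a alg_state \<Rightarrow> 'a alg_state \<Rightarrow> bool"
  for \<Omega> S Sadj yd g \<beta> \<tau> \<sigma> \<delta> where
  stop:
    "\<lbrakk>is_solution \<Omega> S Sadj yd g \<beta> A u y p; \<rho> = (\<lambda>x. min (topo_deriv g \<beta> A p x) 0);
      Lp_norm \<Omega> 1 \<rho> \<le> \<delta>\<rbrakk>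
     \<Longrightarrow> alg_step \<Omega> S Sadj yd g \<beta> \<tau> \<sigma> \<delta> (Iterate k A) (Returned k A)"
| continue:
    "\<lbrakk>is_solution \<Omega> S Sadj yd g \<beta> A u y p; \<rho> = (\<lambda>x. min (topo_deriv g \<beta> A p x) 0);
      \<not> Lp_norm \<Omega> 1 \<rho> \<le> \<delta>\<rbrakk>
     \<Longrightarrow> alg_step \<Omega> S Sadj yd g \<beta> \<tau> \<sigma> \<delta> (Iterate k A) (Line_Search k A \<rho> 0)"
| accept:
    "\<lbrakk>is_max_set \<Omega> \<rho> (\<tau> ^ n) D; A' = sym_diff A D; accepted \<Omega> S yd g \<beta> \<sigma> A \<rho> A'\<rbrakk>
     \<Longrightarrow> alg_step \<Omega> S Sadj yd g \<beta> \<tau> \<sigma> \<delta> (Line_Search k A \<rho> n) (Iterate (Suc k) A')"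
| reject:
    "\<lbrakk>is_max_set \<Omega> \<rho> (\<tau> ^ n) D; A' = sym_diff A D; \<not> accepted \<Omega> S yd g \<beta> \<sigma> A \<rho> A'\<rbrakk>
     \<Longrightarrow> alg_step \<Omega> S Sadj yd g \<beta> \<tau> \<sigma> \<delta> (Line_Search k A \<rho> n) (Line_Search k A \<rho> (Suc n))"

text \<open>Maximal executions; a state without successor is repeated forever.\<close>

definition execution :: "('s \<Rightarrow> 's \<Rightarrow> bool) \<Rightarrow> 's \<Rightarrow> (nat \<Rightarrow> 's) \<Rightarrow> bool" where
  "execution r s0 s \<longleftrightarrow> s 0 = s0 \<and>
     (\<forall>j. r (s j) (s (Suc j)) \<or> ((\<nexists>s'. r (s j) s') \<and> s (Suc j) = s j))"

definition returns :: "(nat \<Rightarrow> 'a alg_state) \<Rightarrow> nat \<Rightarrow> 'a set \<Rightarrow> bool" where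
  "returns s m A \<longleftrightarrow> (\<exists>j. s j = Returned m A)"

text \<open>
  The execution runs through infinitely many iterations, with iterates \<open>A k\<close> and functions \<open>\<rho> k\<close>.
  Each iteration that does not return visits exactly one state \<open>Line_Search k A \<rho> 0\<close>.
\<close>

definition infinite_iterates ::
  "(nat \<Rightarrow> 'a alg_state) \<Rightarrow> (nat \<Rightarrow> 'a set) \<Rightarrow> (nat \<Rightarrow> 'a \<Rightarrow> real) \<Rightarrow> bool" where
  "infinite_iterates s A \<rho> \<longleftrightarrow> (\<forall>k. \<exists>j. s j = Line_Search k (A k) (\<rho> k) 0)"

end

theory Submission
  imports Defs
begin

text \<open>
  Two estimates for the optimal value carry the convergence proof. Let \<open>u\<close> be optimal for the
  set \<open>A\<close>, with adjoint state \<open>p\<close>. The tracking term is quadratic, so the cost of any control \<open>v\<close> for any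
  set \<open>B\<close> can be expanded exactly around \<open>(u, A)\<close>, and the pointwise minimum principle for \<open>u\<close>
  identifies the first-order part as the integral of the topological derivative over the symmetric
  difference of \<open>A\<close> and \<open>B\<close>, plus a nonnegative defect of \<open>v\<close> (lemma \<open>first_order_difference\<close>).

  The quadratic part and the defect are nonnegative. So the optimal value at \<open>B\<close> is at least that at
  \<open>A\<close> minus the \<open>L\<^sup>1\<close> norm of the residual, for every \<open>B\<close> (lemma \<open>optimality_gap\<close>). In particular a small
  residual certifies near optimality, which gives the first alternative.

  Conversely, a control for \<open>B\<close> without defect bounds the optimal value at \<open>B\<close> from above by the
  first-order part plus the squared norm of the change of the state. The integrability assumptions
  make the latter at most a multiple of \<open>m powr s\<close> with \<open>s > 1\<close>, where \<open>m\<close> is the measure of the changed set,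
  uniformly in \<open>A\<close> (lemmas \<open>remainder_bound_bounded_domain\<close> and \<open>remainder_bound_strongly_convex\<close>).
  By the bathtub principle the trial set for the step size \<open>t\<close> captures at least the fraction \<open>t\<close> of the
  residual, while its measure is at most \<open>t\<close> times that of the domain. As \<open>t powr s\<close> is negligible
  against \<open>t\<close> for small \<open>t\<close>, the line search accepts after a number of reductions that depends only on a lower
  bound for the residual (lemma \<open>line_search_accepts\<close>). If the residuals of an infinite run did not
  tend to 0, the optimal values would decrease infinitely often by a fixed amount, although they are
  bounded below. Thus the residuals tend to 0 and the optimal values to the infimum, and a positive
  tolerance is reached after finitely many iterations.

  That the run never gets stuck relies on the existence of solutions (lemma \<open>solution_exists\<close>) and of
  maximal sets (lemma \<open>bathtub\<close>).
\<close>

section \<open>Square integrable functions and Hoelder's inequality on small sets\<close>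

lemma integrable_mult_of_squares:
  fixes f h :: "'b \<Rightarrow> real"
  assumes [measurable]: "f \<in> borel_measurable M" "h \<in> borel_measurable M"
    and f: "integrable M (\<lambda>x. (f x)\<^sup>2)" and h: "integrable M (\<lambda>x. (h x)\<^sup>2)"
  shows "integrable M (\<lambda>x. f x * h x)"
proof (rule Bochner_Integration.integrable_bound[OF Bochner_Integration.integrable_add[OF f h]])
  have "\<bar>f x * h x\<bar> \<le> (f x)\<^sup>2 + (h x)\<^sup>2" for x
  proof -
    have "2 * (\<bar>f x\<bar> * \<bar>h x\<bar>) \<le> (f x)\<^sup>2 + (h x)\<^sup>2"
      using sum_squares_bound[of "\<bar>f x\<bar>" "\<bar>h x\<bar>"] by simp
    moreover have "0 \<le> \<bar>f x\<bar> * \<bar>h x\<bar>" by simp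
    ultimately show ?thesis unfolding abs_mult by linarith
  qed
  then show "AE x in M. norm (f x * h x) \<le> norm ((f x)\<^sup>2 + (h x)\<^sup>2)"
    by auto
qed simp

lemma integrable_square_add:
  fixes f h :: "'b \<Rightarrow> real"
  assumes [measurable]: "f \<in> borel_measurable M" "h \<in> borel_measurable M"
    and f: "integrable M (\<lambda>x. (f x)\<^sup>2)" and h: "integrable M (\<lambda>x. (h x)\<^sup>2)"
  shows "integrable M (\<lambda>x. (f x + h x)\<^sup>2)"
proof -
  have "integrable M (\<lambda>x. (f x)\<^sup>2 + (h x)\<^sup>2 + 2 * (f x * h x))"
    by (intro Bochner_Integration.integrable_add integrable_mult_right integrable_mult_of_squares f h assms)
  then show ?thesis by (simp add: power2_sum mult.assoc)
qed

lemma Cauchy_Schwarz_integral: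
  fixes f h :: "'b \<Rightarrow> real"
  assumes [measurable]: "f \<in> borel_measurable M" "h \<in> borel_measurable M"
    and f: "integrable M (\<lambda>x. (f x)\<^sup>2)" and h: "integrable M (\<lambda>x. (h x)\<^sup>2)"
  shows "\<bar>\<integral>x. f x * h x \<partial>M\<bar> \<le> sqrt (\<integral>x. (f x)\<^sup>2 \<partial>M) * sqrt (\<integral>x. (h x)\<^sup>2 \<partial>M)"
proof -
  let ?F = "\<integral>x. (f x)\<^sup>2 \<partial>M" and ?H = "\<integral>x. (h x)\<^sup>2 \<partial>M" and ?I = "\<integral>x. f x * h x \<partial>M"
  have fh: "integrable M (\<lambda>x. f x * h x)"
    by (rule integrable_mult_of_squares) (use assms in auto)
  have "?I\<^sup>2 \<le> ?F * ?H"
  proof (cases "?H = 0")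
    case True
    then have "AE x in M. (h x)\<^sup>2 = 0"
      by (subst (asm) integral_nonneg_eq_0_iff_AE[OF h]) auto
    then have "AE x in M. f x * h x = 0" by eventually_elim simp
    then have "?I = 0" by (rule integral_eq_zero_AE)
    with True show ?thesis by simp
  next
    case False
    moreover have "?H \<ge> 0" by simp
    ultimately have pos: "?H > 0" by linarith
    define t where "t = ?I / ?H"
    have "0 \<le> (\<integral>x. (f x - t * h x)\<^sup>2 \<partial>M)" by simp
    also have "(\<lambda>x. (f x - t * h x)\<^sup>2) = (\<lambda>x. (f x)\<^sup>2 + (t\<^sup>2 * (h x)\<^sup>2 - 2 * t * (f x * h x)))"
      by (auto simp: power2_eq_square algebra_simps)
    also have "(\<integral>x. \<dots> x \<partial>M) = ?F + (t\<^sup>2 * ?H - 2 * t * ?I)"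
      using f h fh by simp
    also have "\<dots> = ?F - ?I\<^sup>2 / ?H"
      using pos by (simp add: t_def power2_eq_square field_simps)
    finally show ?thesis using pos by (simp add: field_simps)
  qed
  then have "sqrt (?I\<^sup>2) \<le> sqrt (?F * ?H)" by (rule real_sqrt_le_mono)
  then show ?thesis by (simp add: real_sqrt_mult)
qed

text \<open>
  Young's inequality bounds \<open>\<bar>f x\<bar>\<close> by \<open>(1 - 1/q) * c + (1/q) * c powr (1 - q) * \<bar>f x\<bar> powr q\<close> for
  every \<open>c > 0\<close>. The claim follows by integration over \<open>D\<close> and optimization in \<open>c\<close>.
\<close>

lemma Holder_on_set:
  fixes f :: "'b \<Rightarrow> real"
  assumes [measurable]: "f \<in> borel_measurable M" and fq: "integrable M (\<lambda>x. \<bar>f x\<bar> powr q)"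
    and D[measurable]: "D \<in> sets M" and fin: "emeasure M D < \<infinity>" and q: "q > 1"
  shows "integrable M (\<lambda>x. indicator D x * \<bar>f x\<bar>)"
    and "(\<integral>x. indicator D x * \<bar>f x\<bar> \<partial>M)
           \<le> measure M D powr (1 - 1 / q) * (\<integral>x. \<bar>f x\<bar> powr q \<partial>M) powr (1 / q)"
proof -
  let ?I = "\<integral>x. \<bar>f x\<bar> powr q \<partial>M" and ?m = "measure M D"
  have Dint: "integrable M (indicator D :: 'b \<Rightarrow> real)"
    using fin by (simp add: less_top)
  have young: "\<bar>f x\<bar> \<le> (1 - 1/q) * c + (1/q) * (c powr (1 - q) * \<bar>f x\<bar> powr q)" if c: "c > 0" for c x
  proof (cases "f x = 0")
    case True
    then show ?thesis using q c by simp
  next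
    case False
    have "c powr (1 - 1/q) * (c powr (1 - q) * \<bar>f x\<bar> powr q) powr (1/q)
        \<le> (1 - 1/q) * c + (1/q) * (c powr (1 - q) * \<bar>f x\<bar> powr q)"
      by (rule Youngs_inequality_0) (use q c False in auto)
    also have "c powr (1 - 1/q) * (c powr (1 - q) * \<bar>f x\<bar> powr q) powr (1/q)
      = (c powr (1 - 1/q) * c powr ((1 - q) / q)) * \<bar>f x\<bar>"
      using q c False by (simp add: powr_mult powr_powr)
    also have "c powr (1 - 1/q) * c powr ((1 - q) / q) = 1"
      using q c by (simp flip: powr_add add: field_simps)
    finally show ?thesis by simp
  qed
  have bnd: "integrable M (\<lambda>x. (1 - 1/q) * c * indicator D x + (1/q) * c powr (1 - q) * \<bar>f x\<bar> powr q)" for c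
    using fq Dint by simp
  have le: "indicator D x * \<bar>f x\<bar> \<le> (1 - 1/q) * c * indicator D x + (1/q) * c powr (1 - q) * \<bar>f x\<bar> powr q"
    if "c > 0" for c x
    using young[OF that, of x] q that by (auto split: split_indicator simp: mult.assoc)
  show int: "integrable M (\<lambda>x. indicator D x * \<bar>f x\<bar>)"
    by (rule Bochner_Integration.integrable_bound[OF bnd[of 1]])
       (use le[of 1] q in \<open>auto simp: abs_mult intro!: AE_I2 order_trans[OF _ abs_ge_self]\<close>)
  show "(\<integral>x. indicator D x * \<bar>f x\<bar> \<partial>M) \<le> ?m powr (1 - 1 / q) * ?I powr (1 / q)"
  proof (cases "?I = 0 \<or> ?m = 0")
    case True
    then have "AE x in M. indicator D x * \<bar>f x\<bar> = 0"
    proof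
      assume "?I = 0"
      then have "AE x in M. \<bar>f x\<bar> powr q = 0"
        by (subst (asm) integral_nonneg_eq_0_iff_AE[OF fq]) auto
      then show ?thesis by eventually_elim simp
    next
      assume "?m = 0"
      then have "D \<in> null_sets M" using fin
        by (auto simp: null_sets_def measure_def enn2real_eq_0_iff less_top)
      then have "AE x in M. x \<notin> D" by (rule AE_not_in)
      then show ?thesis by eventually_elim simp
    qed
    then have "(\<integral>x. indicator D x * \<bar>f x\<bar> \<partial>M) = 0" by (rule integral_eq_zero_AE)
    then show ?thesis by simp
  next
    case False
    moreover have "?I \<ge> 0" by simp
    ultimately have I: "?I > 0" and m: "?m > 0" by (auto simp: less_le)
    \<comment> \<open>this value of the free parameter minimises the right-hand side\<close>
    define c where "c = (?I / ?m) powr (1 / q)"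
    have c: "c > 0" using I m by (simp add: c_def)
    have cq: "c powr q = ?I / ?m" using I m q by (simp add: c_def powr_powr)
    have "(\<integral>x. indicator D x * \<bar>f x\<bar> \<partial>M)
       \<le> (\<integral>x. (1 - 1/q) * c * indicator D x + (1/q) * c powr (1 - q) * \<bar>f x\<bar> powr q \<partial>M)"
      by (rule integral_mono[OF int bnd]) (rule le[OF c])
    also have "\<dots> = (1 - 1/q) * c * ?m + (1/q) * c powr (1 - q) * ?I"
      using fq Dint sets.sets_into_space[OF D] by (simp add: Int_absorb2)
    also have "c powr (1 - q) * ?I = c * ?m"
      using cq I m c by (simp add: powr_diff field_simps)
    then have "(1 - 1/q) * c * ?m + (1/q) * c powr (1 - q) * ?I = c * ?m"
      using q by (simp add: field_simps)
    also have "c * ?m = ?m powr (1 - 1 / q) * ?I powr (1 / q)"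
      using I m by (simp add: c_def powr_divide powr_diff)
    finally show ?thesis .
  qed
qed

lemma integral_abs_le_sqrt_square:
  fixes f :: "'b \<Rightarrow> real"
  assumes "finite_measure M" and [measurable]: "f \<in> borel_measurable M"
    and f: "integrable M (\<lambda>x. (f x)\<^sup>2)"
  shows "integrable M f" "(\<integral>x. \<bar>f x\<bar> \<partial>M) \<le> sqrt (measure M (space M)) * sqrt (\<integral>x. (f x)\<^sup>2 \<partial>M)"
proof -
  interpret finite_measure M by fact
  show "integrable M f"
    using integrable_mult_of_squares[of f M "\<lambda>_. 1"] f by simp
  show "(\<integral>x. \<bar>f x\<bar> \<partial>M) \<le> sqrt (measure M (space M)) * sqrt (\<integral>x. (f x)\<^sup>2 \<partial>M)"
    using Cauchy_Schwarz_integral[of "\<lambda>x. \<bar>f x\<bar>" M "\<lambda>_. 1"] f by (simp add: mult.commute)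
qed

text \<open>
  On a finite measure space a Cauchy sequence in \<open>L\<^sup>2\<close> is one in \<open>L\<^sup>1\<close> and thus has a subsequence that
  converges almost everywhere; Fatou's lemma shows that its limit is also the limit in \<open>L\<^sup>2\<close>. The
  subsequence is part of the conclusion because lower semicontinuity is applied pointwise later.
\<close>

lemma L2_complete:
  fixes u :: "nat \<Rightarrow> 'b \<Rightarrow> real"
  assumes fin: "finite_measure M" and meas[measurable]: "\<And>n. u n \<in> borel_measurable M"
    and u: "\<And>n. integrable M (\<lambda>x. (u n x)\<^sup>2)"
    and cau: "\<And>e. e > 0 \<Longrightarrow> \<exists>N. \<forall>i\<ge>N. \<forall>j\<ge>N. (\<integral>x. (u i x - u j x)\<^sup>2 \<partial>M) < e"
  obtains v r where "v \<in> borel_measurable M" "integrable M (\<lambda>x. (v x)\<^sup>2)" "strict_mono r"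
    "AE x in M. (\<lambda>n. u (r n) x) \<longlonglongrightarrow> v x"
    "(\<lambda>n. \<integral>x. (u n x - v x)\<^sup>2 \<partial>M) \<longlonglongrightarrow> 0"
proof -
  interpret finite_measure M by fact
  have d: "integrable M (\<lambda>x. (u i x - u j x)\<^sup>2)" for i j
    using integrable_square_add[of "u i" M "\<lambda>x. - u j x"] u by simp
  let ?m = "measure M (space M)"
  have "\<exists>N. \<forall>i\<ge>N. \<forall>j\<ge>N. LINT x|M. norm (u i x - u j x) < e" if e: "e > 0" for e
  proof -
    define e' where "e' = (e / (sqrt ?m + 1))\<^sup>2"
    have p: "sqrt ?m + 1 > 0" by (simp add: add_nonneg_pos)
    then have "e' > 0" using e by (simp add: e'_def)
    from cau[OF this] obtain N where N: "\<And>i j. i \<ge> N \<Longrightarrow> j \<ge> N \<Longrightarrow> (\<integral>x. (u i x - u j x)\<^sup>2 \<partial>M) < e'"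
      by blast
    have "LINT x|M. norm (u i x - u j x) < e" if "i \<ge> N" "j \<ge> N" for i j
    proof -
      have "(LINT x|M. \<bar>u i x - u j x\<bar>) \<le> sqrt ?m * sqrt (\<integral>x. (u i x - u j x)\<^sup>2 \<partial>M)"
        by (rule integral_abs_le_sqrt_square) (use d fin in auto)
      also have "\<dots> \<le> sqrt ?m * sqrt e'"
        using N[OF that] by (intro mult_left_mono) auto
      also have "sqrt e' = e / (sqrt ?m + 1)" using e p by (simp add: e'_def)
      also have "sqrt ?m * (e / (sqrt ?m + 1)) < e" using e p by (simp add: field_simps)
      finally show ?thesis by simp
    qed
    then show ?thesis by blast
  qed
  moreover have "integrable M (u n)" for n
    by (rule integral_abs_le_sqrt_square) (use u fin in auto)
  ultimately obtain r where r: "strict_mono r" "AE x in M. Cauchy (\<lambda>i. u (r i) x)"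
    using cauchy_L1_AE_cauchy_subseq[of M u] by metis
  define v where "v = (\<lambda>x. lim (\<lambda>i. u (r i) x))"
  have v[measurable]: "v \<in> borel_measurable M" unfolding v_def by measurable
  have conv: "AE x in M. (\<lambda>n. u (r n) x) \<longlonglongrightarrow> v x"
    using r(2) by eventually_elim (simp add: v_def Cauchy_convergent_iff convergent_LIMSEQ_iff)
  have key: "integrable M (\<lambda>x. (u n x - v x)\<^sup>2) \<and> (\<integral>x. (u n x - v x)\<^sup>2 \<partial>M) \<le> e"
    if e: "e > 0" and N: "\<And>i j. i \<ge> N \<Longrightarrow> j \<ge> N \<Longrightarrow> (\<integral>x. (u i x - u j x)\<^sup>2 \<partial>M) < e" and n: "n \<ge> N" for e N n
  proof -
    have "(\<integral>\<^sup>+x. ennreal ((u n x - v x)\<^sup>2) \<partial>M)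
       = (\<integral>\<^sup>+x. liminf (\<lambda>i. ennreal ((u n x - u (r i) x)\<^sup>2)) \<partial>M)"
    proof (rule nn_integral_cong_AE)
      show "AE x in M. ennreal ((u n x - v x)\<^sup>2) = liminf (\<lambda>i. ennreal ((u n x - u (r i) x)\<^sup>2))"
        using conv
      proof eventually_elim
        fix x assume "(\<lambda>n. u (r n) x) \<longlonglongrightarrow> v x"
        then have "(\<lambda>i. ennreal ((u n x - u (r i) x)\<^sup>2)) \<longlonglongrightarrow> ennreal ((u n x - v x)\<^sup>2)"
          by (intro tendsto_intros tendsto_ennrealI)
        then show "ennreal ((u n x - v x)\<^sup>2) = liminf (\<lambda>i. ennreal ((u n x - u (r i) x)\<^sup>2))"
          by (intro lim_imp_Liminf[symmetric]) simp_all
      qed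
    qed
    also have "\<dots> \<le> liminf (\<lambda>i. \<integral>\<^sup>+x. ennreal ((u n x - u (r i) x)\<^sup>2) \<partial>M)"
      by (rule nn_integral_liminf) measurable
    also have "\<dots> \<le> ennreal e"
    proof -
      have ev: "eventually (\<lambda>i. (\<integral>\<^sup>+x. ennreal ((u n x - u (r i) x)\<^sup>2) \<partial>M) \<le> ennreal e) sequentially"
        using eventually_ge_at_top[of N]
      proof eventually_elim
        case (elim i)
        then have "r i \<ge> N" using seq_suble[OF r(1), of i] by linarith
        then show ?case using N[OF n, of "r i"] d
          by (subst nn_integral_eq_integral) (auto intro: ennreal_leI)
      qed
      show ?thesis
        by (rule order_trans[OF Liminf_le_Limsup Limsup_bounded[OF ev]]) simp
    qed
    finally have le: "(\<integral>\<^sup>+x. ennreal ((u n x - v x)\<^sup>2) \<partial>M) \<le> ennreal e" .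
    then have "integrable M (\<lambda>x. (u n x - v x)\<^sup>2)"
      by (intro integrableI_bounded) (auto intro: le_less_trans)
    with le e show ?thesis
      by (subst (asm) nn_integral_eq_integral) (auto simp: ennreal_le_iff)
  qed
  show thesis
  proof (rule that[OF v _ r(1) conv])
    from cau[of 1] obtain N where "\<And>i j. i \<ge> N \<Longrightarrow> j \<ge> N \<Longrightarrow> (\<integral>x. (u i x - u j x)\<^sup>2 \<partial>M) < 1" by auto
    from key[OF _ this, of N] have "integrable M (\<lambda>x. (u N x - v x)\<^sup>2)" by simp
    then have "integrable M (\<lambda>x. (v x - u N x)\<^sup>2)" by (simp add: power2_commute)
    from integrable_square_add[OF _ _ this u[of N]] show "integrable M (\<lambda>x. (v x)\<^sup>2)" by simp
    show "(\<lambda>n. \<integral>x. (u n x - v x)\<^sup>2 \<partial>M) \<longlonglongrightarrow> 0"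
    proof (rule LIMSEQ_I)
      fix e :: real assume e: "e > 0"
      with cau[of "e/2"] obtain N where "\<And>i j. i \<ge> N \<Longrightarrow> j \<ge> N \<Longrightarrow> (\<integral>x. (u i x - u j x)\<^sup>2 \<partial>M) < e/2" by auto
      from key[OF _ this] e have "(\<integral>x. (u n x - v x)\<^sup>2 \<partial>M) \<le> e/2" if "n \<ge> N" for n
        using that by simp
      with e show "\<exists>no. \<forall>n\<ge>no. norm ((\<integral>x. (u n x - v x)\<^sup>2 \<partial>M) - 0) < e"
        by (intro exI[of _ N]) (force)
    qed
  qed
qed

text \<open>
  Elements of almost minimal norm of decreasing bounded convex sets form a Cauchy sequence. By the
  parallelogram law the distance of two of them is controlled by the excess of their norms over the
  norm of their midpoint, which lies in the larger set, and the minimal norms increase to a limit.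
\<close>

lemma nested_convex_Cauchy:
  fixes K :: "nat \<Rightarrow> ('b \<Rightarrow> real) set"
  assumes meas: "\<And>n u. u \<in> K n \<Longrightarrow> u \<in> borel_measurable M"
    and sq: "\<And>n u. u \<in> K n \<Longrightarrow> integrable M (\<lambda>x. (u x)\<^sup>2)"
    and bdd: "\<And>n u. u \<in> K n \<Longrightarrow> (\<integral>x. (u x)\<^sup>2 \<partial>M) \<le> C"
    and ne: "\<And>n. K n \<noteq> {}" and dec: "\<And>m n. m \<le> n \<Longrightarrow> K n \<subseteq> K m"
    and mid: "\<And>n u v. u \<in> K n \<Longrightarrow> v \<in> K n \<Longrightarrow> (\<lambda>x. (u x + v x) / 2) \<in> K n"
  obtains u where "\<And>n. u n \<in> K n"
    "\<And>e. e > 0 \<Longrightarrow> \<exists>N. \<forall>i\<ge>N. \<forall>j\<ge>N. (\<integral>x. (u i x - u j x)\<^sup>2 \<partial>M) < e"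
proof -
  let ?N = "\<lambda>u. \<integral>x. (u x)\<^sup>2 \<partial>M"
  define d where "d = (\<lambda>n. Inf (?N ` K n))"
  have bb: "bdd_below (?N ` K n)" for n by (intro bdd_belowI2[of _ 0]) simp
  have dle: "d n \<le> ?N u" if "u \<in> K n" for n u
    unfolding d_def by (rule cINF_lower[OF bb that])
  have "\<exists>u\<in>K n. ?N u < d n + 1 / real (Suc n)" for n
  proof -
    have "Inf (?N ` K n) < d n + 1 / real (Suc n)" by (simp add: d_def)
    then show ?thesis using cInf_lessD[of "?N ` K n"] ne by blast
  qed
  then obtain u where uK: "\<And>n. u n \<in> K n" and un: "\<And>n. ?N (u n) < d n + 1 / real (Suc n)"
    by metis
  have dC: "d n \<le> C" for n using dle[OF uK] bdd[OF uK] by (rule order_trans)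
  have dmono: "d m \<le> d n" if "m \<le> n" for m n
    unfolding d_def by (rule cINF_superset_mono) (use ne bb dec[OF that] in auto)
  obtain L where "d \<longlonglongrightarrow> L"
    by (rule incseq_convergent[of d C]) (use dmono dC in \<open>auto simp: incseq_def\<close>)
  then have dCauchy: "Cauchy d" by (rule LIMSEQ_imp_Cauchy)
  have step: "(\<integral>x. (u i x - u j x)\<^sup>2 \<partial>M) \<le> 2 * (d j - d i) + 4 / real (Suc i)" if ij: "i \<le> j" for i j
  proof -
    have ui: "u i \<in> K i" and uj: "u j \<in> K i" using uK dec[OF ij] by auto
    note [measurable] = meas[OF ui] meas[OF uj]
    have s: "integrable M (\<lambda>x. (u i x + u j x)\<^sup>2)" "integrable M (\<lambda>x. (u i x - u j x)\<^sup>2)"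
      using integrable_square_add[of "u i" M "u j"] integrable_square_add[of "u i" M "\<lambda>x. - u j x"]
        sq[OF ui] sq[OF uj] by auto
    have "(\<integral>x. (u i x - u j x)\<^sup>2 \<partial>M) + (\<integral>x. (u i x + u j x)\<^sup>2 \<partial>M)
        = (\<integral>x. (u i x - u j x)\<^sup>2 + (u i x + u j x)\<^sup>2 \<partial>M)" using s by simp
    also have "\<dots> = (\<integral>x. 2 * (u i x)\<^sup>2 + 2 * (u j x)\<^sup>2 \<partial>M)"
      by (rule Bochner_Integration.integral_cong) (auto simp: power2_eq_square algebra_simps)
    also have "\<dots> = 2 * ?N (u i) + 2 * ?N (u j)" using sq[OF ui] sq[OF uj] by simp
    finally have par: "(\<integral>x. (u i x - u j x)\<^sup>2 \<partial>M) = 2 * ?N (u i) + 2 * ?N (u j) - (\<integral>x. (u i x + u j x)\<^sup>2 \<partial>M)"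
      by simp
    have "d i \<le> (\<integral>x. ((u i x + u j x) / 2)\<^sup>2 \<partial>M)" by (rule dle[OF mid[OF ui uj]])
    also have "\<dots> = (\<integral>x. (u i x + u j x)\<^sup>2 \<partial>M) / 4" by (simp add: power_divide)
    finally have "4 * d i \<le> (\<integral>x. (u i x + u j x)\<^sup>2 \<partial>M)" by simp
    moreover have "1 / real (Suc j) \<le> 1 / real (Suc i)" using ij by (simp add: frac_le)
    ultimately show ?thesis using par un[of i] un[of j] by simp
  qed
  show thesis
  proof (rule that[of u, OF uK])
    fix e :: real assume e: "e > 0"
    from dCauchy e obtain N1 where N1: "\<And>i j. i \<ge> N1 \<Longrightarrow> j \<ge> N1 \<Longrightarrow> \<bar>d i - d j\<bar> < e / 4"
      unfolding Cauchy_def dist_real_def by (meson e divide_pos_pos zero_less_numeral)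
    obtain N2 where N2: "4 / e * 2 < real N2" using reals_Archimedean2 by blast
    let ?n = "max N1 N2"
    have main: "(\<integral>x. (u i x - u j x)\<^sup>2 \<partial>M) < e" if "i \<ge> ?n" "j \<ge> ?n" "i \<le> j" for i j
    proof -
      have "\<bar>d j - d i\<bar> < e / 4" using that by (intro N1) auto
      then have "d j - d i < e / 4" by linarith
      moreover have "4 / e * 2 < real (Suc i)" using N2 that by linarith
      then have "4 / real (Suc i) < e / 2" using e by (simp add: field_simps)
      ultimately show ?thesis using step[OF that(3)] unfolding right_diff_distrib by linarith
    qed
    have "(\<integral>x. (u i x - u j x)\<^sup>2 \<partial>M) < e" if "i \<ge> ?n" "j \<ge> ?n" for i j
      using main[of i j] main[of j i] that by (cases "i \<le> j") (auto simp: power2_commute[of "u i _"])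
    then show "\<exists>N. \<forall>i\<ge>N. \<forall>j\<ge>N. (\<integral>x. (u i x - u j x)\<^sup>2 \<partial>M) < e" by blast
  qed
qed

section \<open>The bathtub principle\<close>

text \<open>Sections by balls interpolate between the null set and all of the set.\<close>

lemma lebesgue_nonatomic:
  fixes X :: "'a::euclidean_space set"
  assumes X: "X \<in> lmeasurable" and a: "0 \<le> a" "a \<le> measure lebesgue X"
  obtains E where "E \<in> lmeasurable" "E \<subseteq> X" "measure lebesgue E = a"
proof (cases "a = measure lebesgue X")
  case True
  then show thesis using that X by blast
next
  case False
  with a have less: "a < measure lebesgue X" by simp
  define \<phi> where "\<phi> r = measure lebesgue (X \<inter> cball 0 r)" for r :: real
  define c where "c r = measure lebesgue (cball (0::'a) r)" for r :: real
  have m: "X \<inter> cball 0 r \<in> lmeasurable" for r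
    using X by (intro fmeasurable_Int_fmeasurable) auto
  have diff: "\<bar>\<phi> r - \<phi> s\<bar> \<le> \<bar>c r - c s\<bar>" for r s
  proof -
    have *: "\<phi> s \<le> \<phi> r \<and> \<phi> r - \<phi> s \<le> c r - c s" if "s \<le> r" for r s
    proof
      have sub: "X \<inter> cball 0 s \<subseteq> X \<inter> cball 0 r" and sub': "cball (0::'a) s \<subseteq> cball 0 r" using that by auto
      show "\<phi> s \<le> \<phi> r" unfolding \<phi>_def
        by (rule measure_mono_fmeasurable[OF sub]) (use m in \<open>auto dest: fmeasurableD\<close>)
      have "\<phi> r - \<phi> s = measure lebesgue (X \<inter> cball 0 r - X \<inter> cball 0 s)"
        unfolding \<phi>_def by (rule measurable_measure_Diff[symmetric]) (use m sub in \<open>auto dest: fmeasurableD\<close>)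
      also have "\<dots> \<le> measure lebesgue (cball (0::'a) r - cball 0 s)"
        by (rule measure_mono_fmeasurable) (use m in \<open>auto dest: fmeasurableD intro: fmeasurable.Diff\<close>)
      also have "\<dots> = c r - c s"
        unfolding c_def using sub' by (subst measurable_measure_Diff) auto
      finally show "\<phi> r - \<phi> s \<le> c r - c s" .
    qed
    show ?thesis using *[of r s] *[of s r] by (cases "s \<le> r") auto
  qed
  have c_eq: "c r = unit_ball_vol (DIM('a)) * r ^ DIM('a)" if "r \<ge> 0" for r
    using that by (simp add: c_def measure_completion content_cball)
  have cont: "continuous_on {0..b} \<phi>" for b
  proof -
    have "continuous_on {0..b} c"
      by (subst continuous_on_cong[OF refl c_eq]) (auto intro!: continuous_intros)
    then show ?thesis unfolding continuous_on_iff dist_real_def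
      by (meson diff le_less_trans)
  qed
  have "(\<lambda>n. measure lebesgue (X \<inter> cball 0 (real n))) \<longlonglongrightarrow> measure lebesgue (\<Union>n. X \<inter> cball 0 (real n))"
  proof (rule Lim_measure_incseq)
    have "emeasure lebesgue (\<Union>n. X \<inter> cball 0 (real n)) \<le> emeasure lebesgue X"
      using X by (intro emeasure_mono) auto
    also have "\<dots> < \<infinity>" using X by (simp add: fmeasurable_def del: emeasure_completion)
    finally show "emeasure lebesgue (\<Union>n. X \<inter> cball 0 (real n)) \<noteq> \<infinity>" by simp
  qed (use m in \<open>auto simp: incseq_def dest: fmeasurableD\<close>)
  also have "(\<Union>n. X \<inter> cball 0 (real n)) = X"
    by (auto intro: real_arch_simple)
  finally have "eventually (\<lambda>n. a < \<phi> (real n)) sequentially"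
    using less unfolding \<phi>_def by (rule order_tendstoD)
  then obtain n where n: "a < \<phi> (real n)" by (auto simp: eventually_sequentially)
  have "\<phi> 0 = 0"
  proof -
    have "\<phi> 0 \<le> measure lebesgue (cball (0::'a) 0)"
      unfolding \<phi>_def by (rule measure_mono_fmeasurable[OF _ fmeasurableD[OF m]]) (auto simp del: cball_trivial)
    also have "\<dots> = 0" by simp
    finally show ?thesis by (simp add: \<phi>_def measure_le_0_iff)
  qed
  then obtain r where "0 \<le> r" "\<phi> r = a"
    using IVT'[of \<phi> 0 a "real n"] n a cont[of "real n"] by auto
  then show thesis using that[of "X \<inter> cball 0 r"] m[of r] by (auto simp: \<phi>_def)
qed

lemma integral_lebesgue_on_subset:
  fixes f :: "'a::euclidean_space \<Rightarrow> real"
  assumes "D \<in> sets lebesgue" "\<Omega> \<in> sets lebesgue" "D \<subseteq> \<Omega>"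
  shows "(\<integral>x. f x \<partial>lebesgue_on D) = (\<integral>x. indicator D x * f x \<partial>lebesgue_on \<Omega>)"
proof -
  have "(\<lambda>x. indicator \<Omega> x * (indicator D x * f x)) = (\<lambda>x. indicator D x * f x)"
    using assms(3) by (auto simp: fun_eq_iff split: split_indicator)
  then show ?thesis
    using integral_restrict_space[of D lebesgue f] assms(1,2)
      integral_restrict_space[of \<Omega> lebesgue "\<lambda>x. indicator D x * f x"]
    by (simp only: real_scaleR_def) simp
qed

text \<open>
  The bathtub principle: the mass of \<open>f\<close> in a set of measure at most \<open>t * measure lebesgue R\<close> is
  largest for a superlevel set, completed by part of the level set in order to exhaust the
  admissible measure. Such a set captures at least the fraction \<open>t\<close> of the mass of \<open>f\<close>. Both claims
  hold because, for the level \<open>c\<close>, the product \<open>(indicator D x - \<phi> x) * (f x - c)\<close> is nonnegative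
  whenever \<open>0 \<le> \<phi> x \<le> 1\<close>.
\<close>

lemma bathtub:
  fixes f :: "'a::euclidean_space \<Rightarrow> real"
  assumes \<Omega>: "\<Omega> \<in> sets lebesgue" and R: "R \<in> lmeasurable" "R \<subseteq> \<Omega>"
    and f: "integrable (lebesgue_on \<Omega>) f" and f0: "\<And>x. f x \<ge> 0" and t: "0 < t" "t \<le> 1"
  obtains D where "D \<in> sets lebesgue" "D \<subseteq> R" "measure lebesgue D \<le> t * measure lebesgue R"
    "\<And>D'. D' \<in> sets lebesgue \<Longrightarrow> D' \<subseteq> R \<Longrightarrow> measure lebesgue D' \<le> t * measure lebesgue R \<Longrightarrow>
      (\<integral>x. indicator D' x * f x \<partial>lebesgue_on \<Omega>) \<le> (\<integral>x. indicator D x * f x \<partial>lebesgue_on \<Omega>)"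
    "t * (\<integral>x. indicator R x * f x \<partial>lebesgue_on \<Omega>) \<le> (\<integral>x. indicator D x * f x \<partial>lebesgue_on \<Omega>)"
proof -
  let ?N = "lebesgue_on \<Omega>"
  define m where "m = t * measure lebesgue R"
  define L where "L c = {x \<in> R. f x > c}" for c
  define F where "F c = measure lebesgue (L c)" for c
  have meas: "{x \<in> R. P (f x)} \<in> lmeasurable" if P: "Measurable.pred borel P" for P
  proof -
    have "{x \<in> space ?N. P (f x)} \<in> sets ?N" using f P by measurable
    then have "{x \<in> \<Omega>. P (f x)} \<in> sets lebesgue" using \<Omega> by (auto simp: sets_restrict_space_iff)
    then have "{x \<in> \<Omega>. P (f x)} \<inter> R \<in> lmeasurable" using R by (metis fmeasurable_Int_fmeasurable inf_commute)
    moreover have "{x \<in> \<Omega>. P (f x)} \<inter> R = {x \<in> R. P (f x)}" using R by auto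
    ultimately show ?thesis by simp
  qed
  have Lm: "L c \<in> lmeasurable" for c unfolding L_def by (rule meas) measurable
  have Fanti: "F c' \<le> F c" if "c \<le> c'" for c c'
    unfolding F_def by (rule measure_mono_fmeasurable) (use that Lm in \<open>auto simp: L_def dest: fmeasurableD\<close>)
  have "\<exists>c D. D \<in> sets lebesgue \<and> D \<subseteq> R \<and> c \<ge> 0 \<and> measure lebesgue D = m \<and>
     (\<forall>x\<in>D. f x \<ge> c) \<and> (\<forall>x\<in>R - D. f x \<le> c)"
  proof (cases "measure lebesgue R = 0")
    case True
    then show ?thesis using f0 by (intro exI[of _ 0] exI[of _ R]) (auto simp: m_def R fmeasurableD)
  next
    case False
    then have m: "m > 0" "m \<le> measure lebesgue R"
      using t by (auto simp: m_def less_le mult_le_cancel_right1)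
    \<comment> \<open>at the level \<open>c\<close> the open superlevel set is admissible, whereas the closed one has measure at
      least \<open>m\<close>, by continuity of the measure along monotone sequences of levels\<close>
    define C where "C = {c. 0 \<le> c \<and> F c \<le> m}"
    define c where "c = Inf C"
    have "(\<lambda>n. F (real n)) \<longlonglongrightarrow> measure lebesgue (\<Inter>n. L (real n))"
      unfolding F_def
    proof (rule Lim_measure_decseq)
      show "range (\<lambda>n. L (real n)) \<subseteq> sets lebesgue" using fmeasurableD[OF Lm] by blast
      show "decseq (\<lambda>n. L (real n))" by (auto simp: decseq_def L_def)
      show "emeasure lebesgue (L (real n)) \<noteq> \<infinity>" for n
        using fmeasurableD2[OF Lm] by (metis infinity_ennreal_def)
    qed
    also have "(\<Inter>n. L (real n)) = {}"
      by (auto simp: L_def) (meson not_less real_arch_simple)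
    finally have "eventually (\<lambda>n. F (real n) < m) sequentially"
      using m by (intro order_tendstoD(2)) auto
    then obtain n where "F (real n) < m" by (auto simp: eventually_sequentially)
    then have Cne: "C \<noteq> {}" by (auto simp: C_def intro!: exI[of _ "real n"])
    have bb: "bdd_below C" by (auto simp: C_def)
    have c0: "c \<ge> 0" unfolding c_def by (rule cInf_greatest[OF Cne]) (auto simp: C_def)
    have above: "F c' \<le> m" if c': "c < c'" for c'
    proof -
      obtain b where b: "b \<in> C" "b < c'" using cInf_lessD[OF Cne c'[unfolded c_def]] by blast
      then have "F c' \<le> F b" by (intro Fanti) simp
      with b show ?thesis by (simp add: C_def)
    qed
    have below: "F c' > m" if "c' < c" "c' \<ge> 0" for c'
    proof (rule ccontr)
      assume "\<not> F c' > m"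
      then have "c' \<in> C" using that(2) by (simp add: C_def)
      then have "c \<le> c'" unfolding c_def by (rule cInf_lower[OF _ bb])
      with that(1) show False by simp
    qed
    have Fc: "F c \<le> m"
    proof -
      have "(\<lambda>n. F (c + 1 / Suc n)) \<longlonglongrightarrow> measure lebesgue (\<Union>n. L (c + 1 / Suc n))"
        unfolding F_def
      proof (rule Lim_measure_incseq)
        show "incseq (\<lambda>n. L (c + 1 / Suc n))"
        proof (rule incseq_SucI, rule subsetI)
          fix n x assume "x \<in> L (c + 1 / Suc n)"
          moreover have "1 / real (Suc (Suc n)) \<le> 1 / real (Suc n)" by (simp add: frac_le)
          ultimately show "x \<in> L (c + 1 / Suc (Suc n))" by (simp add: L_def)
        qed
        have "emeasure lebesgue (\<Union>n. L (c + 1 / Suc n)) \<le> emeasure lebesgue R"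
          using R by (intro emeasure_mono) (auto simp: L_def)
        then show "emeasure lebesgue (\<Union>n. L (c + 1 / Suc n)) \<noteq> \<infinity>"
          using fmeasurableD2[OF R(1)] by (metis infinity_ennreal_def top_unique)
        show "range (\<lambda>n. L (c + 1 / Suc n)) \<subseteq> sets lebesgue" using fmeasurableD[OF Lm] by blast
      qed
      also have "(\<Union>n. L (c + 1 / Suc n)) = L c"
      proof (intro equalityI subsetI)
        fix x assume x: "x \<in> L c"
        then obtain n where "inverse (real (Suc n)) < f x - c"
          using reals_Archimedean[of "f x - c"] by (auto simp: L_def)
        with x show "x \<in> (\<Union>n. L (c + 1 / Suc n))"
          by (auto simp: L_def inverse_eq_divide intro!: exI[of _ n])
      next
        fix x assume "x \<in> (\<Union>n. L (c + 1 / Suc n))"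
        then obtain n where "x \<in> R" "c + 1 / Suc n < f x" by (auto simp: L_def)
        moreover have "0 < 1 / real (Suc n)" by simp
        ultimately have "c < f x" by linarith
        with \<open>x \<in> R\<close> show "x \<in> L c" by (simp add: L_def)
      qed
      finally show ?thesis unfolding F_def[symmetric]
        by (rule LIMSEQ_le_const2) (auto intro!: above)
    qed
    define G where "G = {x \<in> R. f x \<ge> c}"
    have Gm: "G \<in> lmeasurable" unfolding G_def by (rule meas) measurable
    have Gc: "m \<le> measure lebesgue G"
    proof (cases "c = 0")
      case True
      then have "G = R" using f0 by (auto simp: G_def)
      then show ?thesis using m by simp
    next
      case False
      with c0 have cpos: "c > 0" by simp
      have "(\<lambda>n. F (c - c / Suc n)) \<longlonglongrightarrow> measure lebesgue (\<Inter>n. L (c - c / Suc n))"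
        unfolding F_def
      proof (rule Lim_measure_decseq)
        show "decseq (\<lambda>n. L (c - c / Suc n))"
        proof (rule decseq_SucI, rule subsetI)
          fix n x assume "x \<in> L (c - c / Suc (Suc n))"
          moreover have "c / real (Suc (Suc n)) \<le> c / real (Suc n)" using cpos by (simp add: frac_le)
          ultimately show "x \<in> L (c - c / Suc n)" by (simp add: L_def)
        qed
        show "range (\<lambda>n. L (c - c / Suc n)) \<subseteq> sets lebesgue" using fmeasurableD[OF Lm] by blast
        show "emeasure lebesgue (L (c - c / Suc n)) \<noteq> \<infinity>" for n
          using fmeasurableD2[OF Lm] by (metis infinity_ennreal_def)
      qed
      also have "(\<Inter>n. L (c - c / Suc n)) = G"
      proof (intro equalityI subsetI)
        fix x assume x: "x \<in> (\<Inter>n. L (c - c / Suc n))"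
        then have "\<And>n. c - c / Suc n \<le> f x" by (auto simp: L_def intro: less_imp_le)
        moreover have "(\<lambda>n. c - c / Suc n) \<longlonglongrightarrow> c - 0"
          using tendsto_mult_right_zero[OF LIMSEQ_inverse_real_of_nat, of c]
          by (intro tendsto_intros) (simp add: divide_inverse)
        ultimately have "c \<le> f x" by (intro LIMSEQ_le_const2[of _ c "f x"]) auto
        with x show "x \<in> G" by (auto simp: L_def G_def)
      next
        fix x assume "x \<in> G"
        moreover have "c - c / Suc n < c" for n using cpos by simp
        ultimately show "x \<in> (\<Inter>n. L (c - c / Suc n))"
          unfolding L_def G_def by (blast intro: less_le_trans)
      qed
      finally show ?thesis
        by (rule LIMSEQ_le_const)
           (use cpos in \<open>auto intro!: exI[of _ 0] less_imp_le[OF below] simp: field_simps\<close>)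
    qed
    have "measure lebesgue (G - L c) = measure lebesgue G - F c"
      unfolding F_def by (rule measurable_measure_Diff) (use Gm Lm in \<open>auto simp: G_def L_def dest: fmeasurableD\<close>)
    then have "0 \<le> m - F c" "m - F c \<le> measure lebesgue (G - L c)" using Fc Gc by auto
    moreover have "G - L c \<in> lmeasurable" using Gm Lm by (auto intro: fmeasurable.Diff)
    ultimately obtain E where E: "E \<in> lmeasurable" "E \<subseteq> G - L c" "measure lebesgue E = m - F c"
      using lebesgue_nonatomic by metis
    have "measure lebesgue (L c \<union> E) = F c + (m - F c)"
      unfolding F_def E(3)[unfolded F_def, symmetric]
      by (rule measure_Union)
         (use E(2) fmeasurableD[OF E(1)] fmeasurableD2[OF E(1)] fmeasurableD[OF Lm] fmeasurableD2[OF Lm]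
          in \<open>auto simp del: emeasure_completion\<close>)
    then show ?thesis using E Lm c0
      by (intro exI[of _ c] exI[of _ "L c \<union> E"]) (auto simp: G_def L_def dest: fmeasurableD)
  qed
  then obtain c D where D: "D \<in> sets lebesgue" "D \<subseteq> R" and c0: "c \<ge> 0" and Dm: "measure lebesgue D = m"
    and up: "\<And>x. x \<in> D \<Longrightarrow> f x \<ge> c" and lo: "\<And>x. x \<in> R - D \<Longrightarrow> f x \<le> c" by blast
  have sN: "E \<in> sets ?N" "integrable ?N (indicator E :: 'a \<Rightarrow> real)" "measure ?N E = measure lebesgue E"
    "integrable ?N (\<lambda>x. indicator E x * f x)" if "E \<in> sets lebesgue" "E \<subseteq> R" for E
  proof -
    show E: "E \<in> sets ?N" using that R \<Omega> by (auto simp: sets_restrict_space_iff)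
    have "E \<in> lmeasurable" using that R by (metis fmeasurableI2)
    moreover have "E \<inter> \<Omega> = E" using that R by auto
    ultimately show "integrable ?N (indicator E :: 'a \<Rightarrow> real)" "measure ?N E = measure lebesgue E"
      using that R \<Omega> E
      by (auto simp: emeasure_restrict_space measure_restrict_space fmeasurable_def integrable_indicator_iff)
    show "integrable ?N (\<lambda>x. indicator E x * f x)" using integrable_mult_indicator[OF E f] by simp
  qed
  have key: "(\<integral>x. indicator R x * (\<phi> x * f x) \<partial>?N) \<le> (\<integral>x. indicator D x * f x \<partial>?N)"
    if \<phi>: "\<And>x. 0 \<le> \<phi> x \<and> \<phi> x \<le> 1" and int: "integrable ?N (\<lambda>x. indicator R x * (\<phi> x * f x))"
      "integrable ?N (\<lambda>x. indicator R x * \<phi> x)" and le: "(\<integral>x. indicator R x * \<phi> x \<partial>?N) \<le> m" for \<phi> :: "'a \<Rightarrow> real"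
  proof -
    have "0 \<le> c * (m - (\<integral>x. indicator R x * \<phi> x \<partial>?N))" using c0 le by simp
    also have "\<dots> = (\<integral>x. c * (indicator D x - indicator R x * \<phi> x) \<partial>?N)"
      using sN[OF D] int Dm by (simp add: Int_absorb2 D R subset_trans[OF D(2) R(2)])
    also have "\<dots> \<le> (\<integral>x. indicator D x * f x - indicator R x * (\<phi> x * f x) \<partial>?N)"
    proof (rule integral_mono)
      fix x
      show "c * (indicator D x - indicator R x * \<phi> x) \<le> indicator D x * f x - indicator R x * (\<phi> x * f x)"
      proof (cases "x \<in> R")
        case True
        have "0 \<le> (indicator D x - \<phi> x) * (f x - c)"
        proof (cases "x \<in> D")
          case True
          then show ?thesis using up \<phi>[of x] by simp
        next
          case False
          then show ?thesis using lo[of x] \<open>x \<in> R\<close> \<phi>[of x] by (simp add: mult_nonneg_nonpos)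
        qed
        then show ?thesis using True by (simp add: algebra_simps)
      next
        case False
        then have "x \<notin> D" using D by auto
        with False show ?thesis by simp
      qed
    qed (use sN[OF D] int in auto)
    also have "\<dots> = (\<integral>x. indicator D x * f x \<partial>?N) - (\<integral>x. indicator R x * (\<phi> x * f x) \<partial>?N)"
      using sN[OF D] int by simp
    finally show ?thesis by simp
  qed
  have RS: "R \<in> sets lebesgue" using R by (auto dest: fmeasurableD)
  show thesis
  proof (rule that[OF D])
    show "measure lebesgue D \<le> t * measure lebesgue R" using Dm by (simp add: m_def)
    fix D' assume D': "D' \<in> sets lebesgue" "D' \<subseteq> R" "measure lebesgue D' \<le> t * measure lebesgue R"
    have e: "indicator R x * indicator D' x = (indicator D' x :: real)" for x
      using D' by (auto split: split_indicator)
    have e': "indicator R x * (indicator D' x * f x) = indicator D' x * f x" for x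
      using D' by (auto split: split_indicator)
    show "(\<integral>x. indicator D' x * f x \<partial>?N) \<le> (\<integral>x. indicator D x * f x \<partial>?N)"
      using key[of "indicator D'"] sN[OF D'(1,2)] D'(3) D'(2) R
      by (simp add: e e' m_def Int_absorb2 indicator_le_1 indicator_pos_le)
  next
    show "t * (\<integral>x. indicator R x * f x \<partial>?N) \<le> (\<integral>x. indicator D x * f x \<partial>?N)"
      using key[of "\<lambda>_. t"] sN[OF RS] R t by (simp add: m_def Int_absorb2 mult.left_commute mult.commute)
  qed
qed

section \<open>Lower semicontinuous convex penalties and their Hamiltonians\<close>

lemma lsc_fun_open_superlevel:
  assumes "lsc_fun g"
  shows "open {u. c < g u}"
proof (subst open_subopen, intro ballI)
  fix u assume "u \<in> {u. c < g u}"
  then have c: "c < g u" by simp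
  also have "g u \<le> Liminf (at u) g" using assms by (simp add: lsc_fun_def)
  finally have "eventually (\<lambda>v. c < g v) (at u)" by (rule less_LiminfD)
  then have "eventually (\<lambda>v. c < g v) (nhds u)"
    using c by (simp add: eventually_nhds_conv_at)
  then show "\<exists>T. open T \<and> u \<in> T \<and> T \<subseteq> {u. c < g u}"
    by (auto simp: eventually_nhds)
qed

lemma lsc_fun_sequence:
  assumes "lsc_fun g" "f \<longlonglongrightarrow> u"
  shows "g u \<le> liminf (\<lambda>n. g (f n))"
proof (subst le_Liminf_iff, intro allI impI)
  fix c assume "c < g u"
  then show "eventually (\<lambda>n. c < g (f n)) sequentially"
    using topological_tendstoD[OF assms(2) lsc_fun_open_superlevel[OF assms(1), of c]] by simp
qed

lemma lsc_fun_borel: "lsc_fun g \<Longrightarrow> g \<in> borel_measurable borel"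
  by (rule borel_measurableI_greater) (simp add: lsc_fun_open_superlevel)

text \<open>
  The quadratic growth condition is common to both sets of assumptions on the penalty: it follows
  from strong convexity as well as from a bounded domain. It makes sublevel sets of the cost bounded
  in \<open>L\<^sup>2\<close> and pointwise minimizers of \<open>p * u + g u\<close> grow at most linearly in \<open>p\<close>.
\<close>

locale convex_penalty =
  fixes g :: "real \<Rightarrow> ereal" and K :: real
  assumes g_nonneg: "\<And>u. 0 \<le> g u" and g_zero: "g 0 = 0"
    and g_convex: "convex_fun g" and g_lsc: "lsc_fun g"
    and K_pos: "0 < K"
    and growth: "\<And>u. g u < \<infinity> \<Longrightarrow> u\<^sup>2 \<le> K * (1 + real_of_ereal (g u))"
begin

definition gr :: "real \<Rightarrow> real" where "gr u = real_of_ereal (g u)"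

definition Hr :: "real \<Rightarrow> real" where "Hr p = real_of_ereal (Hbar g p)"

definition sel :: "real \<Rightarrow> real" where
  "sel p = (SOME w. \<forall>u. ereal (p * w) + g w \<le> ereal (p * u) + g u)"

lemma g_real: "g u < \<infinity> \<Longrightarrow> g u = ereal (gr u)"
  unfolding gr_def using g_nonneg[of u] by (cases "g u") auto

lemma gr_nonneg: "0 \<le> gr u"
  using g_nonneg[of u] by (simp add: gr_def real_of_ereal_pos)

lemma gr_zero [simp]: "gr 0 = 0"
  by (simp add: gr_def g_zero)

lemma g_borel [measurable]: "g \<in> borel_measurable borel"
  by (rule lsc_fun_borel[OF g_lsc])

lemma gr_borel [measurable]: "gr \<in> borel_measurable borel"
  unfolding gr_def by measurable

lemma convex_real:
  assumes "g u < \<infinity>" "g v < \<infinity>" "0 < l" "l < 1"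
  shows "g (l * u + (1 - l) * v) < \<infinity>"
    and "gr (l * u + (1 - l) * v) \<le> l * gr u + (1 - l) * gr v"
proof -
  have le: "g (l * u + (1 - l) * v) \<le> ereal (l * gr u + (1 - l) * gr v)"
    using g_convex[unfolded convex_fun_def, rule_format, of l u v] assms
    by (simp add: g_real)
  show fin: "g (l * u + (1 - l) * v) < \<infinity>" by (rule le_less_trans[OF le]) simp
  show "gr (l * u + (1 - l) * v) \<le> l * gr u + (1 - l) * gr v"
    using le g_real[OF fin] by simp
qed

text \<open>The linear term of the growth estimate is absorbed by completing the square.\<close>

lemma sublevel_bound:
  assumes "g w < \<infinity>" "p * w + gr w \<le> 0"
  shows "w\<^sup>2 \<le> 2 * K + K\<^sup>2 * p\<^sup>2"
proof -
  have "w\<^sup>2 \<le> K * (1 + gr w)" using growth[OF assms(1)] by (simp add: gr_def)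
  also have "\<dots> \<le> K * (1 - p * w)" using assms(2) K_pos by (intro mult_left_mono) auto
  finally have *: "w\<^sup>2 \<le> K * (1 - p * w)" .
  have "0 \<le> (K * p + w)\<^sup>2" by simp
  with * show ?thesis by (simp add: power2_eq_square algebra_simps)
qed

text \<open>
  The direct method: a minimizing sequence is bounded by the previous lemma, and \<open>g\<close> is lower
  semicontinuous along a convergent subsequence.
\<close>

lemma minimizer_exists: "\<exists>w. \<forall>u. ereal (p * w) + g w \<le> ereal (p * u) + g u"
proof -
  let ?f = "\<lambda>u. ereal (p * u) + g u"
  define m where "m = (INF u. ?f u)"
  have lower: "m \<le> ?f u" for u unfolding m_def by (rule INF_lower) simp
  show ?thesis
  proof (cases "m = 0")
    case True
    then have "?f 0 \<le> ?f u" for u using lower[of u] by (simp add: g_zero zero_ereal_def)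
    then show ?thesis by blast
  next
    case False
    moreover have "m \<le> 0" using lower[of 0] by (simp add: g_zero flip: zero_ereal_def)
    ultimately have m: "m < 0" by (simp add: less_le)
    obtain h where h: "\<And>n. h n \<in> range ?f" "h \<longlonglongrightarrow> m"
      using Inf_as_limit[of "range ?f"] unfolding m_def by blast
    then obtain w where w: "\<And>n. h n = ?f (w n)" unfolding image_iff by metis
    have "eventually (\<lambda>n. ?f (w n) < 0) sequentially"
      using order_tendstoD(2)[OF h(2) m] by (simp add: w)
    then obtain N where N: "\<And>n. n \<ge> N \<Longrightarrow> ?f (w n) < 0" by (auto simp: eventually_sequentially)
    define v where "v n = w (n + N)" for n
    have vlim: "(\<lambda>n. ?f (v n)) \<longlonglongrightarrow> m"
      using LIMSEQ_ignore_initial_segment[OF h(2), of N] by (simp add: w v_def)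
    have "(v n)\<^sup>2 \<le> 2 * K + K\<^sup>2 * p\<^sup>2" for n
    proof -
      have neg: "?f (v n) < 0" using N[of "n + N"] by (simp add: v_def)
      then have fin: "g (v n) < \<infinity>" by (cases "g (v n)") auto
      show ?thesis using neg by (intro sublevel_bound[OF fin, of p]) (simp add: g_real[OF fin])
    qed
    then have "\<bar>v n\<bar> \<le> sqrt (2 * K + K\<^sup>2 * p\<^sup>2)" for n
      using real_le_rsqrt by (metis power2_abs)
    then have "bounded (range v)" by (auto simp: bounded_iff)
    then obtain x r where r: "strict_mono r" and x: "(v \<circ> r) \<longlonglongrightarrow> x"
      using bounded_imp_convergent_subsequence by blast
    have x': "(\<lambda>n. v (r n)) \<longlonglongrightarrow> x" using x by (simp add: o_def)
    have "(\<lambda>n. ?f (v (r n)) + ereal (- (p * v (r n)))) \<longlonglongrightarrow> m + ereal (- (p * x))"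
    proof (rule tendsto_add_ereal_general1)
      show "(\<lambda>n. ereal (- (p * v (r n)))) \<longlonglongrightarrow> ereal (- (p * x))"
        using x' by (intro tendsto_intros)
    qed (use LIMSEQ_subseq_LIMSEQ[OF vlim r] in \<open>simp_all add: o_def\<close>)
    also have "(\<lambda>n. ?f (v (r n)) + ereal (- (p * v (r n)))) = (\<lambda>n. g (v (r n)))"
    proof
      fix n show "?f (v (r n)) + ereal (- (p * v (r n))) = g (v (r n))"
        using g_nonneg[of "v (r n)"] by (cases "g (v (r n))") auto
    qed
    finally have "liminf (\<lambda>n. g (v (r n))) = m + ereal (- (p * x))"
      by (intro lim_imp_Liminf) auto
    then have "g x \<le> m + ereal (- (p * x))"
      using lsc_fun_sequence[OF g_lsc x'] by simp
    then have "ereal (p * x) + g x \<le> ereal (p * x) + (m + ereal (- (p * x)))"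
      by (rule add_left_mono)
    also have "\<dots> = m" by (cases m) auto
    finally show ?thesis using lower order_trans by blast
  qed
qed

lemma sel_le: "ereal (p * sel p) + g (sel p) \<le> ereal (p * u) + g u"
  using someI_ex[OF minimizer_exists[of p]] unfolding sel_def by blast

lemma sel_fin: "g (sel p) < \<infinity>"
  using sel_le[of p 0] by (cases "g (sel p)") (auto simp: g_zero)

lemma Hr_eq: "Hr p = p * sel p + gr (sel p)"
proof -
  have "Hbar g p = ereal (p * sel p) + g (sel p)"
    unfolding Hbar_def by (rule antisym) (auto intro: INF_lower INF_greatest sel_le)
  then show ?thesis by (simp add: Hr_def g_real[OF sel_fin])
qed

lemma Hr_le: "g u < \<infinity> \<Longrightarrow> Hr p \<le> p * u + gr u"
  using sel_le[of p u] by (simp add: Hr_eq g_real[of u] g_real[OF sel_fin])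

lemma Hr_nonpos: "Hr p \<le> 0"
  using Hr_le[of 0 p] by (simp add: g_zero)

lemma sel_bound: "(sel p)\<^sup>2 \<le> 2 * K + K\<^sup>2 * p\<^sup>2"
  using Hr_nonpos[of p] by (intro sublevel_bound[OF sel_fin]) (simp add: Hr_eq)

lemma abs_Hr_le: "\<bar>Hr p\<bar> \<le> p\<^sup>2 + (sel p)\<^sup>2"
proof -
  have "- (2 * (p * sel p)) \<le> p\<^sup>2 + (sel p)\<^sup>2" using sum_squares_bound[of "- p" "sel p"] by (simp add: mult.assoc)
  moreover have "0 \<le> p\<^sup>2" "0 \<le> (sel p)\<^sup>2" by auto
  ultimately show ?thesis using Hr_nonpos[of p] gr_nonneg[of "sel p"] unfolding Hr_eq by linarith
qed

lemma gr_sel_le: "gr (sel p) \<le> p\<^sup>2 + (sel p)\<^sup>2"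
proof -
  have "- (2 * (p * sel p)) \<le> p\<^sup>2 + (sel p)\<^sup>2" using sum_squares_bound[of "- p" "sel p"] by (simp add: mult.assoc)
  moreover have "0 \<le> p\<^sup>2" "0 \<le> (sel p)\<^sup>2" by auto
  ultimately show ?thesis using Hr_nonpos[of p] unfolding Hr_eq by linarith
qed

text \<open>
  Minimizers of \<open>p * u + g u\<close> decrease in \<open>p\<close>, whichever of them is selected; adding the two
  optimality inequalities shows this. Hence the selection is measurable.
\<close>

lemma sel_antimono: "p \<le> p' \<Longrightarrow> sel p' \<le> sel p"
proof (cases "p = p'")
  case False
  assume "p \<le> p'"
  with False have "p < p'" by simp
  have "(p - p') * (sel p - sel p') \<le> 0"
    using Hr_le[OF sel_fin[of p'], of p] Hr_le[OF sel_fin[of p], of p'] by (simp add: Hr_eq algebra_simps)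
  with \<open>p < p'\<close> show ?thesis by (simp add: mult_le_0_iff)
qed simp

lemma sel_borel [measurable]: "sel \<in> borel_measurable borel"
proof -
  have "(\<lambda>p. - sel p) \<in> borel_measurable borel"
    by (rule borel_measurable_mono) (auto simp: mono_def intro: sel_antimono)
  then have "(\<lambda>p. - (- sel p)) \<in> borel_measurable borel" by measurable
  then show ?thesis by simp
qed

lemma Hr_borel [measurable]: "Hr \<in> borel_measurable borel"
  unfolding Hr_eq[abs_def] by measurable

end

section \<open>Existence of optimal controls\<close>

lemma abs_powr_2: "\<bar>x::real\<bar> powr 2 = x\<^sup>2"
  by simp

lemma Lp_2_iff: "u \<in> Lp \<Omega> 2 \<longleftrightarrow>
    u \<in> borel_measurable (lebesgue_on \<Omega>) \<and> integrable (lebesgue_on \<Omega>) (\<lambda>x. (u x)\<^sup>2)"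
  by (simp add: Lp_def abs_powr_2)

lemma Lp_norm_2: "Lp_norm \<Omega> 2 u = sqrt (\<integral>x. (u x)\<^sup>2 \<partial>lebesgue_on \<Omega>)"
  by (simp add: Lp_norm_def abs_powr_2 powr_half_sqrt)

lemma ereal_integral_real:
  assumes "AE x in M. f x = ereal (r x)" "integrable M r"
  shows "ereal_integral M f = ereal (\<integral>x. r x \<partial>M)"
proof -
  have "(\<integral>\<^sup>+x. e2ennreal (f x) \<partial>M) = (\<integral>\<^sup>+x. ennreal (r x) \<partial>M)"
    by (rule nn_integral_cong_AE) (use assms(1) in eventually_elim, simp add: ennreal.abs_eq e2ennreal_def)
  moreover have "(\<integral>\<^sup>+x. e2ennreal (- f x) \<partial>M) = (\<integral>\<^sup>+x. ennreal (- r x) \<partial>M)"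
    by (rule nn_integral_cong_AE) (use assms(1) in eventually_elim, simp)
  moreover have "(\<integral>\<^sup>+x. ennreal (r x) \<partial>M) \<noteq> \<infinity>" "(\<integral>\<^sup>+x. ennreal (- r x) \<partial>M) \<noteq> \<infinity>"
    using assms(2) by (auto simp: real_integrable_def)
  ultimately show ?thesis
    using real_lebesgue_integral_def[OF assms(2)]
    by (cases "\<integral>\<^sup>+x. ennreal (r x) \<partial>M"; cases "\<integral>\<^sup>+x. ennreal (- r x) \<partial>M")
       (auto simp: ereal_integral_def)
qed

lemma ereal_integral_infinite:
  fixes f :: "'b \<Rightarrow> ereal"
  assumes [measurable]: "f \<in> borel_measurable M" and f: "\<And>x. 0 \<le> f x" and b: "integrable M b"
    and inf: "(\<integral>\<^sup>+x. e2ennreal (f x) \<partial>M) = \<infinity>"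
  shows "ereal_integral M (\<lambda>x. f x + ereal (b x)) = \<infinity>"
proof -
  have [measurable]: "b \<in> borel_measurable M" using b by auto
  have fin: "(\<integral>\<^sup>+x. ennreal \<bar>b x\<bar> \<partial>M) < \<infinity>"
    using b by (simp add: integrable_iff_bounded)
  have "e2ennreal (f x) \<le> e2ennreal (f x + ereal (b x)) + ennreal \<bar>b x\<bar>" for x
  proof (cases "f x")
    case (real a)
    have "ennreal a \<le> ennreal (max 0 (a + b x) + \<bar>b x\<bar>)" by (rule ennreal_leI) auto
    also have "\<dots> = ennreal (a + b x) + ennreal \<bar>b x\<bar>"
      by (subst ennreal_plus) (auto simp: max_def ennreal_neg)
    finally show ?thesis by (simp add: real)
  qed (use f[of x] in auto)
  then have "(\<integral>\<^sup>+x. e2ennreal (f x) \<partial>M) \<le> (\<integral>\<^sup>+x. e2ennreal (f x + ereal (b x)) + ennreal \<bar>b x\<bar> \<partial>M)"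
    by (intro nn_integral_mono)
  also have "\<dots> = (\<integral>\<^sup>+x. e2ennreal (f x + ereal (b x)) \<partial>M) + (\<integral>\<^sup>+x. ennreal \<bar>b x\<bar> \<partial>M)"
    by (rule nn_integral_add) measurable
  finally have pos: "(\<integral>\<^sup>+x. e2ennreal (f x + ereal (b x)) \<partial>M) = \<infinity>"
    using inf fin by (auto simp: top_unique ennreal_add_eq_top)
  have "e2ennreal (- (f x + ereal (b x))) \<le> ennreal \<bar>b x\<bar>" for x
    using f[of x] by (cases "f x") (auto intro: ennreal_leI simp: e2ennreal_neg)
  then have "(\<integral>\<^sup>+x. e2ennreal (- (f x + ereal (b x))) \<partial>M) \<le> (\<integral>\<^sup>+x. ennreal \<bar>b x\<bar> \<partial>M)"
    by (intro nn_integral_mono)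
  then have "(\<integral>\<^sup>+x. e2ennreal (- (f x + ereal (b x))) \<partial>M) < \<infinity>" using fin by (rule order_le_less_trans)
  then show ?thesis
    by (cases "\<integral>\<^sup>+x. e2ennreal (- (f x + ereal (b x))) \<partial>M") (simp_all add: ereal_integral_def pos)
qed

text \<open>
  A control of finite cost is an element of \<open>adm\<close>; on this set the extended real cost agrees with
  the real number \<open>rcost\<close>, and all later estimates take place in the reals.
\<close>

locale design_problem = convex_penalty g K
  for g :: "real \<Rightarrow> ereal" and K :: real +
  fixes \<Omega> :: "'a::euclidean_space set"
    and S :: "('a \<Rightarrow> real) \<Rightarrow> 'y::{real_inner, complete_space}"
    and Sadj :: "'y \<Rightarrow> 'a \<Rightarrow> real" and yd :: 'y and \<beta> :: "'a \<Rightarrow> real"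
  assumes \<Omega>_sets: "\<Omega> \<in> sets lebesgue" and \<Omega>_fin: "emeasure lebesgue \<Omega> < \<infinity>"
    and S_bl: "bounded_linear_from_Lp \<Omega> 2 S" and S_adj: "is_L2_adjoint \<Omega> S Sadj"
    and \<beta>_int: "integrable (lebesgue_on \<Omega>) \<beta>"
begin

abbreviation "M \<equiv> lebesgue_on \<Omega>"

definition adm :: "('a \<Rightarrow> real) set" where
  "adm = {u \<in> Lp \<Omega> 2. (AE x in M. g (u x) < \<infinity>) \<and> integrable M (\<lambda>x. gr (u x))}"

definition rcost :: "('a \<Rightarrow> real) \<Rightarrow> 'a set \<Rightarrow> real" where
  "rcost u A = 1 / 2 * (norm (S (\<lambda>x. indicator A x * u x) - yd))\<^sup>2
     + (\<integral>x. gr (u x) \<partial>M) + (\<integral>x. indicator A x * \<beta> x \<partial>M)"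

lemma finite_M: "finite_measure M"
  using \<Omega>_sets \<Omega>_fin by (intro finite_measure_lebesgue_on) (simp add: fmeasurable_def)

lemma \<Omega>_lmeasurable: "\<Omega> \<in> lmeasurable"
  using \<Omega>_sets \<Omega>_fin by (simp add: fmeasurable_def)

lemma ind_meas [measurable]:
  "A \<in> sets lebesgue \<Longrightarrow> (indicator A :: 'a \<Rightarrow> real) \<in> borel_measurable M"
  by (intro measurable_restrict_space1 borel_measurable_indicator)

lemma integrable_ind:
  fixes f :: "'a \<Rightarrow> real"
  assumes A: "A \<in> sets lebesgue" and f: "integrable M f"
  shows "integrable M (\<lambda>x. indicator A x * f x)"
proof (rule Bochner_Integration.integrable_bound[OF f])
  show "(\<lambda>x. indicator A x * f x) \<in> borel_measurable M" using A f by measurable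
qed (auto split: split_indicator)

lemma L2_meas [measurable_dest]: "u \<in> Lp \<Omega> 2 \<Longrightarrow> u \<in> borel_measurable M"
  and L2_sq: "u \<in> Lp \<Omega> 2 \<Longrightarrow> integrable M (\<lambda>x. (u x)\<^sup>2)"
  by (simp_all add: Lp_2_iff)

lemma L2I: "u \<in> borel_measurable M \<Longrightarrow> integrable M (\<lambda>x. (u x)\<^sup>2) \<Longrightarrow> u \<in> Lp \<Omega> 2"
  by (simp add: Lp_2_iff)

lemma L2_bound:
  assumes "u \<in> borel_measurable M" "integrable M h" "AE x in M. (u x)\<^sup>2 \<le> h x"
  shows "u \<in> Lp \<Omega> 2"
proof (rule L2I[OF assms(1)])
  show "integrable M (\<lambda>x. (u x)\<^sup>2)"
  proof (rule Bochner_Integration.integrable_bound[OF assms(2)])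
    show "(\<lambda>x. (u x)\<^sup>2) \<in> borel_measurable M" using assms(1) by measurable
    show "AE x in M. norm ((u x)\<^sup>2) \<le> norm (h x)"
      using assms(3) by eventually_elim auto
  qed
qed

lemma L2_zero: "(\<lambda>x. 0) \<in> Lp \<Omega> 2"
  by (rule L2I) auto

lemma L2_add: "u \<in> Lp \<Omega> 2 \<Longrightarrow> v \<in> Lp \<Omega> 2 \<Longrightarrow> (\<lambda>x. u x + v x) \<in> Lp \<Omega> 2"
  using integrable_square_add[of u M v] by (intro L2I) (auto simp: Lp_2_iff)

lemma L2_scale: "u \<in> Lp \<Omega> 2 \<Longrightarrow> (\<lambda>x. c * u x) \<in> Lp \<Omega> 2"
  by (intro L2I) (auto simp: Lp_2_iff power_mult_distrib)

lemma L2_diff: "u \<in> Lp \<Omega> 2 \<Longrightarrow> v \<in> Lp \<Omega> 2 \<Longrightarrow> (\<lambda>x. u x - v x) \<in> Lp \<Omega> 2"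
  using L2_add[of u "\<lambda>x. (-1) * v x"] L2_scale[of v "-1"] by simp

lemma L2_ind:
  assumes "A \<in> sets lebesgue" "u \<in> Lp \<Omega> 2"
  shows "(\<lambda>x. indicator A x * u x) \<in> Lp \<Omega> 2"
  by (rule L2_bound[OF _ L2_sq[OF assms(2)]])
     (use assms L2_meas[OF assms(2)] in \<open>auto intro!: AE_I2 split: split_indicator\<close>)

lemma L2_mult_integrable: "u \<in> Lp \<Omega> 2 \<Longrightarrow> v \<in> Lp \<Omega> 2 \<Longrightarrow> integrable M (\<lambda>x. u x * v x)"
  by (rule integrable_mult_of_squares) (simp_all add: Lp_2_iff)

lemma Sadj_L2: "Sadj y \<in> Lp \<Omega> 2"
  using S_adj by (simp add: is_L2_adjoint_def)

lemma S_inner: "u \<in> Lp \<Omega> 2 \<Longrightarrow> S u \<bullet> y = (\<integral>x. u x * Sadj y x \<partial>M)"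
  using S_adj by (simp add: is_L2_adjoint_def)

lemma S_add: "u \<in> Lp \<Omega> 2 \<Longrightarrow> v \<in> Lp \<Omega> 2 \<Longrightarrow> S (\<lambda>x. u x + v x) = S u + S v"
  and S_scale: "u \<in> Lp \<Omega> 2 \<Longrightarrow> S (\<lambda>x. c * u x) = c *\<^sub>R S u"
  using S_bl by (auto simp: bounded_linear_from_Lp_def)

lemma S_diff: "u \<in> Lp \<Omega> 2 \<Longrightarrow> v \<in> Lp \<Omega> 2 \<Longrightarrow> S (\<lambda>x. u x - v x) = S u - S v"
  using S_add[of u "\<lambda>x. (-1) * v x"] S_scale[of v "-1"] L2_scale[of v "-1"] by simp

lemma S_bounded: "\<exists>C. \<forall>u\<in>Lp \<Omega> 2. norm (S u) \<le> C * sqrt (\<integral>x. (u x)\<^sup>2 \<partial>M)"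
  using S_bl by (auto simp: bounded_linear_from_Lp_def Lp_norm_2)

lemma S_convergence:
  assumes u: "\<And>n. u n \<in> Lp \<Omega> 2" and v: "v \<in> Lp \<Omega> 2" and A: "A \<in> sets lebesgue"
    and lim: "(\<lambda>n. \<integral>x. (u n x - v x)\<^sup>2 \<partial>M) \<longlonglongrightarrow> 0"
  shows "(\<lambda>n. S (\<lambda>x. indicator A x * u n x)) \<longlonglongrightarrow> S (\<lambda>x. indicator A x * v x)"
proof -
  obtain C where C: "\<And>u. u \<in> Lp \<Omega> 2 \<Longrightarrow> norm (S u) \<le> C * sqrt (\<integral>x. (u x)\<^sup>2 \<partial>M)"
    using S_bounded by blast
  have "(\<lambda>n. S (\<lambda>x. indicator A x * u n x) - S (\<lambda>x. indicator A x * v x)) \<longlonglongrightarrow> 0"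
  proof (rule tendsto_0_le[where K = 1])
    have "(\<lambda>n. \<bar>C\<bar> * sqrt (\<integral>x. (u n x - v x)\<^sup>2 \<partial>M)) \<longlonglongrightarrow> \<bar>C\<bar> * sqrt 0"
      by (intro tendsto_intros lim)
    then show "(\<lambda>n. \<bar>C\<bar> * sqrt (\<integral>x. (u n x - v x)\<^sup>2 \<partial>M)) \<longlonglongrightarrow> 0" by simp
    show "\<forall>\<^sub>F n in sequentially. norm (S (\<lambda>x. indicator A x * u n x) - S (\<lambda>x. indicator A x * v x))
        \<le> norm (\<bar>C\<bar> * sqrt (\<integral>x. (u n x - v x)\<^sup>2 \<partial>M)) * 1"
    proof (rule always_eventually, rule allI)
      fix n
      let ?d = "\<lambda>x. indicator A x * u n x - indicator A x * v x"
      have d: "?d \<in> Lp \<Omega> 2" by (intro L2_diff L2_ind A u v)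
      have "norm (S (\<lambda>x. indicator A x * u n x) - S (\<lambda>x. indicator A x * v x)) = norm (S ?d)"
        by (subst S_diff) (auto intro: L2_ind A u v)
      also have "\<dots> \<le> C * sqrt (\<integral>x. (?d x)\<^sup>2 \<partial>M)" by (rule C[OF d])
      also have "\<dots> \<le> \<bar>C\<bar> * sqrt (\<integral>x. (?d x)\<^sup>2 \<partial>M)" by (intro mult_right_mono) auto
      also have "\<dots> \<le> \<bar>C\<bar> * sqrt (\<integral>x. (u n x - v x)\<^sup>2 \<partial>M)"
        by (intro mult_left_mono real_sqrt_le_mono integral_mono L2_sq d L2_diff u v)
           (auto split: split_indicator)
      finally show "norm (S (\<lambda>x. indicator A x * u n x) - S (\<lambda>x. indicator A x * v x))
        \<le> norm (\<bar>C\<bar> * sqrt (\<integral>x. (u n x - v x)\<^sup>2 \<partial>M)) * 1" by (simp add: abs_mult)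
    qed
  qed
  then show ?thesis by (rule LIM_zero_cancel)
qed

lemma adm_L2: "u \<in> adm \<Longrightarrow> u \<in> Lp \<Omega> 2"
  and adm_fin: "u \<in> adm \<Longrightarrow> AE x in M. g (u x) < \<infinity>"
  and adm_int: "u \<in> adm \<Longrightarrow> integrable M (\<lambda>x. gr (u x))"
  by (auto simp: adm_def)

lemma zero_adm: "(\<lambda>x. 0) \<in> adm"
  by (simp add: adm_def L2_zero g_zero)

lemma adm_of_nn_integral:
  assumes u: "u \<in> Lp \<Omega> 2" and le: "(\<integral>\<^sup>+x. e2ennreal (g (u x)) \<partial>M) \<le> ennreal E"
  shows "u \<in> adm" and "0 \<le> E \<Longrightarrow> (\<integral>x. gr (u x) \<partial>M) \<le> E"
proof -
  note [measurable] = L2_meas[OF u]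
  have "(\<integral>\<^sup>+x. e2ennreal (g (u x)) \<partial>M) \<noteq> \<infinity>" using le by (auto simp: top_unique)
  then have "AE x in M. e2ennreal (g (u x)) \<noteq> \<infinity>"
    by (intro nn_integral_noteq_infinite) auto
  then have fin: "AE x in M. g (u x) < \<infinity>"
  proof eventually_elim
    case (elim x)
    then show ?case by (cases "g (u x)") auto
  qed
  have eq: "(\<integral>\<^sup>+x. e2ennreal (g (u x)) \<partial>M) = (\<integral>\<^sup>+x. ennreal (gr (u x)) \<partial>M)"
    by (rule nn_integral_cong_AE) (use fin in eventually_elim, simp add: g_real)
  have int: "integrable M (\<lambda>x. gr (u x))"
    by (rule integrableI_bounded) (use eq le gr_nonneg in \<open>auto intro: le_less_trans\<close>)
  with fin u show "u \<in> adm" by (simp add: adm_def)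
  show "0 \<le> E \<Longrightarrow> (\<integral>x. gr (u x) \<partial>M) \<le> E"
    using le unfolding eq by (subst (asm) nn_integral_eq_integral[OF int]) (auto simp: gr_nonneg)
qed

lemma cost_eq_rcost:
  assumes u: "u \<in> adm" and A: "A \<in> sets lebesgue"
  shows "cost \<Omega> S yd g \<beta> u A = ereal (rcost u A)"
proof -
  have "ereal_integral M (\<lambda>x. g (u x) + ereal (indicator A x * \<beta> x))
      = ereal (\<integral>x. gr (u x) + indicator A x * \<beta> x \<partial>M)"
    by (rule ereal_integral_real)
       (use adm_fin[OF u] adm_int[OF u] integrable_ind[OF A \<beta>_int] in \<open>auto simp: g_real elim!: eventually_mono\<close>)
  then show ?thesis
    using adm_int[OF u] integrable_ind[OF A \<beta>_int] by (simp add: cost_def rcost_def)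
qed

lemma cost_infinite:
  assumes u: "u \<in> Lp \<Omega> 2" "u \<notin> adm" and A: "A \<in> sets lebesgue"
  shows "cost \<Omega> S yd g \<beta> u A = \<infinity>"
proof -
  note [measurable] = L2_meas[OF u(1)]
  have "(\<integral>\<^sup>+x. e2ennreal (g (u x)) \<partial>M) = \<infinity>"
  proof (rule ccontr)
    assume "\<not> ?thesis"
    then obtain E where "(\<integral>\<^sup>+x. e2ennreal (g (u x)) \<partial>M) = ennreal E"
      by (cases "\<integral>\<^sup>+x. e2ennreal (g (u x)) \<partial>M") auto
    with adm_of_nn_integral(1)[OF u(1), of E] u(2) show False by simp
  qed
  then have "ereal_integral M (\<lambda>x. g (u x) + ereal (indicator A x * \<beta> x)) = \<infinity>"
    by (intro ereal_integral_infinite integrable_ind A \<beta>_int) (auto simp: g_nonneg)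
  then show ?thesis by (simp add: cost_def)
qed

lemma adm_sq_le:
  assumes u: "u \<in> adm"
  shows "(\<integral>x. (u x)\<^sup>2 \<partial>M) \<le> K * (measure M \<Omega> + (\<integral>x. gr (u x) \<partial>M))"
proof -
  interpret finite_measure M by (rule finite_M)
  have "(\<integral>x. (u x)\<^sup>2 \<partial>M) \<le> (\<integral>x. K * (1 + gr (u x)) \<partial>M)"
  proof (rule integral_mono_AE)
    show "AE x in M. (u x)\<^sup>2 \<le> K * (1 + gr (u x))"
      using adm_fin[OF u] by eventually_elim (use growth in \<open>simp add: gr_def\<close>)
  qed (use L2_sq[OF adm_L2[OF u]] adm_int[OF u] in auto)
  also have "\<dots> = K * (measure M \<Omega> + (\<integral>x. gr (u x) \<partial>M))"
    using adm_int[OF u] by simp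
  finally show ?thesis .
qed

lemma adm_convex:
  assumes u: "u \<in> adm" and v: "v \<in> adm" and l: "0 < l" "l < 1"
  shows "(\<lambda>x. l * u x + (1 - l) * v x) \<in> adm"
    and "(\<integral>x. gr (l * u x + (1 - l) * v x) \<partial>M) \<le> l * (\<integral>x. gr (u x) \<partial>M) + (1 - l) * (\<integral>x. gr (v x) \<partial>M)"
proof -
  note [measurable] = L2_meas[OF adm_L2[OF u]] L2_meas[OF adm_L2[OF v]]
  have bound: "AE x in M. g (l * u x + (1 - l) * v x) < \<infinity> \<and>
      gr (l * u x + (1 - l) * v x) \<le> l * gr (u x) + (1 - l) * gr (v x)"
    using adm_fin[OF u] adm_fin[OF v] by eventually_elim (use convex_real l in auto)
  have int: "integrable M (\<lambda>x. l * gr (u x) + (1 - l) * gr (v x))"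
    using adm_int[OF u] adm_int[OF v] by simp
  have int': "integrable M (\<lambda>x. gr (l * u x + (1 - l) * v x))"
  proof (rule Bochner_Integration.integrable_bound[OF int])
    show "AE x in M. norm (gr (l * u x + (1 - l) * v x)) \<le> norm (l * gr (u x) + (1 - l) * gr (v x))"
      using bound by eventually_elim (auto simp: gr_nonneg intro: order_trans[OF _ abs_ge_self])
  qed measurable
  show "(\<lambda>x. l * u x + (1 - l) * v x) \<in> adm"
    unfolding adm_def using bound int' L2_add[OF L2_scale L2_scale, OF adm_L2[OF u] adm_L2[OF v]]
    by (auto elim!: eventually_mono)
  have "(\<integral>x. gr (l * u x + (1 - l) * v x) \<partial>M) \<le> (\<integral>x. l * gr (u x) + (1 - l) * gr (v x) \<partial>M)"
    by (rule integral_mono_AE[OF int' int]) (use bound in \<open>auto elim!: eventually_mono\<close>)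
  then show "(\<integral>x. gr (l * u x + (1 - l) * v x) \<partial>M) \<le> l * (\<integral>x. gr (u x) \<partial>M) + (1 - l) * (\<integral>x. gr (v x) \<partial>M)"
    using adm_int[OF u] adm_int[OF v] by simp
qed

lemma adm_ind:
  assumes u: "u \<in> adm" and A: "A \<in> sets lebesgue"
  shows "(\<lambda>x. indicator A x * u x) \<in> adm"
    and "(\<integral>x. gr (indicator A x * u x) \<partial>M) \<le> (\<integral>x. gr (u x) \<partial>M)"
proof -
  note [measurable] = L2_meas[OF adm_L2[OF u]] A
  have int': "integrable M (\<lambda>x. gr (indicator A x * u x))"
    by (rule Bochner_Integration.integrable_bound[OF adm_int[OF u]])
       (auto intro!: AE_I2 simp: gr_nonneg split: split_indicator)
  have "AE x in M. g (indicator A x * u x) < \<infinity>"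
    using adm_fin[OF u] by eventually_elim (auto simp: g_zero split: split_indicator)
  then show "(\<lambda>x. indicator A x * u x) \<in> adm"
    using int' L2_ind[OF A adm_L2[OF u]] by (simp add: adm_def)
  show "(\<integral>x. gr (indicator A x * u x) \<partial>M) \<le> (\<integral>x. gr (u x) \<partial>M)"
    by (rule integral_mono[OF int' adm_int[OF u]]) (auto simp: gr_nonneg split: split_indicator)
qed

lemma midpoint_norm_sq:
  fixes a b :: "'c::real_inner"
  shows "(norm ((1/2) *\<^sub>R (a + b)))\<^sup>2 \<le> ((norm a)\<^sup>2 + (norm b)\<^sup>2) / 2"
proof -
  have "0 \<le> (norm (a - b))\<^sup>2" by simp
  moreover have "(norm ((1/2) *\<^sub>R (a + b)))\<^sup>2 = (norm (a + b))\<^sup>2 / 4"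
    by (simp add: power_divide)
  ultimately show ?thesis
    by (simp add: power2_norm_eq_inner inner_add_left inner_add_right inner_diff_left inner_diff_right inner_commute)
qed

lemma rcost_midpoint:
  assumes u: "u \<in> adm" and v: "v \<in> adm" and A: "A \<in> sets lebesgue"
  shows "rcost (\<lambda>x. (u x + v x) / 2) A \<le> (rcost u A + rcost v A) / 2"
proof -
  have eq: "(\<lambda>x. (u x + v x) / 2) = (\<lambda>x. 1/2 * u x + (1 - 1/2) * v x)" by (auto simp: add_divide_distrib)
  let ?su = "S (\<lambda>x. indicator A x * u x)" and ?sv = "S (\<lambda>x. indicator A x * v x)"
  have L: "(\<lambda>x. indicator A x * u x) \<in> Lp \<Omega> 2" "(\<lambda>x. indicator A x * v x) \<in> Lp \<Omega> 2"
    using L2_ind A adm_L2 u v by auto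
  have "S (\<lambda>x. indicator A x * ((u x + v x) / 2))
      = S (\<lambda>x. 1/2 * (indicator A x * u x) + 1/2 * (indicator A x * v x))"
    by (rule arg_cong[where f = S]) (auto simp: algebra_simps)
  also have "\<dots> = (1/2) *\<^sub>R ?su + (1/2) *\<^sub>R ?sv"
    using S_add[OF L2_scale L2_scale, OF L, of "1/2" "1/2"] S_scale[OF L(1), of "1/2"] S_scale[OF L(2), of "1/2"] by simp
  finally have s: "S (\<lambda>x. indicator A x * ((u x + v x) / 2)) = (1/2) *\<^sub>R ?su + (1/2) *\<^sub>R ?sv" .
  have "(1/2) *\<^sub>R ?su + (1/2) *\<^sub>R ?sv - yd = (1/2) *\<^sub>R ?su + (1/2) *\<^sub>R ?sv - ((1/2) *\<^sub>R yd + (1/2) *\<^sub>R yd)"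
    by (simp flip: scaleR_left_distrib)
  also have "\<dots> = (1/2) *\<^sub>R ((?su - yd) + (?sv - yd))"
    by (simp add: scaleR_right_distrib scaleR_right_diff_distrib)
  finally have "S (\<lambda>x. indicator A x * ((u x + v x) / 2)) - yd = (1/2) *\<^sub>R ((?su - yd) + (?sv - yd))"
    unfolding s .
  then have "(norm (S (\<lambda>x. indicator A x * ((u x + v x) / 2)) - yd))\<^sup>2
      \<le> ((norm (?su - yd))\<^sup>2 + (norm (?sv - yd))\<^sup>2) / 2"
    using midpoint_norm_sq[of "?su - yd" "?sv - yd"] by simp
  moreover have "(\<integral>x. gr ((u x + v x) / 2) \<partial>M) \<le> ((\<integral>x. gr (u x) \<partial>M) + (\<integral>x. gr (v x) \<partial>M)) / 2"
    using adm_convex(2)[OF u v, of "1/2"] by (simp add: add_divide_distrib)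
  ultimately show ?thesis by (simp add: rcost_def)
qed

text \<open>
  A minimizer exists because the nested sublevel sets of the cost are convex and bounded in \<open>L\<^sup>2\<close>:
  elements of almost minimal norm converge strongly, and the cost is lower semicontinuous along
  this sequence by Fatou's lemma. Multiplication of the limit by the indicator of \<open>A\<close> leaves the state
  unchanged and does not increase the penalty, whence a minimizer that vanishes outside of \<open>A\<close>.
\<close>

lemma solution_exists:
  assumes A: "A \<in> sets lebesgue"
  shows "\<exists>u y p. is_solution \<Omega> S Sadj yd g \<beta> A u y p"
proof -
  let ?b = "\<integral>x. indicator A x * \<beta> x \<partial>M"
  define m where "m = Inf ((\<lambda>u. rcost u A) ` adm)"
  have ge: "?b + (\<integral>x. gr (u x) \<partial>M) \<le> rcost u A" for u by (simp add: rcost_def)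
  have ge': "?b \<le> rcost u A" for u
  proof -
    have "0 \<le> (\<integral>x. gr (u x) \<partial>M)" by (simp add: gr_nonneg)
    with ge[of u] show ?thesis by linarith
  qed
  have bb: "bdd_below ((\<lambda>u. rcost u A) ` adm)" using ge' by (intro bdd_belowI2)
  have mle: "m \<le> rcost u A" if "u \<in> adm" for u unfolding m_def by (rule cINF_lower[OF bb that])
  define Kn where "Kn n = {u \<in> adm. rcost u A \<le> m + 1 / real (Suc n)}" for n
  have frac: "1 / real (Suc n) \<le> 1 / real (Suc k)" if "k \<le> n" for k n using that by (simp add: frac_le)
  obtain u where uK: "\<And>n. u n \<in> Kn n"
    and cau: "\<And>e. e > 0 \<Longrightarrow> \<exists>N. \<forall>i\<ge>N. \<forall>j\<ge>N. (\<integral>x. (u i x - u j x)\<^sup>2 \<partial>M) < e"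
  proof (rule nested_convex_Cauchy[where K = Kn and C = "K * (measure M \<Omega> + (m + 1 - ?b))"])
    fix n u assume u: "u \<in> Kn n"
    then have u': "u \<in> adm" by (simp add: Kn_def)
    show "u \<in> borel_measurable M" "integrable M (\<lambda>x. (u x)\<^sup>2)"
      using L2_meas L2_sq adm_L2[OF u'] by auto
    have "rcost u A \<le> m + 1 / real (Suc n)" "1 / real (Suc n) \<le> 1" using u by (simp_all add: Kn_def)
    then have "rcost u A \<le> m + 1" by linarith
    with ge[of u] have "(\<integral>x. gr (u x) \<partial>M) \<le> m + 1 - ?b" by simp
    then have "K * (measure M \<Omega> + (\<integral>x. gr (u x) \<partial>M)) \<le> K * (measure M \<Omega> + (m + 1 - ?b))"
      using K_pos by (intro mult_left_mono add_left_mono) auto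
    with adm_sq_le[OF u'] show "(\<integral>x. (u x)\<^sup>2 \<partial>M) \<le> K * (measure M \<Omega> + (m + 1 - ?b))" by linarith
  next
    fix n
    have "\<exists>a\<in>(\<lambda>u. rcost u A) ` adm. a < m + 1 / real (Suc n)"
      by (rule cInf_lessD) (use zero_adm in \<open>auto simp: m_def\<close>)
    then show "Kn n \<noteq> {}" by (auto simp: Kn_def intro: less_imp_le)
  next
    fix k n :: nat assume "k \<le> n"
    then show "Kn n \<subseteq> Kn k" using frac[of k n] by (auto simp: Kn_def)
  next
    fix n u v assume uv: "u \<in> Kn n" "v \<in> Kn n"
    then have a: "u \<in> adm" "v \<in> adm" by (auto simp: Kn_def)
    have "(\<lambda>x. (u x + v x) / 2) = (\<lambda>x. 1/2 * u x + (1 - 1/2) * v x)" by (auto simp: add_divide_distrib)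
    then have "(\<lambda>x. (u x + v x) / 2) \<in> adm" using adm_convex(1)[OF a, of "1/2"] by simp
    then show "(\<lambda>x. (u x + v x) / 2) \<in> Kn n"
      using rcost_midpoint[OF a A] uv by (simp add: Kn_def)
  qed blast
  have ua: "u n \<in> adm" and uc: "rcost (u n) A \<le> m + 1 / real (Suc n)" for n using uK[of n] by (auto simp: Kn_def)
  obtain v r where v: "v \<in> borel_measurable M" "integrable M (\<lambda>x. (v x)\<^sup>2)" and r: "strict_mono r"
    and ae: "AE x in M. (\<lambda>n. u (r n) x) \<longlonglongrightarrow> v x"
    and lim: "(\<lambda>n. \<integral>x. (u n x - v x)\<^sup>2 \<partial>M) \<longlonglongrightarrow> 0"
    by (rule L2_complete[OF finite_M _ _ cau]) (use L2_meas L2_sq adm_L2[OF ua] in auto)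
  have vL: "v \<in> Lp \<Omega> 2" using v by (rule L2I)
  \<comment> \<open>the upper bound for the penalty of \<open>u n\<close> that the sublevel condition leaves, and its limit\<close>
  define e where "e n = m + 1 / real (Suc n) - ?b - 1/2 * (norm (S (\<lambda>x. indicator A x * u n x) - yd))\<^sup>2" for n
  define E where "E = m - ?b - 1/2 * (norm (S (\<lambda>x. indicator A x * v x) - yd))\<^sup>2"
  have gu: "(\<integral>x. gr (u n x) \<partial>M) \<le> e n" for n using uc[of n] by (simp add: e_def rcost_def)
  have "e \<longlonglongrightarrow> m + 0 - ?b - 1/2 * (norm (S (\<lambda>x. indicator A x * v x) - yd))\<^sup>2"
    unfolding e_def
    by (intro tendsto_intros S_convergence adm_L2 ua vL A lim)
       (use LIMSEQ_inverse_real_of_nat in \<open>simp add: inverse_eq_divide\<close>)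
  then have eE: "e \<longlonglongrightarrow> E" by (simp add: E_def)
  have "0 \<le> e n" for n
  proof -
    have "0 \<le> (\<integral>x. gr (u n x) \<partial>M)" by (simp add: gr_nonneg)
    with gu[of n] show ?thesis by linarith
  qed
  then have E0: "0 \<le> E" using eE by (intro LIMSEQ_le_const[OF eE]) auto
  have erE: "(\<lambda>n. e (r n)) \<longlonglongrightarrow> E" using LIMSEQ_subseq_LIMSEQ[OF eE r] by (simp add: o_def)
  note [measurable] = v(1) L2_meas[OF adm_L2[OF ua]]
  have "(\<integral>\<^sup>+x. e2ennreal (g (v x)) \<partial>M) \<le> (\<integral>\<^sup>+x. liminf (\<lambda>n. e2ennreal (g (u (r n) x))) \<partial>M)"
  proof (rule nn_integral_mono_AE)
    show "AE x in M. e2ennreal (g (v x)) \<le> liminf (\<lambda>n. e2ennreal (g (u (r n) x)))"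
      using ae
    proof eventually_elim
      fix x assume "(\<lambda>n. u (r n) x) \<longlonglongrightarrow> v x"
      then have "g (v x) \<le> liminf (\<lambda>n. g (u (r n) x))" by (rule lsc_fun_sequence[OF g_lsc])
      then have "e2ennreal (g (v x)) \<le> e2ennreal (liminf (\<lambda>n. g (u (r n) x)))" by (rule e2ennreal_mono)
      also have "\<dots> = liminf (\<lambda>n. e2ennreal (g (u (r n) x)))"
        by (rule Liminf_compose_continuous_mono[symmetric])
           (auto intro: continuous_on_e2ennreal simp: mono_def e2ennreal_mono)
      finally show "e2ennreal (g (v x)) \<le> liminf (\<lambda>n. e2ennreal (g (u (r n) x)))" .
    qed
  qed
  also have "\<dots> \<le> liminf (\<lambda>n. \<integral>\<^sup>+x. e2ennreal (g (u (r n) x)) \<partial>M)"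
    by (rule nn_integral_liminf) measurable
  also have "\<dots> \<le> liminf (\<lambda>n. ennreal (e (r n)))"
  proof (rule Liminf_mono, rule always_eventually, rule allI)
    fix n
    have "(\<integral>\<^sup>+x. e2ennreal (g (u (r n) x)) \<partial>M) = (\<integral>\<^sup>+x. ennreal (gr (u (r n) x)) \<partial>M)"
      by (rule nn_integral_cong_AE) (use adm_fin[OF ua[of "r n"]] in eventually_elim, simp add: g_real)
    also have "\<dots> = ennreal (\<integral>x. gr (u (r n) x) \<partial>M)"
      by (rule nn_integral_eq_integral[OF adm_int[OF ua]]) (simp add: gr_nonneg)
    also have "\<dots> \<le> ennreal (e (r n))" by (rule ennreal_leI[OF gu])
    finally show "(\<integral>\<^sup>+x. e2ennreal (g (u (r n) x)) \<partial>M) \<le> ennreal (e (r n))" .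
  qed
  also have "\<dots> = ennreal E"
    by (rule lim_imp_Liminf) (simp_all add: tendsto_ennrealI erE)
  finally have le: "(\<integral>\<^sup>+x. e2ennreal (g (v x)) \<partial>M) \<le> ennreal E" .
  have va: "v \<in> adm" and vE: "(\<integral>x. gr (v x) \<partial>M) \<le> E"
    using adm_of_nn_integral[OF vL le] E0 by auto
  have vm: "rcost v A \<le> m" using vE by (simp add: rcost_def E_def)
  define w where "w x = indicator A x * v x" for x
  have wa: "w \<in> adm" and wg: "(\<integral>x. gr (w x) \<partial>M) \<le> (\<integral>x. gr (v x) \<partial>M)"
    using adm_ind[OF va A] by (simp_all add: w_def[abs_def])
  have ww: "indicator A x * w x = w x" for x by (simp add: w_def split: split_indicator)
  have "(\<lambda>x. indicator A x * w x) = (\<lambda>x. indicator A x * v x)"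
    by (auto simp: w_def fun_eq_iff split: split_indicator)
  then have wm: "rcost w A \<le> m" using vm wg unfolding rcost_def by simp
  have "cost \<Omega> S yd g \<beta> w A \<le> cost \<Omega> S yd g \<beta> v' A" if "v' \<in> Lp \<Omega> 2" for v'
  proof (cases "v' \<in> adm")
    case True
    then show ?thesis using mle[OF True] wm A wa by (simp add: cost_eq_rcost)
  next
    case False
    then show ?thesis using that A by (simp add: cost_infinite)
  qed
  then have "is_solution \<Omega> S Sadj yd g \<beta> A w (S (\<lambda>x. indicator A x * w x)) (Sadj (S (\<lambda>x. indicator A x * w x) - yd))"
    using adm_L2[OF wa] ww Sadj_L2 by (simp add: is_solution_def)
  then show ?thesis by blast
qed

end

section \<open>First-order expansion of the optimal value\<close>

context design_problem
begin

lemma solution_adm: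
  assumes A: "A \<in> sets lebesgue" and sol: "is_solution \<Omega> S Sadj yd g \<beta> A u y p"
  shows "u \<in> adm"
proof (rule ccontr)
  assume "u \<notin> adm"
  moreover have "u \<in> Lp \<Omega> 2" using sol by (simp add: is_solution_def)
  ultimately have "cost \<Omega> S yd g \<beta> u A = \<infinity>" using A by (simp add: cost_infinite)
  moreover have "cost \<Omega> S yd g \<beta> u A \<le> cost \<Omega> S yd g \<beta> (\<lambda>x. 0) A"
    using sol L2_zero by (simp add: is_solution_def)
  ultimately show False using A by (simp add: cost_eq_rcost zero_adm)
qed

lemma solution_min:
  assumes A: "A \<in> sets lebesgue" and sol: "is_solution \<Omega> S Sadj yd g \<beta> A u y p" and v: "v \<in> adm"
  shows "rcost u A \<le> rcost v A"
  using sol adm_L2[OF v] cost_eq_rcost[OF v A] cost_eq_rcost[OF solution_adm[OF A sol] A]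
  by (auto simp: is_solution_def)

definition val :: "'a set \<Rightarrow> real" where
  "val A = real_of_ereal (opt_value \<Omega> S yd g \<beta> A)"

lemma opt_value_solution:
  assumes A: "A \<in> sets lebesgue" and sol: "is_solution \<Omega> S Sadj yd g \<beta> A u y p"
  shows "opt_value \<Omega> S yd g \<beta> A = ereal (rcost u A)"
proof -
  have "opt_value \<Omega> S yd g \<beta> A = cost \<Omega> S yd g \<beta> u A"
    unfolding opt_value_def
    by (rule antisym) (use sol in \<open>auto simp: is_solution_def intro: INF_lower INF_greatest\<close>)
  then show ?thesis by (simp add: cost_eq_rcost[OF solution_adm[OF A sol] A])
qed

lemma opt_value_eq: "A \<in> sets lebesgue \<Longrightarrow> opt_value \<Omega> S yd g \<beta> A = ereal (val A)"
  using solution_exists[of A] opt_value_solution[of A] by (auto simp: val_def)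

lemma val_solution:
  "A \<in> sets lebesgue \<Longrightarrow> is_solution \<Omega> S Sadj yd g \<beta> A u y p \<Longrightarrow> val A = rcost u A"
  using opt_value_solution[of A u y p] by (simp add: val_def)

lemma val_le:
  assumes A: "A \<in> sets lebesgue" and v: "v \<in> adm"
  shows "val A \<le> rcost v A"
  using solution_exists[OF A] solution_min[OF A _ v] val_solution[OF A] by metis

lemma solution_p:
  assumes "is_solution \<Omega> S Sadj yd g \<beta> A u y p"
  shows "p \<in> Lp \<Omega> 2"
    and "w \<in> Lp \<Omega> 2 \<Longrightarrow> (\<integral>x. p x * w x \<partial>M) = S w \<bullet> (S (\<lambda>x. indicator A x * u x) - yd)"
proof -
  show p: "p \<in> Lp \<Omega> 2" using assms by (simp add: is_solution_def)
  assume w: "w \<in> Lp \<Omega> 2"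
  let ?z = "S (\<lambda>x. indicator A x * u x) - yd"
  note [measurable] = L2_meas[OF p] L2_meas[OF w] L2_meas[OF Sadj_L2[of ?z]]
  have "(\<integral>x. p x * w x \<partial>M) = (\<integral>x. w x * Sadj ?z x \<partial>M)"
  proof (rule integral_cong_AE)
    have y: "y = S (\<lambda>x. indicator A x * u x)" and "AE x in M. p x = Sadj (y - yd) x"
      using assms unfolding is_solution_def by auto
    then have "AE x in M. p x = Sadj ?z x" unfolding y by simp
    then show "AE x in M. p x * w x = w x * Sadj ?z x" by eventually_elim simp
  qed measurable
  also have "\<dots> = S w \<bullet> ?z" by (rule S_inner[OF w, symmetric])
  finally show "(\<integral>x. p x * w x \<partial>M) = S w \<bullet> ?z" .
qed

text \<open>The quadratic part of the cost is expanded exactly around the state at \<open>A\<close>.\<close>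

lemma rcost_expansion:
  assumes A: "A \<in> sets lebesgue" and B: "B \<in> sets lebesgue"
    and sol: "is_solution \<Omega> S Sadj yd g \<beta> A u y p" and v: "v \<in> adm"
  shows "rcost v B - rcost u A =
      (\<integral>x. p x * (indicator B x * v x - indicator A x * u x) \<partial>M)
      + 1 / 2 * (norm (S (\<lambda>x. indicator B x * v x - indicator A x * u x)))\<^sup>2
      + ((\<integral>x. gr (v x) \<partial>M) - (\<integral>x. gr (u x) \<partial>M))
      + (\<integral>x. (indicator B x - indicator A x) * \<beta> x \<partial>M)"
proof -
  let ?d = "\<lambda>x. indicator B x * v x - indicator A x * u x"
  let ?y = "S (\<lambda>x. indicator A x * u x)"
  have L: "(\<lambda>x. indicator B x * v x) \<in> Lp \<Omega> 2" "(\<lambda>x. indicator A x * u x) \<in> Lp \<Omega> 2"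
    using L2_ind A B adm_L2 v solution_adm[OF A sol] by auto
  have d: "?d \<in> Lp \<Omega> 2" by (rule L2_diff[OF L])
  have e: "S (\<lambda>x. indicator B x * v x) - yd = (?y - yd) + S ?d"
    by (simp add: S_diff[OF L])
  have n: "(norm (S (\<lambda>x. indicator B x * v x) - yd))\<^sup>2
      = (norm (?y - yd))\<^sup>2 + 2 * (S ?d \<bullet> (?y - yd)) + (norm (S ?d))\<^sup>2"
    unfolding e by (simp only: power2_norm_eq_inner inner_add_left inner_add_right)
      (simp add: inner_commute)
  have b: "(\<integral>x. (indicator B x - indicator A x) * \<beta> x \<partial>M)
      = (\<integral>x. indicator B x * \<beta> x \<partial>M) - (\<integral>x. indicator A x * \<beta> x \<partial>M)"
    using integrable_ind[OF A \<beta>_int] integrable_ind[OF B \<beta>_int] by (simp add: left_diff_distrib)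
  show ?thesis unfolding rcost_def n solution_p(2)[OF sol d] b by (simp add: add_divide_distrib)
qed

text \<open>
  Admissible controls can be combined on disjoint sets because \<open>g 0 = 0\<close>.
\<close>

lemma adm_piecewise:
  assumes u: "u \<in> adm" and w: "w \<in> adm" and E: "E \<in> sets lebesgue" and F: "F \<in> sets lebesgue"
    and disj: "E \<inter> F = {}"
  shows "(\<lambda>x. indicator E x * u x + indicator F x * w x) \<in> adm"
proof -
  note [measurable] = E F L2_meas[OF adm_L2[OF u]] L2_meas[OF adm_L2[OF w]]
  have "integrable M (\<lambda>x. gr (indicator E x * u x + indicator F x * w x))"
    by (rule Bochner_Integration.integrable_bound[OF Bochner_Integration.integrable_add[OF adm_int[OF u] adm_int[OF w]]])
       (use disj in \<open>auto intro!: AE_I2 simp: gr_nonneg split: split_indicator\<close>)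
  moreover have "AE x in M. g (indicator E x * u x + indicator F x * w x) < \<infinity>"
    using adm_fin[OF u] adm_fin[OF w]
    by eventually_elim (use disj in \<open>auto simp: g_zero split: split_indicator\<close>)
  ultimately show ?thesis
    using L2_add[OF L2_ind L2_ind, OF E adm_L2[OF u] F adm_L2[OF w]] by (simp add: adm_def)
qed

lemma integrable_quadratic_bound:
  "p \<in> Lp \<Omega> 2 \<Longrightarrow> integrable M (\<lambda>x. 2 * K + K\<^sup>2 * (p x)\<^sup>2)"
  using L2_sq[of p] finite_measure.integrable_const[OF finite_M]
  by (intro Bochner_Integration.integrable_add integrable_mult_right)

lemma sel_adm:
  assumes p: "p \<in> Lp \<Omega> 2"
  shows "(\<lambda>x. sel (p x)) \<in> adm"
proof -
  note [measurable] = L2_meas[OF p]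
  have L: "(\<lambda>x. sel (p x)) \<in> Lp \<Omega> 2"
    by (rule L2_bound[OF _ integrable_quadratic_bound[OF p]]) (auto intro: sel_bound)
  have "integrable M (\<lambda>x. gr (sel (p x)))"
    by (rule Bochner_Integration.integrable_bound[OF Bochner_Integration.integrable_add[OF L2_sq[OF p] L2_sq[OF L]]])
       (auto intro!: AE_I2 simp: gr_nonneg gr_sel_le)
  with L show ?thesis using sel_fin by (simp add: adm_def less_imp_neq)
qed

lemma Hr_integrable:
  assumes p: "p \<in> Lp \<Omega> 2"
  shows "integrable M (\<lambda>x. Hr (p x))"
proof -
  note [measurable] = L2_meas[OF p]
  show ?thesis
    by (rule Bochner_Integration.integrable_bound[OF Bochner_Integration.integrable_add
          [OF L2_sq[OF p] L2_sq[OF adm_L2[OF sel_adm[OF p]]]]])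
       (auto intro!: AE_I2 simp: abs_Hr_le)
qed

lemma nonneg_of_quadratic:
  fixes c Q :: real
  assumes "\<And>l. 0 < l \<Longrightarrow> l < 1 \<Longrightarrow> 0 \<le> l * c + l\<^sup>2 * Q" and Q: "0 \<le> Q"
  shows "0 \<le> c"
proof (rule ccontr)
  assume "\<not> 0 \<le> c"
  then have c: "c < 0" by simp
  \<comment> \<open>small enough for the linear term to dominate\<close>
  define l where "l = min (1/2) (- c / (2 * (Q + 1)))"
  have l: "0 < l" "l < 1" using c Q by (auto simp: l_def intro!: divide_neg_pos)
  have "l * Q \<le> (- c / (2 * (Q + 1))) * Q" using Q by (intro mult_right_mono) (auto simp: l_def)
  also have "\<dots> < - c" using c Q by (simp add: field_simps) (smt (verit) mult_nonneg_nonpos)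
  finally have "l * (c + l * Q) < 0" using l by (intro mult_pos_neg) auto
  moreover have "l * (c + l * Q) = l * c + l\<^sup>2 * Q" by (simp add: power2_eq_square algebra_simps)
  ultimately show False using assms(1)[OF l] by simp
qed

text \<open>
  The pointwise minimum principle. Moving from \<open>u\<close> towards the pointwise minimizer changes the cost
  to first order by the integral of a nonpositive function, which therefore vanishes.
\<close>

lemma solution_pointwise:
  assumes A: "A \<in> sets lebesgue" and sol: "is_solution \<Omega> S Sadj yd g \<beta> A u y p"
  shows "AE x in M. g (u x) < \<infinity> \<and> p x * (indicator A x * u x) + gr (u x) = indicator A x * Hr (p x)"
proof -
  have u: "u \<in> adm" by (rule solution_adm[OF A sol])
  have p: "p \<in> Lp \<Omega> 2" by (rule solution_p(1)[OF sol])
  define v where "v x = indicator A x * sel (p x)" for x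
  have v: "v \<in> adm" unfolding v_def[abs_def] by (rule adm_ind(1)[OF sel_adm[OF p] A])
  have Lu: "(\<lambda>x. indicator A x * u x) \<in> Lp \<Omega> 2" and Lv: "(\<lambda>x. indicator A x * v x) \<in> Lp \<Omega> 2"
    using L2_ind A adm_L2 u v by auto
  let ?d = "\<lambda>x. indicator A x * v x - indicator A x * u x"
  have d: "?d \<in> Lp \<Omega> 2" by (rule L2_diff[OF Lv Lu])
  define c where "c = (\<integral>x. p x * ?d x \<partial>M) + ((\<integral>x. gr (v x) \<partial>M) - (\<integral>x. gr (u x) \<partial>M))"
  define Q where "Q = 1/2 * (norm (S ?d))\<^sup>2"
  have "0 \<le> c"
  proof (rule nonneg_of_quadratic)
    fix l :: real assume l: "0 < l" "l < 1"
    define w where "w x = l * v x + (1 - l) * u x" for x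
    have w: "w \<in> adm" and gw: "(\<integral>x. gr (w x) \<partial>M) \<le> l * (\<integral>x. gr (v x) \<partial>M) + (1 - l) * (\<integral>x. gr (u x) \<partial>M)"
      using adm_convex[OF v u l] by (simp_all add: w_def[abs_def])
    have dw: "indicator A x * w x - indicator A x * u x = l * ?d x" for x
      by (auto simp: w_def algebra_simps)
    have "0 \<le> rcost w A - rcost u A" using solution_min[OF A sol w] by simp
    also have "\<dots> = l * (\<integral>x. p x * ?d x \<partial>M) + l\<^sup>2 * Q + ((\<integral>x. gr (w x) \<partial>M) - (\<integral>x. gr (u x) \<partial>M))"
      using l unfolding rcost_expansion[OF A A sol w] dw S_scale[OF d]
      by (simp add: Q_def power_mult_distrib mult.left_commute[of _ l])
    also have "\<dots> \<le> l * c + l\<^sup>2 * Q" using gw by (simp add: c_def algebra_simps)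
    finally show "0 \<le> l * c + l\<^sup>2 * Q" .
  qed (simp add: Q_def)
  define h where "h x = (p x * (indicator A x * u x) + gr (u x)) - (p x * (indicator A x * v x) + gr (v x))" for x
  have hi: "integrable M h"
    unfolding h_def[abs_def] using L2_mult_integrable[OF p Lu] L2_mult_integrable[OF p Lv] adm_int u v by simp
  have "(\<integral>x. h x \<partial>M) = - c"
    unfolding h_def c_def
    using L2_mult_integrable[OF p Lu] L2_mult_integrable[OF p Lv] adm_int u v by (simp add: right_diff_distrib)
  have v_eq: "p x * (indicator A x * v x) + gr (v x) = indicator A x * Hr (p x)" for x
    by (auto simp: v_def Hr_eq split: split_indicator)
  have h0: "AE x in M. 0 \<le> h x"
    using adm_fin[OF u]
    by eventually_elim (auto simp: h_def v_eq gr_nonneg Hr_le split: split_indicator)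
  then have "0 \<le> (\<integral>x. h x \<partial>M)" by (rule integral_nonneg_AE)
  with \<open>(\<integral>x. h x \<partial>M) = - c\<close> \<open>0 \<le> c\<close> have "(\<integral>x. h x \<partial>M) = 0" by simp
  then have "AE x in M. h x = 0" using integral_nonneg_eq_0_iff_AE[OF hi h0] by simp
  then show ?thesis using adm_fin[OF u]
    by eventually_elim (simp add: h_def v_eq)
qed

definition DJ :: "'a set \<Rightarrow> ('a \<Rightarrow> real) \<Rightarrow> 'a \<Rightarrow> real" where
  "DJ A p = topo_deriv g \<beta> A p"

lemma DJ_eq: "DJ A p x = (if x \<notin> A then \<beta> x + Hr (p x) else - (\<beta> x + Hr (p x)))"
  by (simp add: DJ_def topo_deriv_def Hr_def)

lemma DJ_integrable:
  assumes A: "A \<in> sets lebesgue" and p: "p \<in> Lp \<Omega> 2"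
  shows "integrable M (DJ A p)"
proof -
  have "integrable M (\<lambda>x. (\<beta> x + Hr (p x)) - 2 * (indicator A x * (\<beta> x + Hr (p x))))"
    using \<beta>_int Hr_integrable[OF p] integrable_ind[OF A, of "\<lambda>x. \<beta> x + Hr (p x)"] by simp
  moreover have "(\<lambda>x. (\<beta> x + Hr (p x)) - 2 * (indicator A x * (\<beta> x + Hr (p x)))) = DJ A p"
    by (auto simp: DJ_eq fun_eq_iff split: split_indicator)
  ultimately show ?thesis by simp
qed

text \<open>
  The change of the cost from the optimal pair \<open>(u, A)\<close> to any pair \<open>(v, B)\<close> is the integral of the
  topological derivative over the changed set, plus two nonnegative terms: the defect of \<open>v\<close> in the
  pointwise minimization of the Hamiltonian on \<open>B\<close>, and the quadratic change of the state. The
  defect of \<open>u\<close> itself vanishes by the pointwise minimum principle.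
\<close>

lemma first_order_difference:
  assumes A: "A \<in> sets lebesgue" and B: "B \<in> sets lebesgue"
    and sol: "is_solution \<Omega> S Sadj yd g \<beta> A u y p" and v: "v \<in> adm"
  shows "rcost v B - rcost u A =
      ((\<integral>x. p x * (indicator B x * v x) + gr (v x) \<partial>M) - (\<integral>x. indicator B x * Hr (p x) \<partial>M))
      + (\<integral>x. indicator (sym_diff A B) x * DJ A p x \<partial>M)
      + 1 / 2 * (norm (S (\<lambda>x. indicator B x * v x - indicator A x * u x)))\<^sup>2"
proof -
  have u: "u \<in> adm" by (rule solution_adm[OF A sol])
  have p: "p \<in> Lp \<Omega> 2" by (rule solution_p(1)[OF sol])
  have Lu: "(\<lambda>x. indicator A x * u x) \<in> Lp \<Omega> 2" and Lv: "(\<lambda>x. indicator B x * v x) \<in> Lp \<Omega> 2"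
    using L2_ind A B adm_L2 u v by auto
  note ints = L2_mult_integrable[OF p Lu] L2_mult_integrable[OF p Lv] adm_int[OF u] adm_int[OF v]
    integrable_ind[OF A \<beta>_int] integrable_ind[OF B \<beta>_int]
    integrable_ind[OF A Hr_integrable[OF p]] integrable_ind[OF B Hr_integrable[OF p]]
  note [measurable] = L2_meas[OF p] L2_meas[OF adm_L2[OF u]] A
  have eqA: "(\<integral>x. p x * (indicator A x * u x) + gr (u x) \<partial>M) = (\<integral>x. indicator A x * Hr (p x) \<partial>M)"
    by (rule integral_cong_AE) (use solution_pointwise[OF A sol] in \<open>auto elim!: eventually_mono\<close>)
  have "(\<lambda>x. indicator (sym_diff A B) x * DJ A p x)
     = (\<lambda>x. (indicator B x - indicator A x) * \<beta> x + (indicator B x * Hr (p x) - indicator A x * Hr (p x)))"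
    by (auto simp: DJ_eq fun_eq_iff split: split_indicator)
  then have DJ: "(\<integral>x. indicator (sym_diff A B) x * DJ A p x \<partial>M)
     = (\<integral>x. (indicator B x - indicator A x) * \<beta> x \<partial>M)
       + ((\<integral>x. indicator B x * Hr (p x) \<partial>M) - (\<integral>x. indicator A x * Hr (p x) \<partial>M))"
    using ints by (simp add: left_diff_distrib)
  have "(\<integral>x. p x * (indicator B x * v x - indicator A x * u x) \<partial>M)
     = (\<integral>x. p x * (indicator B x * v x) \<partial>M) - (\<integral>x. p x * (indicator A x * u x) \<partial>M)"
    using ints by (simp add: right_diff_distrib)
  then show ?thesis
    unfolding rcost_expansion[OF A B sol v] DJ using eqA ints by simp
qed

text \<open>
  Both remaining terms of the expansion are nonnegative; this convexity estimate turns a small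
  residual into a bound for the distance to the global infimum.
\<close>

lemma val_lower_bound:
  assumes A: "A \<in> sets lebesgue" and B: "B \<in> sets lebesgue"
    and sol: "is_solution \<Omega> S Sadj yd g \<beta> A u y p"
  shows "val A + (\<integral>x. indicator (sym_diff A B) x * DJ A p x \<partial>M) \<le> val B"
proof -
  obtain v y' p' where sol': "is_solution \<Omega> S Sadj yd g \<beta> B v y' p'"
    using solution_exists[OF B] by blast
  have v: "v \<in> adm" by (rule solution_adm[OF B sol'])
  have p: "p \<in> Lp \<Omega> 2" by (rule solution_p(1)[OF sol])
  have "(\<integral>x. indicator B x * Hr (p x) \<partial>M) \<le> (\<integral>x. p x * (indicator B x * v x) + gr (v x) \<partial>M)"
  proof (rule integral_mono_AE)
    show "AE x in M. indicator B x * Hr (p x) \<le> p x * (indicator B x * v x) + gr (v x)"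
      using adm_fin[OF v] by eventually_elim (auto simp: gr_nonneg Hr_le split: split_indicator)
  qed (use integrable_ind[OF B Hr_integrable[OF p]] L2_mult_integrable[OF p L2_ind[OF B adm_L2[OF v]]]
        adm_int[OF v] in auto)
  then show ?thesis
    using first_order_difference[OF A B sol v] val_solution[OF A sol] val_solution[OF B sol']
      zero_le_power2[of "norm (S (\<lambda>x. indicator B x * v x - indicator A x * u x))"] by linarith
qed

text \<open>
  The estimate of the second-order term. It has to be superlinear in the measure of the changed set,
  uniformly in the current set and its solution. The condition on \<open>w\<close> is satisfied both by the
  current control and by pointwise minimizers, since the minimal value of the Hamiltonian is
  nonpositive.
\<close>

definition remainder_bound :: "real \<Rightarrow> real \<Rightarrow> bool" where
  "remainder_bound C s \<longleftrightarrow> (\<forall>A u y p D w. A \<in> sets lebesgue \<longrightarrow> is_solution \<Omega> S Sadj yd g \<beta> A u y p \<longrightarrow>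
     D \<in> sets lebesgue \<longrightarrow> D \<subseteq> \<Omega> \<longrightarrow> w \<in> Lp \<Omega> 2 \<longrightarrow>
     (AE x in M. x \<in> D \<longrightarrow> g (w x) < \<infinity> \<and> p x * w x + gr (w x) \<le> 0) \<longrightarrow>
     (norm (S (\<lambda>x. indicator D x * w x)))\<^sup>2 \<le> C * measure lebesgue D powr s)"

text \<open>
  The trial control for \<open>B\<close> keeps \<open>u\<close> on \<open>A \<inter> B\<close> and is the pointwise minimizer on \<open>B - A\<close>. Its defect
  vanishes, and its state differs from the current one only by the effect of the changed set.
\<close>

lemma val_upper_bound:
  assumes rem: "remainder_bound C s" and C: "0 \<le> C" and s: "1 < s"
    and A: "A \<in> sets lebesgue" "A \<subseteq> \<Omega>" and B: "B \<in> sets lebesgue" "B \<subseteq> \<Omega>"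
    and sol: "is_solution \<Omega> S Sadj yd g \<beta> A u y p"
  shows "val B \<le> val A + (\<integral>x. indicator (sym_diff A B) x * DJ A p x \<partial>M)
      + 2 * C * measure lebesgue (sym_diff A B) powr s"
proof -
  have u: "u \<in> adm" by (rule solution_adm[OF A(1) sol])
  have p: "p \<in> Lp \<Omega> 2" by (rule solution_p(1)[OF sol])
  define v where "v x = indicator (A \<inter> B) x * u x + indicator (B - A) x * sel (p x)" for x
  have v: "v \<in> adm"
    unfolding v_def[abs_def] by (rule adm_piecewise[OF u sel_adm[OF p]]) (use A B in auto)
  let ?D1 = "B - A" and ?D2 = "A - B"
  note [measurable] = A(1) B(1) L2_meas[OF p] L2_meas[OF adm_L2[OF v]]
  have first: "(\<integral>x. p x * (indicator B x * v x) + gr (v x) \<partial>M) = (\<integral>x. indicator B x * Hr (p x) \<partial>M)"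
  proof (rule integral_cong_AE)
    show "AE x in M. p x * (indicator B x * v x) + gr (v x) = indicator B x * Hr (p x)"
      using solution_pointwise[OF A(1) sol]
      by eventually_elim (auto simp: v_def Hr_eq split: split_indicator)
  qed measurable
  have d: "(\<lambda>x. indicator B x * v x - indicator A x * u x)
     = (\<lambda>x. indicator ?D1 x * sel (p x) - indicator ?D2 x * u x)"
    by (auto simp: v_def fun_eq_iff split: split_indicator)
  have mono: "C * measure lebesgue D powr s \<le> C * measure lebesgue (sym_diff A B) powr s"
    if "D \<subseteq> sym_diff A B" "D \<in> sets lebesgue" for D
  proof -
    have "sym_diff A B \<in> lmeasurable"
      by (rule fmeasurableI2[OF \<Omega>_lmeasurable]) (use A B in auto)
    then have "measure lebesgue D \<le> measure lebesgue (sym_diff A B)"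
      using that by (intro measure_mono_fmeasurable) auto
    then show ?thesis using C s by (intro mult_left_mono powr_mono2) auto
  qed
  have "(norm (S (\<lambda>x. indicator ?D1 x * sel (p x))))\<^sup>2 \<le> C * measure lebesgue ?D1 powr s"
  proof (rule rem[unfolded remainder_bound_def, rule_format, OF A(1) sol])
    show "AE x in M. x \<in> ?D1 \<longrightarrow> g (sel (p x)) < \<infinity> \<and> p x * sel (p x) + gr (sel (p x)) \<le> 0"
      using Hr_nonpos[unfolded Hr_eq] sel_fin by blast
  qed (use A B adm_L2[OF sel_adm[OF p]] in auto)
  also have "\<dots> \<le> C * measure lebesgue (sym_diff A B) powr s" by (rule mono) (use A B in auto)
  finally have r1: "(norm (S (\<lambda>x. indicator ?D1 x * sel (p x))))\<^sup>2 \<le> C * measure lebesgue (sym_diff A B) powr s" .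
  have "(norm (S (\<lambda>x. indicator ?D2 x * u x)))\<^sup>2 \<le> C * measure lebesgue ?D2 powr s"
  proof (rule rem[unfolded remainder_bound_def, rule_format, OF A(1) sol])
    show "AE x in M. x \<in> ?D2 \<longrightarrow> g (u x) < \<infinity> \<and> p x * u x + gr (u x) \<le> 0"
      using solution_pointwise[OF A(1) sol]
    proof eventually_elim
      case (elim x)
      then show ?case using Hr_nonpos[of "p x"] by auto
    qed
  qed (use A B adm_L2[OF u] in auto)
  also have "\<dots> \<le> C * measure lebesgue (sym_diff A B) powr s" by (rule mono) (use A B in auto)
  finally have r2: "(norm (S (\<lambda>x. indicator ?D2 x * u x)))\<^sup>2 \<le> C * measure lebesgue (sym_diff A B) powr s" .
  have L: "(\<lambda>x. indicator ?D1 x * sel (p x)) \<in> Lp \<Omega> 2" "(\<lambda>x. indicator ?D2 x * u x) \<in> Lp \<Omega> 2"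
    using A B by (auto intro!: L2_ind adm_L2[OF u] adm_L2[OF sel_adm[OF p]])
  have "(norm (a - b))\<^sup>2 \<le> 2 * (norm a)\<^sup>2 + 2 * (norm b)\<^sup>2" for a b :: 'y
  proof -
    have "0 \<le> (norm (a + b))\<^sup>2" by simp
    then show ?thesis
      by (simp add: power2_norm_eq_inner inner_add_left inner_add_right inner_diff_left inner_diff_right inner_commute)
  qed
  then have "(norm (S (\<lambda>x. indicator B x * v x - indicator A x * u x)))\<^sup>2
     \<le> 2 * (norm (S (\<lambda>x. indicator ?D1 x * sel (p x))))\<^sup>2 + 2 * (norm (S (\<lambda>x. indicator ?D2 x * u x)))\<^sup>2"
    unfolding d S_diff[OF L] by blast
  then have "1/2 * (norm (S (\<lambda>x. indicator B x * v x - indicator A x * u x)))\<^sup>2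
     \<le> 2 * C * measure lebesgue (sym_diff A B) powr s"
    using r1 r2 by linarith
  then show ?thesis
    using first_order_difference[OF A(1) B(1) sol v] first val_solution[OF A(1) sol] val_le[OF B(1) v] by linarith
qed

text \<open>Comparison with the zero control.\<close>

lemma solution_penalty_le:
  assumes A: "A \<in> sets lebesgue" and sol: "is_solution \<Omega> S Sadj yd g \<beta> A u y p"
  shows "(\<integral>x. gr (u x) \<partial>M) \<le> 1/2 * (norm yd)\<^sup>2"
proof -
  have "S (\<lambda>x. 0) = 0" using S_scale[OF L2_zero, of 0] by simp
  then show ?thesis
    using solution_min[OF A sol zero_adm] by (simp add: rcost_def) (smt (verit) zero_le_power2)
qed

end

section \<open>Superlinear remainder estimates\<close>

text \<open>
  Strong convexity on the segment from \<open>u\<close> to the minimizer 0, in the limit towards 0.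
\<close>

lemma strongly_convex_quadratic_growth:
  assumes sc: "strongly_convex_fun \<mu> g" and nn: "\<And>u. 0 \<le> g u" and g0: "g 0 = 0" and u: "g u < \<infinity>"
  shows "\<mu> / 2 * u\<^sup>2 \<le> real_of_ereal (g u)"
proof (rule field_le_mult_one_interval)
  fix z :: real assume z: "0 < z" "z < 1"
  obtain a where a: "g u = ereal a" using u nn[of u] by (cases "g u") auto
  let ?l = "1 - z"
  have "u \<in> edom g" "0 \<in> edom g" using u g0 by (auto simp: edom_def)
  moreover have "?l \<in> {0<..<1}" using z by simp
  ultimately have "ereal (\<mu> / 2 * ?l * (1 - ?l) * \<bar>u - 0\<bar>\<^sup>2) + g (?l * u + (1 - ?l) * 0)
      \<le> ereal ?l * g u + ereal (1 - ?l) * g 0"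
    using sc unfolding strongly_convex_fun_def by blast
  then have "ereal (\<mu> / 2 * ?l * z * u\<^sup>2) + g (?l * u) \<le> ereal (?l * a)"
    by (simp add: a g0)
  moreover have "ereal (\<mu> / 2 * ?l * z * u\<^sup>2) \<le> ereal (\<mu> / 2 * ?l * z * u\<^sup>2) + g (?l * u)"
    using add_left_mono[OF nn[of "?l * u"], of "ereal (\<mu> / 2 * ?l * z * u\<^sup>2)"] by simp
  ultimately have "ereal (\<mu> / 2 * ?l * z * u\<^sup>2) \<le> ereal (?l * a)" by (rule order_trans[rotated])
  then have "?l * (z * (\<mu> / 2 * u\<^sup>2)) \<le> ?l * a" by (simp add: mult_ac)
  then show "z * (\<mu> / 2 * u\<^sup>2) \<le> real_of_ereal (g u)" using z by (simp add: a)
qed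

lemma square_on_set:
  fixes f :: "'b \<Rightarrow> real"
  assumes [measurable]: "f \<in> borel_measurable M" and fq: "integrable M (\<lambda>x. \<bar>f x\<bar> powr q)"
    and D: "D \<in> sets M" "emeasure M D < \<infinity>" and q: "q > 2"
  shows "integrable M (\<lambda>x. indicator D x * (f x)\<^sup>2)"
    and "(\<integral>x. indicator D x * (f x)\<^sup>2 \<partial>M)
           \<le> measure M D powr (1 - 2 / q) * (\<integral>x. \<bar>f x\<bar> powr q \<partial>M) powr (2 / q)"
proof -
  have e: "\<bar>(f x)\<^sup>2\<bar> powr (q / 2) = \<bar>f x\<bar> powr q" for x
  proof -
    have "\<bar>(f x)\<^sup>2\<bar> powr (q / 2) = (\<bar>f x\<bar> powr 2) powr (q / 2)" by simp
    then show ?thesis unfolding powr_powr by simp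
  qed
  have h: "(\<lambda>x. (f x)\<^sup>2) \<in> borel_measurable M" "integrable M (\<lambda>x. \<bar>(f x)\<^sup>2\<bar> powr (q / 2))" "q / 2 > 1"
    using fq q unfolding e by auto
  from Holder_on_set[OF h(1,2) D h(3)]
  show "integrable M (\<lambda>x. indicator D x * (f x)\<^sup>2)"
    and "(\<integral>x. indicator D x * (f x)\<^sup>2 \<partial>M)
           \<le> measure M D powr (1 - 2 / q) * (\<integral>x. \<bar>f x\<bar> powr q \<partial>M) powr (2 / q)"
    unfolding e by simp_all
qed

lemma abs_diff_powr_le:
  fixes a b q :: real
  assumes "0 < q"
  shows "\<bar>a - b\<bar> powr q \<le> 2 powr q * (\<bar>a\<bar> powr q + \<bar>b\<bar> powr q)"
proof -
  have "\<bar>a - b\<bar> powr q \<le> (2 * max \<bar>a\<bar> \<bar>b\<bar>) powr q"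
    using assms by (intro powr_mono2) auto
  also have "\<dots> = 2 powr q * max \<bar>a\<bar> \<bar>b\<bar> powr q" by (simp add: powr_mult)
  also have "\<dots> \<le> 2 powr q * (\<bar>a\<bar> powr q + \<bar>b\<bar> powr q)"
    by (intro mult_left_mono) (auto simp: max_def)
  finally show ?thesis .
qed

context design_problem
begin

lemma sets_M: "D \<in> sets lebesgue \<Longrightarrow> D \<subseteq> \<Omega> \<Longrightarrow> D \<in> sets M"
  using \<Omega>_sets by (auto simp: sets_restrict_space_iff)

lemma measure_M: "D \<in> sets lebesgue \<Longrightarrow> D \<subseteq> \<Omega> \<Longrightarrow> measure M D = measure lebesgue D"
  using \<Omega>_sets by (simp add: measure_restrict_space)

lemma emeasure_M: "emeasure M D < \<infinity>"
  using finite_measure.emeasure_finite[OF finite_M, of D] by (simp add: less_top)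

lemma norm_S_sq:
  "w \<in> Lp \<Omega> 2 \<Longrightarrow> (norm (S w))\<^sup>2 = (\<integral>x. w x * Sadj (S w) x \<partial>M)"
  by (simp add: power2_norm_eq_inner S_inner)

text \<open>
  If the domain of the penalty is bounded, so are the admissible perturbations, and the gain comes
  from the integrability of the adjoint: \<open>\<parallel>z\<parallel>\<^sup>2 = \<langle>w, S\<^sup>* z\<rangle>\<close> for \<open>z = S w\<close>.
\<close>

lemma remainder_bound_bounded_domain:
  assumes bdd: "bounded (edom g)" and q: "2 < q" and bl: "bounded_linear_into_Lp \<Omega> q Sadj"
  shows "\<exists>C s. 0 \<le> C \<and> 1 < s \<and> remainder_bound C s"
proof -
  obtain B where B: "\<And>u. g u < \<infinity> \<Longrightarrow> \<bar>u\<bar> \<le> B"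
    using bdd by (auto simp: bounded_iff edom_def)
  have B0: "0 \<le> B" using B[of 0] by (simp add: g_zero)
  obtain c' where c': "\<And>y. Lp_norm \<Omega> q (Sadj y) \<le> c' * norm y"
    and Lq: "\<And>y. Sadj y \<in> Lp \<Omega> q"
    using bl by (auto simp: bounded_linear_into_Lp_def)
  define c where "c = \<bar>c'\<bar>"
  have c: "Lp_norm \<Omega> q (Sadj y) \<le> c * norm y" for y
    by (rule order_trans[OF c']) (simp add: c_def mult_right_mono)
  have "remainder_bound ((B * c)\<^sup>2) (2 * (1 - 1 / q))"
    unfolding remainder_bound_def
  proof (intro allI impI)
    fix A u y p D w
    assume D: "D \<in> sets lebesgue" "D \<subseteq> \<Omega>" and w: "w \<in> Lp \<Omega> 2"
      and ae: "AE x in M. x \<in> D \<longrightarrow> g (w x) < \<infinity> \<and> p x * w x + gr (w x) \<le> 0"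
    let ?f = "\<lambda>x. indicator D x * w x"
    let ?z = "S ?f"
    let ?m = "measure lebesgue D powr (1 - 1 / q)"
    have f: "?f \<in> Lp \<Omega> 2" by (rule L2_ind[OF D(1) w])
    have hq: "Sadj ?z \<in> borel_measurable M" "integrable M (\<lambda>x. \<bar>Sadj ?z x\<bar> powr q)"
      using Lq by (auto simp: Lp_def)
    note H = Holder_on_set[OF hq sets_M[OF D] emeasure_M, unfolded measure_M[OF D]]
    have "(norm ?z)\<^sup>2 = (\<integral>x. ?f x * Sadj ?z x \<partial>M)" by (rule norm_S_sq[OF f])
    also have "\<dots> \<le> (\<integral>x. B * (indicator D x * \<bar>Sadj ?z x\<bar>) \<partial>M)"
    proof (rule integral_mono_AE)
      show "integrable M (\<lambda>x. ?f x * Sadj ?z x)" by (rule L2_mult_integrable[OF f Sadj_L2])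
      show "integrable M (\<lambda>x. B * (indicator D x * \<bar>Sadj ?z x\<bar>))" using H(1) q by simp
      show "AE x in M. ?f x * Sadj ?z x \<le> B * (indicator D x * \<bar>Sadj ?z x\<bar>)"
        using ae
      proof eventually_elim
        case (elim x)
        have "w x * Sadj ?z x \<le> B * \<bar>Sadj ?z x\<bar>" if "x \<in> D"
        proof -
          have "w x * Sadj ?z x \<le> \<bar>w x\<bar> * \<bar>Sadj ?z x\<bar>" by (metis abs_ge_self abs_mult)
          also have "\<dots> \<le> B * \<bar>Sadj ?z x\<bar>" using elim that by (intro mult_right_mono B) auto
          finally show ?thesis .
        qed
        then show ?case by (auto split: split_indicator)
      qed
    qed
    also have "\<dots> = B * (\<integral>x. indicator D x * \<bar>Sadj ?z x\<bar> \<partial>M)" by simp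
    also have "\<dots> \<le> B * (?m * Lp_norm \<Omega> q (Sadj ?z))"
      using H(2) q B0 by (intro mult_left_mono) (auto simp: Lp_norm_def)
    also have "\<dots> \<le> B * (?m * (c * norm ?z))"
      using B0 by (intro mult_left_mono c) auto
    finally have "norm ?z * norm ?z \<le> (B * c * ?m) * norm ?z"
      by (simp add: power2_eq_square mult_ac)
    then have "norm ?z \<le> B * c * ?m"
      using B0 by (cases "norm ?z = 0") (auto simp: c_def)
    then have "(norm ?z)\<^sup>2 \<le> (B * c * ?m)\<^sup>2" by (rule power_mono) simp
    also have "\<dots> = (B * c)\<^sup>2 * measure lebesgue D powr (2 * (1 - 1 / q))"
      by (simp add: power_mult_distrib power2_eq_square flip: powr_add)
    finally show "(norm ?z)\<^sup>2 \<le> (B * c)\<^sup>2 * measure lebesgue D powr (2 * (1 - 1 / q))" .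
  qed
  moreover have "1 < 2 * (1 - 1 / q)" using q by (simp add: field_simps)
  ultimately show ?thesis by (intro exI[of _ "(B * c)\<^sup>2"] exI[of _ "2 * (1 - 1 / q)"]) auto
qed

text \<open>
  The adjoint is determined almost everywhere by its defining property, and the latter is linear.
\<close>

lemma Sadj_diff: "AE x in M. Sadj (y - z) x = Sadj y x - Sadj z x"
proof -
  define h where "h x = Sadj (y - z) x - (Sadj y x - Sadj z x)" for x
  have h: "h \<in> Lp \<Omega> 2" unfolding h_def[abs_def] by (intro L2_diff Sadj_L2)
  have "(\<integral>x. (h x)\<^sup>2 \<partial>M) = (\<integral>x. h x * Sadj (y - z) x - (h x * Sadj y x - h x * Sadj z x) \<partial>M)"
    by (rule Bochner_Integration.integral_cong) (auto simp: h_def power2_eq_square algebra_simps)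
  also have "\<dots> = S h \<bullet> (y - z) - (S h \<bullet> y - S h \<bullet> z)"
    using L2_mult_integrable[OF h Sadj_L2] by (simp add: S_inner[OF h])
  also have "\<dots> = 0" by (simp add: inner_diff_right)
  finally have "AE x in M. (h x)\<^sup>2 = 0"
    by (subst (asm) integral_nonneg_eq_0_iff_AE[OF L2_sq[OF h]]) auto
  then show ?thesis by eventually_elim (simp add: h_def)
qed

text \<open>
  All adjoint states share one bound in \<open>L\<^sup>q\<close>, because comparison with the zero control bounds the
  controls in \<open>L\<^sup>2\<close> independently of the set \<open>A\<close>.
\<close>

lemma adjoint_state_bound:
  assumes q: "2 < q" and bl: "bounded_linear_Lp_Lp \<Omega> 2 q (\<lambda>u. Sadj (S u))" and ydq: "Sadj yd \<in> Lp \<Omega> q"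
  shows "\<exists>P. \<forall>A u y p. A \<in> sets lebesgue \<longrightarrow> is_solution \<Omega> S Sadj yd g \<beta> A u y p \<longrightarrow>
      integrable M (\<lambda>x. \<bar>p x\<bar> powr q) \<and> (\<integral>x. \<bar>p x\<bar> powr q \<partial>M) \<le> P"
proof -
  obtain c where c: "\<And>u. u \<in> Lp \<Omega> 2 \<Longrightarrow> Lp_norm \<Omega> q (Sadj (S u)) \<le> c * Lp_norm \<Omega> 2 u"
    and Lq: "\<And>u. u \<in> Lp \<Omega> 2 \<Longrightarrow> Sadj (S u) \<in> Lp \<Omega> q"
    using bl unfolding bounded_linear_Lp_Lp_def by blast
  define N where "N = \<bar>c\<bar> * sqrt (K * (measure M \<Omega> + 1/2 * (norm yd)\<^sup>2))"
  define P where "P = 2 powr q * (N powr q + (\<integral>x. \<bar>Sadj yd x\<bar> powr q \<partial>M))"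
  have "integrable M (\<lambda>x. \<bar>p x\<bar> powr q) \<and> (\<integral>x. \<bar>p x\<bar> powr q \<partial>M) \<le> P"
    if A: "A \<in> sets lebesgue" and sol: "is_solution \<Omega> S Sadj yd g \<beta> A u y p" for A u y p
  proof -
    let ?f = "\<lambda>x. indicator A x * u x"
    have u: "u \<in> adm" by (rule solution_adm[OF A sol])
    have f: "?f \<in> Lp \<Omega> 2" by (rule L2_ind[OF A adm_L2[OF u]])
    have y: "y = S ?f" and py: "AE x in M. p x = Sadj (y - yd) x" and p: "p \<in> Lp \<Omega> 2"
      using sol unfolding is_solution_def by auto
    have yq: "integrable M (\<lambda>x. \<bar>Sadj y x\<bar> powr q)" using Lq[OF f] by (simp add: y Lp_def)
    have ydq': "integrable M (\<lambda>x. \<bar>Sadj yd x\<bar> powr q)" using ydq by (simp add: Lp_def)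
    note [measurable] = L2_meas[OF p]
    have int: "integrable M (\<lambda>x. 2 powr q * (\<bar>Sadj y x\<bar> powr q + \<bar>Sadj yd x\<bar> powr q))"
      using yq ydq' by simp
    have le: "AE x in M. \<bar>p x\<bar> powr q \<le> 2 powr q * (\<bar>Sadj y x\<bar> powr q + \<bar>Sadj yd x\<bar> powr q)"
      using py Sadj_diff[of y yd] by eventually_elim (use q abs_diff_powr_le in simp)
    have pq: "integrable M (\<lambda>x. \<bar>p x\<bar> powr q)"
      by (rule Bochner_Integration.integrable_bound[OF int])
         (use le in \<open>auto elim!: eventually_mono\<close>)
    have "(\<integral>x. (?f x)\<^sup>2 \<partial>M) \<le> (\<integral>x. (u x)\<^sup>2 \<partial>M)"
      by (rule integral_mono[OF L2_sq[OF f] L2_sq[OF adm_L2[OF u]]]) (auto split: split_indicator)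
    also have "\<dots> \<le> K * (measure M \<Omega> + (\<integral>x. gr (u x) \<partial>M))" by (rule adm_sq_le[OF u])
    also have "\<dots> \<le> K * (measure M \<Omega> + 1/2 * (norm yd)\<^sup>2)"
      using K_pos solution_penalty_le[OF A sol] by (intro mult_left_mono add_left_mono) auto
    finally have fN: "\<bar>c\<bar> * Lp_norm \<Omega> 2 ?f \<le> N"
      unfolding N_def Lp_norm_2 by (intro mult_left_mono real_sqrt_le_mono) auto
    have "Lp_norm \<Omega> q (Sadj y) \<le> c * Lp_norm \<Omega> 2 ?f" unfolding y by (rule c[OF f])
    also have "\<dots> \<le> \<bar>c\<bar> * Lp_norm \<Omega> 2 ?f" by (intro mult_right_mono) (auto simp: Lp_norm_2)
    also note fN
    finally have "Lp_norm \<Omega> q (Sadj y) powr q \<le> N powr q"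
      using q by (intro powr_mono2) (auto simp: Lp_norm_def)
    then have "(\<integral>x. \<bar>Sadj y x\<bar> powr q \<partial>M) \<le> N powr q"
      using q by (simp add: Lp_norm_def powr_powr)
    moreover have "(\<integral>x. \<bar>p x\<bar> powr q \<partial>M)
        \<le> 2 powr q * ((\<integral>x. \<bar>Sadj y x\<bar> powr q \<partial>M) + (\<integral>x. \<bar>Sadj yd x\<bar> powr q \<partial>M))"
      using integral_mono_AE[OF pq int le] yq ydq' by simp
    ultimately show ?thesis using pq unfolding P_def
      by (smt (verit) mult_left_mono powr_ge_zero)
  qed
  then show ?thesis by blast
qed

text \<open>
  If the penalty is strongly convex, then \<open>\<bar>w\<bar>\<close> is dominated by a multiple of \<open>\<bar>p\<bar>\<close> and is bounded in
  \<open>L\<^sup>q\<close>. Restriction to a set of measure \<open>m\<close> gains the factor \<open>m powr (1/2 - 1/q)\<close> in the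
  passage from \<open>L\<^sup>q\<close> to \<open>L\<^sup>2\<close>; it is gained once for each of the two factors of the pairing
  \<open>\<langle>w, S\<^sup>* S w\<rangle>\<close> and once more in the norm of \<open>S\<^sup>* S w\<close>. The resulting exponent
  \<open>3 * (1/2 - 1/q)\<close> exceeds 1 precisely for \<open>q > 6\<close>.
\<close>

lemma remainder_bound_strongly_convex:
  assumes \<mu>: "0 < \<mu>" and sc: "strongly_convex_fun \<mu> g" and q: "6 < q"
    and bl: "bounded_linear_Lp_Lp \<Omega> 2 q (\<lambda>u. Sadj (S u))" and ydq: "Sadj yd \<in> Lp \<Omega> q"
  shows "\<exists>C s. 0 \<le> C \<and> 1 < s \<and> remainder_bound C s"
proof -
  from q have q2: "2 < q" by simp
  obtain c where c: "\<And>u. u \<in> Lp \<Omega> 2 \<Longrightarrow> Lp_norm \<Omega> q (Sadj (S u)) \<le> c * Lp_norm \<Omega> 2 u"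
    and Lq: "\<And>u. u \<in> Lp \<Omega> 2 \<Longrightarrow> Sadj (S u) \<in> Lp \<Omega> q"
    using bl unfolding bounded_linear_Lp_Lp_def by blast
  obtain P where P: "\<And>A u y p. A \<in> sets lebesgue \<Longrightarrow> is_solution \<Omega> S Sadj yd g \<beta> A u y p \<Longrightarrow>
      integrable M (\<lambda>x. \<bar>p x\<bar> powr q) \<and> (\<integral>x. \<bar>p x\<bar> powr q \<partial>M) \<le> P"
    using adjoint_state_bound[OF q2 bl ydq] by blast
  define W where "W = ((2 / \<mu>) powr q * \<bar>P\<bar>) powr (2 / q)"
  define s where "s = 3 / 2 * (1 - 2 / q)"
  have W0: "0 \<le> W" by (simp add: W_def)
  have "remainder_bound (\<bar>c\<bar> * W) s"
    unfolding remainder_bound_def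
  proof (intro allI impI)
    fix A u y p D w
    assume A: "A \<in> sets lebesgue" and sol: "is_solution \<Omega> S Sadj yd g \<beta> A u y p"
      and D: "D \<in> sets lebesgue" "D \<subseteq> \<Omega>" and w: "w \<in> Lp \<Omega> 2"
      and ae: "AE x in M. x \<in> D \<longrightarrow> g (w x) < \<infinity> \<and> p x * w x + gr (w x) \<le> 0"
    let ?f = "\<lambda>x. indicator D x * w x"
    let ?z = "S ?f"
    define a where "a = measure lebesgue D powr (1 - 2 / q)"
    have a0: "0 \<le> a" by (simp add: a_def)
    have p: "p \<in> Lp \<Omega> 2" by (rule solution_p(1)[OF sol])
    have f: "?f \<in> Lp \<Omega> 2" by (rule L2_ind[OF D(1) w])
    note [measurable] = L2_meas[OF f] L2_meas[OF p] D(1)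
    have fp: "AE x in M. \<bar>?f x\<bar> \<le> 2 / \<mu> * \<bar>p x\<bar>"
      using ae
    proof eventually_elim
      case (elim x)
      show ?case
      proof (cases "x \<in> D \<and> w x \<noteq> 0")
        case True
        with elim have fin: "g (w x) < \<infinity>" and le: "p x * w x + gr (w x) \<le> 0" by auto
        have "\<mu> / 2 * (w x)\<^sup>2 \<le> gr (w x)"
          unfolding gr_def by (rule strongly_convex_quadratic_growth[OF sc g_nonneg g_zero fin])
        also have "\<dots> \<le> - (p x * w x)" using le by simp
        also have "\<dots> \<le> \<bar>p x\<bar> * \<bar>w x\<bar>" by (metis abs_ge_minus_self abs_mult)
        finally have "\<mu> / 2 * \<bar>w x\<bar> * \<bar>w x\<bar> \<le> \<bar>p x\<bar> * \<bar>w x\<bar>" by (simp add: power2_eq_square)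
        then have "\<mu> / 2 * \<bar>w x\<bar> \<le> \<bar>p x\<bar>" using True by simp
        then show ?thesis using True \<mu> by (simp add: field_simps)
      qed (use \<mu> in \<open>auto split: split_indicator\<close>)
    qed
    have fpq: "AE x in M. \<bar>?f x\<bar> powr q \<le> (2 / \<mu>) powr q * \<bar>p x\<bar> powr q"
      using fp
    proof eventually_elim
      case (elim x)
      have "\<bar>?f x\<bar> powr q \<le> (2 / \<mu> * \<bar>p x\<bar>) powr q" using q elim by (intro powr_mono2) auto
      also have "(2 / \<mu> * \<bar>p x\<bar>) powr q = (2 / \<mu>) powr q * \<bar>p x\<bar> powr q"
        by (rule powr_mult)
      finally show ?case .
    qed
    have pint: "integrable M (\<lambda>x. (2 / \<mu>) powr q * \<bar>p x\<bar> powr q)" using P[OF A sol] by simp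
    have fq: "integrable M (\<lambda>x. \<bar>?f x\<bar> powr q)"
      by (rule Bochner_Integration.integrable_bound[OF pint])
         (use fpq in \<open>auto elim!: eventually_mono\<close>)
    have "(\<integral>x. \<bar>?f x\<bar> powr q \<partial>M) \<le> (2 / \<mu>) powr q * (\<integral>x. \<bar>p x\<bar> powr q \<partial>M)"
      using integral_mono_AE[OF fq pint fpq] by simp
    also have "\<dots> \<le> (2 / \<mu>) powr q * \<bar>P\<bar>" using P[OF A sol] by (intro mult_left_mono) auto
    finally have "(\<integral>x. \<bar>?f x\<bar> powr q \<partial>M) powr (2 / q) \<le> W"
      unfolding W_def using q by (intro powr_mono2) auto
    then have "a * (\<integral>x. \<bar>?f x\<bar> powr q \<partial>M) powr (2 / q) \<le> a * W"
      using a0 by (rule mult_left_mono)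
    moreover have "(\<lambda>x. indicator D x * (?f x)\<^sup>2) = (\<lambda>x. (?f x)\<^sup>2)"
      by (auto simp: fun_eq_iff split: split_indicator)
    ultimately have F: "(\<integral>x. (?f x)\<^sup>2 \<partial>M) \<le> a * W"
      using square_on_set(2)[OF L2_meas[OF f] fq sets_M[OF D] emeasure_M q2] measure_M[OF D]
      by (simp add: a_def)
    let ?h = "\<lambda>x. indicator D x * Sadj ?z x"
    have h: "?h \<in> Lp \<Omega> 2" by (rule L2_ind[OF D(1) Sadj_L2])
    have hq: "integrable M (\<lambda>x. \<bar>Sadj ?z x\<bar> powr q)" using Lq[OF f] by (simp add: Lp_def)
    have h2: "(\<lambda>x. indicator D x * (Sadj ?z x)\<^sup>2) = (\<lambda>x. (?h x)\<^sup>2)"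
      by (auto simp: fun_eq_iff split: split_indicator)
    have "(\<integral>x. (?h x)\<^sup>2 \<partial>M) \<le> a * (\<integral>x. \<bar>Sadj ?z x\<bar> powr q \<partial>M) powr (2 / q)"
      using square_on_set(2)[OF L2_meas[OF Sadj_L2] hq sets_M[OF D] emeasure_M q2] measure_M[OF D]
      unfolding h2 a_def by simp
    also have "(\<integral>x. \<bar>Sadj ?z x\<bar> powr q \<partial>M) powr (2 / q) = (Lp_norm \<Omega> q (Sadj ?z))\<^sup>2"
      by (simp add: Lp_norm_def power2_eq_square flip: powr_add)
    also have "\<dots> \<le> (\<bar>c\<bar> * Lp_norm \<Omega> 2 ?f)\<^sup>2"
    proof (rule power_mono)
      show "Lp_norm \<Omega> q (Sadj ?z) \<le> \<bar>c\<bar> * Lp_norm \<Omega> 2 ?f"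
        by (rule order_trans[OF c[OF f]]) (auto simp: Lp_norm_2 intro: mult_right_mono)
    qed (simp add: Lp_norm_def)
    also have "\<dots> = c\<^sup>2 * (\<integral>x. (?f x)\<^sup>2 \<partial>M)" by (simp add: Lp_norm_2 power_mult_distrib)
    also have "\<dots> \<le> c\<^sup>2 * (a * W)" using F by (intro mult_left_mono) auto
    finally have H: "(\<integral>x. (?h x)\<^sup>2 \<partial>M) \<le> a * (c\<^sup>2 * (a * W))" using a0 by (simp add: mult_left_mono)
    have "(norm ?z)\<^sup>2 = (\<integral>x. ?f x * ?h x \<partial>M)"
      unfolding norm_S_sq[OF f] by (rule Bochner_Integration.integral_cong) (auto split: split_indicator)
    also have "\<dots> \<le> sqrt (\<integral>x. (?f x)\<^sup>2 \<partial>M) * sqrt (\<integral>x. (?h x)\<^sup>2 \<partial>M)"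
      using Cauchy_Schwarz_integral[OF L2_meas[OF f] L2_meas[OF h] L2_sq[OF f] L2_sq[OF h]] by simp
    also have "\<dots> \<le> sqrt (a * W) * sqrt (a * (c\<^sup>2 * (a * W)))"
      using F H by (intro mult_mono real_sqrt_le_mono) (auto simp: a0 W0)
    also have "\<dots> = sqrt ((a * (\<bar>c\<bar> * W))\<^sup>2 * a)"
      by (simp add: power2_eq_square mult_ac flip: real_sqrt_mult)
    also have "\<dots> = \<bar>c\<bar> * W * (a * sqrt a)"
      using a0 W0 by (simp add: real_sqrt_mult)
    also have "a * sqrt a = a powr (3 / 2)"
    proof -
      have "a powr (1 + 1/2) = a powr 1 * a powr (1/2)" by (rule powr_add)
      then show ?thesis using a0 by (simp add: powr_half_sqrt)
    qed
    also have "\<dots> = measure lebesgue D powr s" by (simp add: a_def s_def powr_powr mult.commute)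
    finally show "(norm ?z)\<^sup>2 \<le> \<bar>c\<bar> * W * measure lebesgue D powr s" .
  qed
  moreover have "1 < s" using q by (simp add: s_def field_simps)
  ultimately show ?thesis using W0 by (intro exI[of _ "\<bar>c\<bar> * W"] exI[of _ s]) auto
qed

end

section \<open>Residuals and the line search\<close>

lemma Lp_norm_1: "Lp_norm \<Omega> 1 f = (\<integral>x. \<bar>f x\<bar> \<partial>lebesgue_on \<Omega>)"
  by (simp add: Lp_norm_def)

context design_problem
begin

definition is_residual :: "'a set \<Rightarrow> ('a \<Rightarrow> real) \<Rightarrow> bool" where
  "is_residual A \<rho> \<longleftrightarrow> A \<in> sets lebesgue \<and> A \<subseteq> \<Omega> \<and>
     (\<exists>u y p. is_solution \<Omega> S Sadj yd g \<beta> A u y p \<and> \<rho> = (\<lambda>x. min (topo_deriv g \<beta> A p x) 0))"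

lemma residual_integrable:
  assumes "is_residual A \<rho>"
  shows "integrable M \<rho>" and "\<rho> x \<le> 0"
proof -
  obtain u y p where A: "A \<in> sets lebesgue" and sol: "is_solution \<Omega> S Sadj yd g \<beta> A u y p"
    and \<rho>: "\<rho> = (\<lambda>x. min (DJ A p x) 0)"
    using assms by (auto simp: is_residual_def DJ_def)
  show "integrable M \<rho>" unfolding \<rho>
    using DJ_integrable[OF A solution_p(1)[OF sol]] by (intro integrable_min) auto
  show "\<rho> x \<le> 0" by (simp add: \<rho>)
qed

text \<open>
  The topological derivative is bounded below by the residual, so its integral over any set of
  changes is at least minus the norm of the residual.
\<close>

lemma optimality_gap:
  assumes res: "is_residual A \<rho>" and B: "B \<in> sets lebesgue"
  shows "val A - Lp_norm \<Omega> 1 \<rho> \<le> val B"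
proof -
  obtain u y p where A: "A \<in> sets lebesgue" and sol: "is_solution \<Omega> S Sadj yd g \<beta> A u y p"
    and \<rho>: "\<rho> = (\<lambda>x. min (DJ A p x) 0)"
    using res by (auto simp: is_residual_def DJ_def)
  have "sym_diff A B \<in> sets lebesgue" using A B by auto
  note int = integrable_ind[OF this DJ_integrable[OF A solution_p(1)[OF sol]]]
  have "(\<integral>x. - \<bar>\<rho> x\<bar> \<partial>M) \<le> (\<integral>x. indicator (sym_diff A B) x * DJ A p x \<partial>M)"
    by (rule integral_mono[OF _ int])
       (use residual_integrable[OF res] in \<open>auto simp: \<rho> split: split_indicator\<close>)
  then show ?thesis using val_lower_bound[OF A B sol] by (simp add: Lp_norm_1)
qed

lemma inf_value_between:
  assumes res: "is_residual A \<rho>"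
  shows "ereal (val A - Lp_norm \<Omega> 1 \<rho>) \<le> inf_value \<Omega> S yd g \<beta>"
    and "inf_value \<Omega> S yd g \<beta> \<le> ereal (val A)"
proof -
  have A: "A \<in> sets lebesgue" "A \<subseteq> \<Omega>" using res by (auto simp: is_residual_def)
  show "ereal (val A - Lp_norm \<Omega> 1 \<rho>) \<le> inf_value \<Omega> S yd g \<beta>"
    unfolding inf_value_def
    by (rule INF_greatest) (use optimality_gap[OF res] in \<open>auto simp: opt_value_eq\<close>)
  show "inf_value \<Omega> S yd g \<beta> \<le> ereal (val A)"
    unfolding inf_value_def opt_value_eq[OF A(1), symmetric] by (rule INF_lower) (use A in auto)
qed

lemma residual_support:
  assumes res: "is_residual A \<rho>"
  shows "{x \<in> \<Omega>. \<rho> x \<noteq> 0} \<in> lmeasurable"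
proof -
  have "{x \<in> space M. \<rho> x \<noteq> 0} \<in> sets M" using residual_integrable(1)[OF res] by measurable
  then have "{x \<in> \<Omega>. \<rho> x \<noteq> 0} \<in> sets lebesgue" using \<Omega>_sets by (auto simp: sets_restrict_space_iff)
  then show ?thesis by (intro fmeasurableI2[OF \<Omega>_lmeasurable]) auto
qed

lemma integral_on_support:
  fixes \<rho> :: "'a \<Rightarrow> real"
  shows "(\<integral>x. indicator {x \<in> \<Omega>. \<rho> x \<noteq> 0} x * \<bar>\<rho> x\<bar> \<partial>M) = (\<integral>x. \<bar>\<rho> x\<bar> \<partial>M)"
  by (rule Bochner_Integration.integral_cong) (auto simp: indicator_def)

lemma max_set_exists:
  assumes res: "is_residual A \<rho>" and t: "0 < t" "t \<le> 1"
  shows "\<exists>D. is_max_set \<Omega> \<rho> t D"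
proof -
  let ?R = "{x \<in> \<Omega>. \<rho> x \<noteq> 0}"
  have norm: "Lp_norm D 1 \<rho> = (\<integral>x. indicator D x * \<bar>\<rho> x\<bar> \<partial>M)" if "D \<in> sets lebesgue" "D \<subseteq> ?R" for D
    unfolding Lp_norm_1 by (rule integral_lebesgue_on_subset) (use that \<Omega>_sets in auto)
  obtain D where D: "D \<in> sets lebesgue" "D \<subseteq> ?R" "measure lebesgue D \<le> t * measure lebesgue ?R"
    "\<And>D'. D' \<in> sets lebesgue \<Longrightarrow> D' \<subseteq> ?R \<Longrightarrow> measure lebesgue D' \<le> t * measure lebesgue ?R \<Longrightarrow>
      (\<integral>x. indicator D' x * \<bar>\<rho> x\<bar> \<partial>M) \<le> (\<integral>x. indicator D x * \<bar>\<rho> x\<bar> \<partial>M)"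
    by (rule bathtub[OF \<Omega>_sets residual_support[OF res] _ integrable_abs[OF residual_integrable(1)[OF res]] abs_ge_zero t])
       auto
  then have "is_max_set \<Omega> \<rho> t D" by (auto simp: is_max_set_def Let_def norm)
  then show ?thesis by blast
qed

text \<open>
  Any maximal set captures at least the fraction \<open>t\<close> of the residual, because the set provided by the
  bathtub principle does.
\<close>

lemma max_set_properties:
  assumes res: "is_residual A \<rho>" and t: "0 < t" "t \<le> 1" and D: "is_max_set \<Omega> \<rho> t D"
  shows "D \<in> sets lebesgue" and "D \<subseteq> {x \<in> \<Omega>. \<rho> x \<noteq> 0}"
    and "measure lebesgue D \<le> t * measure lebesgue \<Omega>"
    and "t * Lp_norm \<Omega> 1 \<rho> \<le> (\<integral>x. indicator D x * \<bar>\<rho> x\<bar> \<partial>M)"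
    and "(\<integral>x. \<bar>indicator (sym_diff A D) x - indicator A x\<bar> * \<rho> x \<partial>M) = - (\<integral>x. indicator D x * \<bar>\<rho> x\<bar> \<partial>M)"
proof -
  let ?R = "{x \<in> \<Omega>. \<rho> x \<noteq> 0}"
  show Ds: "D \<in> sets lebesgue" and DR: "D \<subseteq> ?R" using D by (auto simp: is_max_set_def Let_def)
  have "measure lebesgue D \<le> t * measure lebesgue ?R" using D by (auto simp: is_max_set_def Let_def)
  also have "\<dots> \<le> t * measure lebesgue \<Omega>"
    using t residual_support[OF res] \<Omega>_lmeasurable
    by (intro mult_left_mono measure_mono_fmeasurable) (auto dest: fmeasurableD)
  finally show "measure lebesgue D \<le> t * measure lebesgue \<Omega>" .
  have norm: "Lp_norm D 1 \<rho> = (\<integral>x. indicator D x * \<bar>\<rho> x\<bar> \<partial>M)" if "D \<in> sets lebesgue" "D \<subseteq> ?R" for D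
    unfolding Lp_norm_1 by (rule integral_lebesgue_on_subset) (use that \<Omega>_sets in auto)
  obtain E where E: "E \<in> sets lebesgue" "E \<subseteq> ?R" "measure lebesgue E \<le> t * measure lebesgue ?R"
    "t * (\<integral>x. indicator ?R x * \<bar>\<rho> x\<bar> \<partial>M) \<le> (\<integral>x. indicator E x * \<bar>\<rho> x\<bar> \<partial>M)"
    by (rule bathtub[OF \<Omega>_sets residual_support[OF res] _ integrable_abs[OF residual_integrable(1)[OF res]] abs_ge_zero t])
       auto
  have "Lp_norm E 1 \<rho> \<le> Lp_norm D 1 \<rho>" using D E by (auto simp: is_max_set_def Let_def)
  then show "t * Lp_norm \<Omega> 1 \<rho> \<le> (\<integral>x. indicator D x * \<bar>\<rho> x\<bar> \<partial>M)"
    using E(4) unfolding norm[OF E(1,2)] norm[OF Ds DR] integral_on_support Lp_norm_1[of \<Omega>] by linarith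
  have "\<bar>indicator (sym_diff A D) x - indicator A x\<bar> * \<rho> x = - (indicator D x * \<bar>\<rho> x\<bar>)" for x
    using residual_integrable(2)[OF res, of x] by (auto split: split_indicator)
  then show "(\<integral>x. \<bar>indicator (sym_diff A D) x - indicator A x\<bar> * \<rho> x \<partial>M) = - (\<integral>x. indicator D x * \<bar>\<rho> x\<bar> \<partial>M)"
    by simp
qed

lemma next_set:
  assumes res: "is_residual A \<rho>" and t: "0 < t" "t \<le> 1" and D: "is_max_set \<Omega> \<rho> t D"
  shows "sym_diff A D \<in> sets lebesgue" "sym_diff A D \<subseteq> \<Omega>"
  using max_set_properties(1,2)[OF assms] res by (auto simp: is_residual_def)

lemma accepted_iff:
  assumes res: "is_residual A \<rho>" and t: "0 < t" "t \<le> 1" and D: "is_max_set \<Omega> \<rho> t D"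
  shows "accepted \<Omega> S yd g \<beta> \<sigma> A \<rho> (sym_diff A D) \<longleftrightarrow>
    val (sym_diff A D) \<le> val A - \<sigma> * (\<integral>x. indicator D x * \<bar>\<rho> x\<bar> \<partial>M)"
proof -
  have A: "A \<in> sets lebesgue" using res by (simp add: is_residual_def)
  show ?thesis
    unfolding accepted_def max_set_properties(5)[OF assms] opt_value_eq[OF A] opt_value_eq[OF next_set(1)[OF assms]]
    by simp
qed

lemma accepted_decrease:
  assumes res: "is_residual A \<rho>" and t: "0 < t" "t \<le> 1" and D: "is_max_set \<Omega> \<rho> t D"
    and acc: "accepted \<Omega> S yd g \<beta> \<sigma> A \<rho> (sym_diff A D)" and \<sigma>: "0 < \<sigma>"
  shows "val (sym_diff A D) \<le> val A - \<sigma> * t * Lp_norm \<Omega> 1 \<rho>"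
proof -
  have "\<sigma> * (t * Lp_norm \<Omega> 1 \<rho>) \<le> \<sigma> * (\<integral>x. indicator D x * \<bar>\<rho> x\<bar> \<partial>M)"
    using max_set_properties(4)[OF res t D] \<sigma> by (intro mult_left_mono) auto
  then show ?thesis using acc unfolding accepted_iff[OF res t D] by (simp add: mult.assoc)
qed

text \<open>
  The number \<open>N\<close> must not depend on the current set: this uniformity bounds the step sizes from below
  along the whole run.
\<close>

definition accepts_from :: "real \<Rightarrow> real \<Rightarrow> nat \<Rightarrow> real \<Rightarrow> bool" where
  "accepts_from \<tau> \<sigma> N \<epsilon> \<longleftrightarrow> (\<forall>n\<ge>N. \<forall>A \<rho> D. is_residual A \<rho> \<longrightarrow> \<epsilon> \<le> Lp_norm \<Omega> 1 \<rho> \<longrightarrow>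
     is_max_set \<Omega> \<rho> (\<tau> ^ n) D \<longrightarrow> accepted \<Omega> S yd g \<beta> \<sigma> A \<rho> (sym_diff A D))"

text \<open>
  The predicted decrease is at least of order \<open>t\<close> for the step size \<open>t\<close>, by the bathtub principle,
  whereas the remainder is of order \<open>t powr s\<close> with \<open>s > 1\<close>.
\<close>

lemma line_search_accepts:
  assumes rem: "remainder_bound C s" and C: "0 \<le> C" and s: "1 < s"
    and \<tau>: "0 < \<tau>" "\<tau> < 1" and \<sigma>: "\<sigma> < 1" and \<epsilon>: "0 < \<epsilon>"
  shows "\<exists>N. accepts_from \<tau> \<sigma> N \<epsilon>"
proof -
  define c where "c = 2 * C * measure lebesgue \<Omega> powr s"
  have "(\<lambda>n. c * ((\<tau> ^ n) powr (s - 1))) \<longlonglongrightarrow> c * (0 powr (s - 1))"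
  proof (rule tendsto_mult[OF tendsto_const tendsto_powr'[OF _ tendsto_const]])
    show "(\<lambda>n. \<tau> ^ n) \<longlonglongrightarrow> 0" using \<tau> by (intro LIMSEQ_power_zero) auto
  qed (use s \<tau> in auto)
  then have "(\<lambda>n. c * ((\<tau> ^ n) powr (s - 1))) \<longlonglongrightarrow> 0" using s by simp
  moreover have "0 < (1 - \<sigma>) * \<epsilon>" using \<sigma> \<epsilon> by simp
  ultimately have "eventually (\<lambda>n. c * ((\<tau> ^ n) powr (s - 1)) < (1 - \<sigma>) * \<epsilon>) sequentially"
    by (rule order_tendstoD)
  then obtain N where N: "\<And>n. n \<ge> N \<Longrightarrow> c * ((\<tau> ^ n) powr (s - 1)) < (1 - \<sigma>) * \<epsilon>"
    by (auto simp: eventually_sequentially)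
  have "accepted \<Omega> S yd g \<beta> \<sigma> A \<rho> (sym_diff A D)"
    if n: "n \<ge> N" and res: "is_residual A \<rho>" and le: "\<epsilon> \<le> Lp_norm \<Omega> 1 \<rho>" and D: "is_max_set \<Omega> \<rho> (\<tau> ^ n) D" for n A \<rho> D
  proof -
    define t where "t = \<tau> ^ n"
    have t: "0 < t" "t \<le> 1" using \<tau> by (auto simp: t_def power_le_one)
    note D = D[folded t_def]
    note P = max_set_properties[OF res t D]
    let ?G = "\<integral>x. indicator D x * \<bar>\<rho> x\<bar> \<partial>M"
    obtain u y p where A: "A \<in> sets lebesgue" "A \<subseteq> \<Omega>" and sol: "is_solution \<Omega> S Sadj yd g \<beta> A u y p"
      and \<rho>: "\<rho> = (\<lambda>x. min (DJ A p x) 0)"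
      using res by (auto simp: is_residual_def DJ_def)
    have DD: "sym_diff A (sym_diff A D) = D" by auto
    have "(\<lambda>x. indicator D x * DJ A p x) = (\<lambda>x. - (indicator D x * \<bar>\<rho> x\<bar>))"
    proof
      fix x show "indicator D x * DJ A p x = - (indicator D x * \<bar>\<rho> x\<bar>)"
        using P(2) by (cases "x \<in> D") (auto simp: \<rho>)
    qed
    then have first: "(\<integral>x. indicator D x * DJ A p x \<partial>M) = - ?G" by simp
    have "2 * C * measure lebesgue D powr s \<le> 2 * C * (t * measure lebesgue \<Omega>) powr s"
      using C s P(3) by (intro mult_left_mono powr_mono2) auto
    also have "\<dots> = t * (c * t powr (s - 1))"
      using t by (simp add: c_def powr_mult powr_diff)
    also have "\<dots> \<le> t * ((1 - \<sigma>) * \<epsilon>)"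
      using N[OF n] t by (intro mult_left_mono) (auto simp: t_def)
    also have "\<dots> = (1 - \<sigma>) * (t * \<epsilon>)" by simp
    also have "\<dots> \<le> (1 - \<sigma>) * ?G"
    proof (rule mult_left_mono)
      have "t * \<epsilon> \<le> t * Lp_norm \<Omega> 1 \<rho>" using le t by (intro mult_left_mono) auto
      with P(4) show "t * \<epsilon> \<le> ?G" by linarith
    qed (use \<sigma> in simp)
    finally have rest: "2 * C * measure lebesgue D powr s \<le> (1 - \<sigma>) * ?G" .
    have "val (sym_diff A D) \<le> val A - ?G + 2 * C * measure lebesgue D powr s"
      using val_upper_bound[OF rem C s A next_set[OF res t D] sol] unfolding DD first by simp
    also have "\<dots> \<le> val A - \<sigma> * ?G" using rest by (simp add: algebra_simps)
    finally show ?thesis unfolding accepted_iff[OF res t D] .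
  qed
  then show ?thesis unfolding accepts_from_def by blast
qed

text \<open>
  The invariant of the transition system. In a line search the residual exceeds the tolerance; this
  keeps it positive even if the tolerance is 0.
\<close>

fun state_ok :: "real \<Rightarrow> 'a alg_state \<Rightarrow> bool" where
  "state_ok \<delta> (Iterate k A) \<longleftrightarrow> A \<in> sets lebesgue \<and> A \<subseteq> \<Omega>"
| "state_ok \<delta> (Line_Search k A \<rho> n) \<longleftrightarrow> is_residual A \<rho> \<and> \<delta> < Lp_norm \<Omega> 1 \<rho>"
| "state_ok \<delta> (Returned m A) \<longleftrightarrow> opt_value \<Omega> S yd g \<beta> A \<le> inf_value \<Omega> S yd g \<beta> + ereal \<delta>"

lemma small_residual_near_optimal:
  assumes res: "is_residual A \<rho>" and le: "Lp_norm \<Omega> 1 \<rho> \<le> \<delta>"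
  shows "opt_value \<Omega> S yd g \<beta> A \<le> inf_value \<Omega> S yd g \<beta> + ereal \<delta>"
proof -
  have A: "A \<in> sets lebesgue" using res by (simp add: is_residual_def)
  have "ereal (val A) = ereal (val A - Lp_norm \<Omega> 1 \<rho>) + ereal (Lp_norm \<Omega> 1 \<rho>)" by simp
  also have "\<dots> \<le> inf_value \<Omega> S yd g \<beta> + ereal \<delta>"
    using le by (intro add_mono inf_value_between(1)[OF res]) simp
  finally show ?thesis by (simp add: opt_value_eq[OF A])
qed

lemma state_ok_step:
  assumes step: "alg_step \<Omega> S Sadj yd g \<beta> \<tau> \<sigma> \<delta> st st'" and ok: "state_ok \<delta> st" and \<tau>: "0 < \<tau>" "\<tau> < 1"
  shows "state_ok \<delta> st'"
  using step ok
proof (cases rule: alg_step.cases)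
  case (stop A u y p \<rho> k)
  then have "is_residual A \<rho>" using ok by (auto simp: is_residual_def)
  then show ?thesis using stop small_residual_near_optimal by simp
next
  case (continue A u y p \<rho> k)
  then have "is_residual A \<rho>" using ok by (auto simp: is_residual_def)
  then show ?thesis using continue by simp
next
  case (accept \<rho> n D A' A k)
  then have "is_residual A \<rho>" using ok by simp
  from next_set[OF this _ _ accept(3)] show ?thesis using accept \<tau> by (simp add: power_le_one)
next
  case (reject \<rho> n D A' A k)
  then show ?thesis using ok by simp
qed

lemma no_deadlock:
  assumes ok: "state_ok \<delta> st" and \<tau>: "0 < \<tau>" "\<tau> < 1" and st: "\<And>m A. st \<noteq> Returned m A"
  shows "\<exists>st'. alg_step \<Omega> S Sadj yd g \<beta> \<tau> \<sigma> \<delta> st st'"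
proof (cases st)
  case (Iterate k A)
  with ok have "A \<in> sets lebesgue" by simp
  then obtain u y p where sol: "is_solution \<Omega> S Sadj yd g \<beta> A u y p"
    using solution_exists by blast
  show ?thesis
  proof (cases "Lp_norm \<Omega> 1 (\<lambda>x. min (topo_deriv g \<beta> A p x) 0) \<le> \<delta>")
    case True
    show ?thesis unfolding Iterate by (rule exI, rule alg_step.stop[OF sol refl True])
  next
    case False
    show ?thesis unfolding Iterate by (rule exI, rule alg_step.continue[OF sol refl False])
  qed
next
  case (Line_Search k A \<rho> n)
  then obtain D where "is_max_set \<Omega> \<rho> (\<tau> ^ n) D"
    using max_set_exists[of A \<rho> "\<tau> ^ n"] ok \<tau> by (auto simp: power_le_one)
  then show ?thesis unfolding Line_Search
    using alg_step.accept[OF _ refl] alg_step.reject[OF _ refl]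
    by (cases "accepted \<Omega> S yd g \<beta> \<sigma> A \<rho> (sym_diff A D)") fast+
qed (use st in auto)

end

section \<open>Runs of the algorithm\<close>

text \<open>
  The constants \<open>C\<close> and \<open>r\<close> of the remainder estimate are parameters, so that one convergence proof
  serves both sets of assumptions.
\<close>

locale algorithm_run = design_problem g K \<Omega> S Sadj yd \<beta>
  for g :: "real \<Rightarrow> ereal" and K :: real and \<Omega> :: "'a::euclidean_space set"
    and S :: "('a \<Rightarrow> real) \<Rightarrow> 'y::{real_inner, complete_space}"
    and Sadj :: "'y \<Rightarrow> 'a \<Rightarrow> real" and yd :: 'y and \<beta> :: "'a \<Rightarrow> real" +
  fixes \<tau> \<sigma> \<delta> :: real and A0 :: "'a set" and s :: "nat \<Rightarrow> 'a alg_state" and C r :: real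
  assumes rem: "remainder_bound C r" and C0: "0 \<le> C" and r1: "1 < r"
    and \<tau>: "0 < \<tau>" "\<tau> < 1" and \<sigma>: "0 < \<sigma>" "\<sigma> < 1" and \<delta>: "0 \<le> \<delta>"
    and A0: "A0 \<in> sets lebesgue" "A0 \<subseteq> \<Omega>"
    and exec: "execution (alg_step \<Omega> S Sadj yd g \<beta> \<tau> \<sigma> \<delta>) (Iterate 0 A0) s"
begin

abbreviation "step \<equiv> alg_step \<Omega> S Sadj yd g \<beta> \<tau> \<sigma> \<delta>"

lemma run_cases: "step (s j) (s (Suc j)) \<or> (\<forall>st. \<not> step (s j) st) \<and> s (Suc j) = s j"
  using exec unfolding execution_def by blast

lemma run_ok: "state_ok \<delta> (s j)"
proof (induction j)
  case 0
  then show ?case using exec A0 by (simp add: execution_def)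
next
  case (Suc j)
  from run_cases[of j] show ?case
  proof
    assume "step (s j) (s (Suc j))"
    then show ?thesis by (rule state_ok_step[OF _ Suc \<tau>])
  qed (use Suc in simp)
qed

lemma run_step: "(\<And>m A. s j \<noteq> Returned m A) \<Longrightarrow> step (s j) (s (Suc j))"
  using run_cases[of j] no_deadlock[OF run_ok[of j] \<tau>] by blast

lemma returned_stays: "s j = Returned m A \<Longrightarrow> s (j + i) = Returned m A"
proof (induction i)
  case (Suc i)
  then have e: "s (j + i) = Returned m A" by simp
  then have "\<not> step (s (j + i)) st" for st by (auto elim: alg_step.cases)
  then show ?case using run_cases[of "j + i"] e by simp
qed simp

text \<open>
  After the return the state is constant, so the run visits finitely many states only, whereas
  infinitely many iterations visit pairwise different ones.
\<close>

lemma returns_not_infinite: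
  assumes "returns s m A"
  shows "\<not> infinite_iterates s B \<rho>"
proof
  assume "infinite_iterates s B \<rho>"
  then obtain j where j: "\<And>k. s (j k) = Line_Search k (B k) (\<rho> k) 0"
    unfolding infinite_iterates_def using choice[of "\<lambda>k j. s j = Line_Search k (B k) (\<rho> k) 0"] by blast
  obtain i where i: "s i = Returned m A" using assms by (auto simp: returns_def)
  have "j k < i" for k
  proof (rule ccontr)
    assume "\<not> j k < i"
    then obtain d where "j k = i + d" by (metis le_Suc_ex not_less)
    with returned_stays[OF i, of d] j[of k] show False by simp
  qed
  then have "range j \<subseteq> {..<i}" by auto
  then have "finite (range j)" by (rule finite_subset) simp
  moreover have "inj j" 
  proof (rule injI)
    fix k l assume e: "j k = j l"
    have "Line_Search k (B k) (\<rho> k) 0 = s (j k)" by (rule j[symmetric])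
    also have "\<dots> = s (j l)" by (simp only: e)
    also have "\<dots> = Line_Search l (B l) (\<rho> l) 0" by (rule j)
    finally show "k = l" unfolding alg_state.inject by (elim conjE)
  qed
  ultimately show False using finite_imageD[of j UNIV] by simp
qed

lemma line_search_step:
  assumes "s j = Line_Search k A \<rho> n"
  shows "(\<exists>D. is_max_set \<Omega> \<rho> (\<tau> ^ n) D \<and> accepted \<Omega> S yd g \<beta> \<sigma> A \<rho> (sym_diff A D) \<and>
            s (Suc j) = Iterate (Suc k) (sym_diff A D)) \<or>
         (\<exists>D. is_max_set \<Omega> \<rho> (\<tau> ^ n) D \<and> \<not> accepted \<Omega> S yd g \<beta> \<sigma> A \<rho> (sym_diff A D)) \<and>
            s (Suc j) = Line_Search k A \<rho> (Suc n)"
proof -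
  have "step (Line_Search k A \<rho> n) (s (Suc j))" using run_step[of j] assms by simp
  then show ?thesis by (cases rule: alg_step.cases) auto
qed

lemma line_search_ends:
  assumes "s j = Line_Search k A \<rho> n" and N: "accepts_from \<tau> \<sigma> N (Lp_norm \<Omega> 1 \<rho>)" and "n \<le> N"
  shows "\<exists>j' A'. s j' = Iterate (Suc k) A' \<and> val A' \<le> val A - \<sigma> * \<tau> ^ N * Lp_norm \<Omega> 1 \<rho>"
  using assms(1,3)
proof (induction "N - n" arbitrary: j n rule: less_induct)
  case less
  have res: "is_residual A \<rho>" using run_ok[of j] less.prems by simp
  have \<tau>n: "0 < \<tau> ^ n" "\<tau> ^ n \<le> 1" using \<tau> by (auto simp: power_le_one)
  from line_search_step[OF less.prems(1)] show ?case
  proof (elim disjE exE conjE)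
    fix D assume D: "is_max_set \<Omega> \<rho> (\<tau> ^ n) D" and acc: "accepted \<Omega> S yd g \<beta> \<sigma> A \<rho> (sym_diff A D)"
      and nxt: "s (Suc j) = Iterate (Suc k) (sym_diff A D)"
    have "\<tau> ^ N \<le> \<tau> ^ n" using \<tau> less.prems(2) by (intro power_decreasing) auto
    then have "\<sigma> * \<tau> ^ N * Lp_norm \<Omega> 1 \<rho> \<le> \<sigma> * \<tau> ^ n * Lp_norm \<Omega> 1 \<rho>"
      using \<sigma> by (intro mult_right_mono mult_left_mono) (auto simp: Lp_norm_1)
    then have "val (sym_diff A D) \<le> val A - \<sigma> * \<tau> ^ N * Lp_norm \<Omega> 1 \<rho>"
      using accepted_decrease[OF res \<tau>n D acc \<sigma>(1)] by linarith
    with nxt show ?thesis by blast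
  next
    fix D assume D: "is_max_set \<Omega> \<rho> (\<tau> ^ n) D" "\<not> accepted \<Omega> S yd g \<beta> \<sigma> A \<rho> (sym_diff A D)"
      and nxt: "s (Suc j) = Line_Search k A \<rho> (Suc n)"
    have "n < N"
    proof (rule ccontr)
      assume "\<not> n < N"
      then have "N \<le> n" by simp
      with N[unfolded accepts_from_def] res D show False by blast
    qed
    then show ?thesis using less.hyps[OF _ nxt] by simp
  qed
qed

text \<open>
  The least such number is chosen, so that it does not increase with the residual.
\<close>

definition threshold :: "real \<Rightarrow> nat" where
  "threshold \<epsilon> = (LEAST N. accepts_from \<tau> \<sigma> N \<epsilon>)"

lemma threshold: "0 < \<epsilon> \<Longrightarrow> accepts_from \<tau> \<sigma> (threshold \<epsilon>) \<epsilon>"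
  unfolding threshold_def using LeastI_ex[OF line_search_accepts[OF rem C0 r1 \<tau> \<sigma>(2)]] .

lemma threshold_antimono: "0 < \<epsilon> \<Longrightarrow> \<epsilon> \<le> \<epsilon>' \<Longrightarrow> threshold \<epsilon>' \<le> threshold \<epsilon>"
  using threshold[of \<epsilon>] unfolding threshold_def[of \<epsilon>']
  by (intro Least_le) (auto simp: accepts_from_def)

lemma not_returned_iterates:
  assumes nr: "\<And>m A. \<not> returns s m A"
  obtains A \<rho> where "infinite_iterates s A \<rho>"
    "\<And>k. is_residual (A k) (\<rho> k)" "\<And>k. \<delta> < Lp_norm \<Omega> 1 (\<rho> k)"
    "\<And>k. val (A (Suc k)) \<le> val (A k) - \<sigma> * \<tau> ^ threshold (Lp_norm \<Omega> 1 (\<rho> k)) * Lp_norm \<Omega> 1 (\<rho> k)"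
proof -
  have start: "\<exists>\<rho>. s (Suc j) = Line_Search k A \<rho> 0" if j: "s j = Iterate k A" for j k A
  proof -
    have "step (Iterate k A) (s (Suc j))" using run_step[of j] nr j by (auto simp: returns_def)
    then show ?thesis
      by (cases rule: alg_step.cases) (use nr in \<open>auto simp: returns_def\<close>)
  qed
  define P :: "nat \<Rightarrow> nat \<times> 'a set \<times> ('a \<Rightarrow> real) \<Rightarrow> bool" where
    "P k x \<longleftrightarrow> s (fst x) = Line_Search k (fst (snd x)) (snd (snd x)) 0" for k x
  define Q :: "nat \<times> 'a set \<times> ('a \<Rightarrow> real) \<Rightarrow> nat \<times> 'a set \<times> ('a \<Rightarrow> real) \<Rightarrow> bool" where
    "Q x y \<longleftrightarrow> val (fst (snd y)) \<le> val (fst (snd x))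
       - \<sigma> * \<tau> ^ threshold (Lp_norm \<Omega> 1 (snd (snd x))) * Lp_norm \<Omega> 1 (snd (snd x))" for x y
  have "\<exists>f. \<forall>k. P k (f k) \<and> Q (f k) (f (Suc k))"
  proof (rule dependent_nat_choice)
    have "s 0 = Iterate 0 A0" using exec by (simp add: execution_def)
    from start[OF this] obtain \<rho> where "s (Suc 0) = Line_Search 0 A0 \<rho> 0" by blast
    then have "P 0 (Suc 0, A0, \<rho>)" by (simp add: P_def)
    then show "\<exists>x. P 0 x" ..
  next
    fix x k assume "P k x"
    moreover obtain j A \<rho> where x: "x = (j, A, \<rho>)" by (cases x) auto
    ultimately have j: "s j = Line_Search k A \<rho> 0" by (simp add: P_def)
    have "0 < Lp_norm \<Omega> 1 \<rho>" using run_ok[of j] j \<delta> by simp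
    from line_search_ends[OF j threshold[OF this]] obtain j' A' where j': "s j' = Iterate (Suc k) A'"
      and v: "val A' \<le> val A - \<sigma> * \<tau> ^ threshold (Lp_norm \<Omega> 1 \<rho>) * Lp_norm \<Omega> 1 \<rho>" by auto
    from start[OF j'] obtain \<rho>' where "s (Suc j') = Line_Search (Suc k) A' \<rho>' 0" by blast
    with v have "P (Suc k) (Suc j', A', \<rho>') \<and> Q x (Suc j', A', \<rho>')" by (simp add: P_def Q_def x)
    then show "\<exists>y. P (Suc k) y \<and> Q x y" ..
  qed
  then obtain f where f: "\<And>k. P k (f k)" "\<And>k. Q (f k) (f (Suc k))" by blast
  define A where "A k = fst (snd (f k))" for k
  define \<rho> where "\<rho> k = snd (snd (f k))" for k
  have LS: "s (fst (f k)) = Line_Search k (A k) (\<rho> k) 0" for k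
    using f(1)[of k] by (simp add: A_def \<rho>_def P_def)
  show thesis
  proof (rule that[of A \<rho>])
    show "infinite_iterates s A \<rho>" using LS by (auto simp: infinite_iterates_def)
    show "is_residual (A k) (\<rho> k)" "\<delta> < Lp_norm \<Omega> 1 (\<rho> k)" for k
      using run_ok[of "fst (f k)"] LS[of k] by auto
    show "val (A (Suc k)) \<le> val (A k) - \<sigma> * \<tau> ^ threshold (Lp_norm \<Omega> 1 (\<rho> k)) * Lp_norm \<Omega> 1 (\<rho> k)" for k
      using f(2)[of k] by (simp add: A_def \<rho>_def Q_def)
  qed
qed

text \<open>
  The optimal values decrease and are bounded below, so their decrements tend to 0. A residual of at
  least \<open>\<epsilon>\<close> forces a decrement of at least a fixed positive number, hence the residuals tend to 0, and
  with them the distance of the optimal values to the infimum.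
\<close>

lemma iterates_converge:
  assumes res: "\<And>k. is_residual (A k) (\<rho> k)" and big: "\<And>k. \<delta> < Lp_norm \<Omega> 1 (\<rho> k)"
    and dec: "\<And>k. val (A (Suc k)) \<le> val (A k) - \<sigma> * \<tau> ^ threshold (Lp_norm \<Omega> 1 (\<rho> k)) * Lp_norm \<Omega> 1 (\<rho> k)"
  shows "(\<lambda>k. Lp_norm \<Omega> 1 (\<rho> k)) \<longlonglongrightarrow> 0"
    and "(\<lambda>k. opt_value \<Omega> S yd g \<beta> (A k)) \<longlonglongrightarrow> inf_value \<Omega> S yd g \<beta>"
proof -
  let ?r = "\<lambda>k. Lp_norm \<Omega> 1 (\<rho> k)" and ?v = "\<lambda>k. val (A k)"
  have A: "A k \<in> sets lebesgue" for k using res by (simp add: is_residual_def)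
  have pos: "0 < ?r k" for k using big[of k] \<delta> by simp
  have "?v (Suc k) \<le> ?v k" for k
  proof -
    have "0 \<le> \<sigma> * \<tau> ^ threshold (?r k) * ?r k" using \<sigma> \<tau> pos[of k] by simp
    then show ?thesis using dec[of k] by linarith
  qed
  then have "decseq ?v" by (rule decseq_SucI)
  then obtain l where l: "?v \<longlonglongrightarrow> l"
    using decseq_convergent[of ?v "?v 0 - ?r 0"] optimality_gap[OF res A] by blast
  have "(\<lambda>k. ?v k - ?v (Suc k)) \<longlonglongrightarrow> l - l" by (intro tendsto_diff l LIMSEQ_Suc)
  then have diff: "(\<lambda>k. ?v k - ?v (Suc k)) \<longlonglongrightarrow> 0" by simp
  show r0: "?r \<longlonglongrightarrow> 0"
  proof (rule order_tendstoI)
    fix \<epsilon> :: real assume \<epsilon>: "0 < \<epsilon>"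
    have "0 < \<sigma> * \<tau> ^ threshold \<epsilon> * \<epsilon>" using \<sigma> \<tau> \<epsilon> by simp
    from order_tendstoD(2)[OF diff this] show "eventually (\<lambda>k. ?r k < \<epsilon>) sequentially"
    proof eventually_elim
      case (elim k)
      show ?case
      proof (rule ccontr)
        assume "\<not> ?r k < \<epsilon>"
        then have le: "\<epsilon> \<le> ?r k" by simp
        have "\<tau> ^ threshold \<epsilon> \<le> \<tau> ^ threshold (?r k)"
          using \<tau> threshold_antimono[OF \<epsilon> le] by (intro power_decreasing) auto
        then have "\<sigma> * \<tau> ^ threshold \<epsilon> * \<epsilon> \<le> \<sigma> * \<tau> ^ threshold (?r k) * ?r k"
          using \<sigma> \<tau> \<epsilon> le by (intro mult_mono) auto
        with dec[of k] elim show False by linarith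
      qed
    qed
  next
    fix a :: real assume "a < 0"
    then show "eventually (\<lambda>k. a < ?r k) sequentially"
      by (intro always_eventually allI less_trans[OF _ pos])
  qed
  obtain L where L: "inf_value \<Omega> S yd g \<beta> = ereal L"
    using inf_value_between[OF res[of 0]] by (cases "inf_value \<Omega> S yd g \<beta>") auto
  have "L \<le> ?v k" "?v k \<le> L + ?r k" for k
    using inf_value_between[OF res[of k]] by (auto simp: L)
  moreover have "(\<lambda>k. L + ?r k) \<longlonglongrightarrow> L" using tendsto_add[OF tendsto_const r0, of L] by simp
  ultimately have "?v \<longlonglongrightarrow> L"
    by (intro tendsto_sandwich[of "\<lambda>_. L" ?v sequentially "\<lambda>k. L + ?r k"] always_eventually allI tendsto_const)
  then show "(\<lambda>k. opt_value \<Omega> S yd g \<beta> (A k)) \<longlonglongrightarrow> inf_value \<Omega> S yd g \<beta>"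
    by (simp add: L opt_value_eq[OF A])
qed

lemma dichotomy:
  "((\<exists>m A. returns s m A \<and>
              opt_value \<Omega> S yd g \<beta> A \<le> inf_value \<Omega> S yd g \<beta> + ereal \<delta>)
          \<noteq>
          (\<exists>A \<rho>. infinite_iterates s A \<rho> \<and>
              (\<lambda>k. Lp_norm \<Omega> 1 (\<rho> k)) \<longlonglongrightarrow> 0 \<and>
              (\<lambda>k. opt_value \<Omega> S yd g \<beta> (A k)) \<longlonglongrightarrow> inf_value \<Omega> S yd g \<beta>))
         \<and> (\<delta> > 0 \<longrightarrow> (\<exists>m A. returns s m A))"
proof (cases "\<exists>m A. returns s m A")
  case True
  then obtain m A where ret: "returns s m A" by blast
  then obtain j where "s j = Returned m A" by (auto simp: returns_def)
  then have "opt_value \<Omega> S yd g \<beta> A \<le> inf_value \<Omega> S yd g \<beta> + ereal \<delta>" using run_ok[of j] by simp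
  with ret returns_not_infinite[OF ret] show ?thesis by blast
next
  case False
  then obtain A \<rho> where inf: "infinite_iterates s A \<rho>" and res: "\<And>k. is_residual (A k) (\<rho> k)"
    and big: "\<And>k. \<delta> < Lp_norm \<Omega> 1 (\<rho> k)"
    and dec: "\<And>k. val (A (Suc k)) \<le> val (A k) - \<sigma> * \<tau> ^ threshold (Lp_norm \<Omega> 1 (\<rho> k)) * Lp_norm \<Omega> 1 (\<rho> k)"
    using not_returned_iterates by blast
  note conv = iterates_converge[of A \<rho>, OF res big dec]
  have "\<delta> \<le> 0"
    by (rule LIMSEQ_le_const[OF conv(1)]) (use big in \<open>auto intro: less_imp_le\<close>)
  with False inf conv show ?thesis by auto
qed

end

section \<open>Convergence of topological gradient descent\<close>

theorem theorem6p7: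
  fixes \<Omega> A0 :: "'a::euclidean_space set"
    and S :: "('a \<Rightarrow> real) \<Rightarrow> 'y::{real_inner, complete_space}"
    and Sadj :: "'y \<Rightarrow> 'a \<Rightarrow> real"
    and yd :: 'y
    and g :: "real \<Rightarrow> ereal"
    and \<beta> :: "'a \<Rightarrow> real"
    and \<tau> \<sigma> \<delta> :: real
    and s :: "nat \<Rightarrow> 'a alg_state"
  assumes "\<Omega> \<in> sets lebesgue" and "emeasure lebesgue \<Omega> < \<infinity>"
    and "bounded_linear_from_Lp \<Omega> 2 S" and "is_L2_adjoint \<Omega> S Sadj"
    and "proper_fun g" and "convex_fun g" and "lsc_fun g"
    and "\<forall>u. g u \<ge> 0" and "\<forall>u. g u = 0 \<longleftrightarrow> u = 0"
    and "integrable (lebesgue_on \<Omega>) \<beta>"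
    and "((\<exists>\<mu>>0. strongly_convex_fun \<mu> g) \<and>
          (\<exists>q>6. bounded_linear_Lp_Lp \<Omega> 2 q (\<lambda>u. Sadj (S u)) \<and> Sadj yd \<in> Lp \<Omega> q)) \<or>
         (bounded (edom g) \<and> (\<exists>q>3. bounded_linear_into_Lp \<Omega> q Sadj))"
    and "0 < \<tau>" and "\<tau> < 1" and "0 < \<sigma>" and "\<sigma> < 1" and "\<delta> \<ge> 0"
    and "A0 \<in> sets lebesgue" and "A0 \<subseteq> \<Omega>"
    and "execution (alg_step \<Omega> S Sadj yd g \<beta> \<tau> \<sigma> \<delta>) (Iterate 0 A0) s"
  shows "((\<exists>m A. returns s m A \<and>
              opt_value \<Omega> S yd g \<beta> A \<le> inf_value \<Omega> S yd g \<beta> + ereal \<delta>)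
          \<noteq>
          (\<exists>A \<rho>. infinite_iterates s A \<rho> \<and>
              (\<lambda>k. Lp_norm \<Omega> 1 (\<rho> k)) \<longlonglongrightarrow> 0 \<and>
              (\<lambda>k. opt_value \<Omega> S yd g \<beta> (A k)) \<longlonglongrightarrow> inf_value \<Omega> S yd g \<beta>))
         \<and> (\<delta> > 0 \<longrightarrow> (\<exists>m A. returns s m A))"
proof -
  have nn: "\<And>u. 0 \<le> g u" and g0: "g 0 = 0" using assms(8,9) by auto
  have problem: "design_problem g K \<Omega> S Sadj \<beta>"
    if "0 < K" "\<And>u. g u < \<infinity> \<Longrightarrow> u\<^sup>2 \<le> K * (1 + real_of_ereal (g u))" for K
    by (intro design_problem.intro convex_penalty.intro design_problem_axioms.intro assms nn g0 that)
  have "\<exists>K C r. design_problem g K \<Omega> S Sadj \<beta> \<and> 0 \<le> C \<and> 1 < r \<and>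
      design_problem.remainder_bound g \<Omega> S Sadj yd \<beta> C r"
    using assms(11)
  proof (elim disjE conjE exE)
    fix \<mu> q :: real
    assume \<mu>: "0 < \<mu>" and sc: "strongly_convex_fun \<mu> g" and q: "6 < q"
      and bl: "bounded_linear_Lp_Lp \<Omega> 2 q (\<lambda>u. Sadj (S u))" "Sadj yd \<in> Lp \<Omega> q"
    have dp: "design_problem g (2 / \<mu>) \<Omega> S Sadj \<beta>"
    proof (rule problem)
      fix u assume u: "g u < \<infinity>"
      have "\<mu> / 2 * u\<^sup>2 \<le> real_of_ereal (g u)"
        by (rule strongly_convex_quadratic_growth[OF sc nn g0 u])
      then show "u\<^sup>2 \<le> 2 / \<mu> * (1 + real_of_ereal (g u))" using \<mu> by (simp add: field_simps)
    qed (use \<mu> in simp)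
    interpret design_problem g "2 / \<mu>" \<Omega> S Sadj yd \<beta> by (rule dp)
    obtain C r where "0 \<le> C" "1 < r" "remainder_bound C r"
      using remainder_bound_strongly_convex[OF \<mu> sc q bl] by (elim exE conjE)
    then show ?thesis using dp by blast
  next
    fix q :: real
    assume bdd: "bounded (edom g)" and q: "3 < q" and bl: "bounded_linear_into_Lp \<Omega> q Sadj"
    obtain B where B: "\<And>u. g u < \<infinity> \<Longrightarrow> \<bar>u\<bar> \<le> B"
      using bdd by (auto simp: bounded_iff edom_def)
    have dp: "design_problem g (B\<^sup>2 + 1) \<Omega> S Sadj \<beta>"
    proof (rule problem)
      show "0 < B\<^sup>2 + 1" by (simp add: add_nonneg_pos)
      fix u assume u: "g u < \<infinity>"
      have "u\<^sup>2 \<le> B\<^sup>2" using power_mono[OF B[OF u], of 2] by simp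
      moreover have "0 \<le> (B\<^sup>2 + 1) * real_of_ereal (g u)" by (simp add: nn real_of_ereal_pos)
      ultimately show "u\<^sup>2 \<le> (B\<^sup>2 + 1) * (1 + real_of_ereal (g u))" by (simp add: distrib_left)
    qed
    interpret design_problem g "B\<^sup>2 + 1" \<Omega> S Sadj yd \<beta> by (rule dp)
    have "2 < q" using q by simp
    obtain C r where "0 \<le> C" "1 < r" "remainder_bound C r"
      using remainder_bound_bounded_domain[OF bdd \<open>2 < q\<close> bl] by (elim exE conjE)
    then show ?thesis using dp by blast
  qed
  then obtain K C r where problem: "design_problem g K \<Omega> S Sadj \<beta>" and C: "0 \<le> C" "1 < r"
    and rem: "design_problem.remainder_bound g \<Omega> S Sadj yd \<beta> C r" by (elim exE conjE)
  interpret algorithm_run g K \<Omega> S Sadj yd \<beta> \<tau> \<sigma> \<delta> A0 s C r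
    by (intro algorithm_run.intro algorithm_run_axioms.intro problem C rem assms)
  show ?thesis by (rule dichotomy)
qed

end
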